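(* For $\vec{x}=(a,b,c,d,e,f,g)^T\in V$, $$S(g)\,A(1+a-f,1+b-f,1+c-f,1+d-f)\,A(1-a,e-a,f-a,g-a)\,K_{p_0}(\vec{x})$$ $$+\,S(f-a)\,A(a,b,c,d)\,A(g-a,g-b,g-c,g-d)\,L_{\overline{6}}(\vec{x})-B_4(\vec{x})\,L_5(\vec{x})=0.$$
   Context: $V=\{(a,b,c,d,e,f,g)^T\in\mathbb{C}^7: e+f+g-a-b-c-d=1\}$. ${}_4F_3\left[\begin{smallmatrix}a,b,c,d\\ e,f,g\end{smallmatrix};1\right]=\sum_{n\ge0}\frac{(a)_n(b)_n(c)_n(d)_n}{n!(e)_n(f)_n(g)_n}$, with $(a)_n$ the rising factorial. For $(a,b,c,d,e,f,g)^T\in V$, $$K(a;b,c,d;e,f,g)=\frac{{}_4F_3\left[\begin{smallmatrix}a,b,c,d\\ e,f,g\end{smallmatrix};1\right]}{\sin\pi a\,\Gamma(a)\Gamma(1+a-e)\Gamma(1+a-f)\Gamma(1+a-g)\Gamma(e)\Gamma(f)\Gamma(g)}+\frac{{}_4F_3\left[\begin{smallmatrix}a,1+a-e,1+a-f,1+a-g\\ 1+a-b,1+a-c,1+a-d\end{smallmatrix};1\right]}{\sin\pi a\,\Gamma(a)\Gamma(b)\Gamma(c)\Gamma(d)\Gamma(1+a-b)\Gamma(1+a-c)\Gamma(1+a-d)},$$ $$L(a,b,c,d;e;f,g)=\frac{{}_4F_3\left[\begin{smallmatrix}a,b,c,d\\ e,f,g\end{smallmatrix};1\right]}{\sin\pi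 e\,\Gamma(1+a-e)\Gamma(1+b-e)\Gamma(1+c-e)\Gamma(1+d-e)\Gamma(e)\Gamma(f)\Gamma(g)}-\frac{{}_4F_3\left[\begin{smallmatrix}1+a-e,1+b-e,1+c-e,1+d-e\\ 2-e,1+f-e,1+g-e\end{smallmatrix};1\right]}{\sin\pi e\,\Gamma(a)\Gamma(b)\Gamma(c)\Gamma(d)\Gamma(2-e)\Gamma(1+f-e)\Gamma(1+g-e)}.$$ Notation: $S(a_1,\dots,a_n)=\sin\pi a_1\cdots\sin\pi a_n$; $A(x,y,z,w)=\frac{1}{\Gamma(x)\Gamma(y)\Gamma(z)\Gamma(w)}$ (with $1/\Gamma=0$ at nonpositive integers). The relation is asserted for those $\vec{x}\in V$ at which the $K$ and $L$ functions occurring are defined (no lower parameter of an occurring series is a nonpositive integer, no sine in an occurring denominator vanishes). Here $K_{p_0}(\vec{x})=K(a;b,c,d;e,f,g)$, $L_{\overline{6}}(\vec{x})=L(1-a,1-b,1-c,1-d;2-e;2-f,2-g)$, $L_5(\vec{x})=L(a,b,c,d;f;e,g)$, and $B_4(\vec{x})=\pi^{-4}S(f-a,g-a)\,[S(b,c,d)+S(e-a,f,g)]$. *)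

theory Defs
  imports "HOL-Analysis.Analysis"
begin

type_synonym param = "complex \<times> complex \<times> complex \<times> complex \<times> complex \<times> complex \<times> complex"

definition V :: "param set" where
  "V = {(a, b, c, d, e, f, g). e + f + g - a - b - c - d = 1}"

definition F43 ::
  "complex \<Rightarrow> complex \<Rightarrow> complex \<Rightarrow> complex \<Rightarrow> complex \<Rightarrow> complex \<Rightarrow> complex \<Rightarrow> complex" where
  "F43 a b c d e f g =
     (\<Sum>n. (pochhammer a n * pochhammer b n * pochhammer c n * pochhammer d n) /
           (fact n * pochhammer e n * pochhammer f n * pochhammer g n))"

definition sinpi :: "complex list \<Rightarrow> complex" where
  "sinpi xs = (\<Prod>x\<leftarrow>xs. sin (of_real pi * x))"

(* Reciprocal Gamma factors are written with the entire function rGamma = 1/Gamma,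
   which is 0 at the nonpositive integers. *)

definition A4 :: "complex \<Rightarrow> complex \<Rightarrow> complex \<Rightarrow> complex \<Rightarrow> complex" where
  "A4 x y z w = rGamma x * rGamma y * rGamma z * rGamma w"

(* K_fun a b c d e f g is K(a; b, c, d; e, f, g). *)
definition K_fun ::
  "complex \<Rightarrow> complex \<Rightarrow> complex \<Rightarrow> complex \<Rightarrow> complex \<Rightarrow> complex \<Rightarrow> complex \<Rightarrow> complex" where
  "K_fun a b c d e f g =
     F43 a b c d e f g / sin (of_real pi * a) *
       (rGamma a * rGamma (1 + a - e) * rGamma (1 + a - f) * rGamma (1 + a - g) *
        rGamma e * rGamma f * rGamma g)
   + F43 a (1 + a - e) (1 + a - f) (1 + a - g) (1 + a - b) (1 + a - c) (1 + a - d)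
       / sin (of_real pi * a) *
       (rGamma a * rGamma b * rGamma c * rGamma d *
        rGamma (1 + a - b) * rGamma (1 + a - c) * rGamma (1 + a - d))"

definition K_defined ::
  "complex \<Rightarrow> complex \<Rightarrow> complex \<Rightarrow> complex \<Rightarrow> complex \<Rightarrow> complex \<Rightarrow> complex \<Rightarrow> bool" where
  "K_defined a b c d e f g \<longleftrightarrow>
     sin (of_real pi * a) \<noteq> 0 \<and>
     e \<notin> \<int>\<^sub>\<le>\<^sub>0 \<and> f \<notin> \<int>\<^sub>\<le>\<^sub>0 \<and> g \<notin> \<int>\<^sub>\<le>\<^sub>0 \<and>
     1 + a - b \<notin> \<int>\<^sub>\<le>\<^sub>0 \<and> 1 + a - c \<notin> \<int>\<^sub>\<le>\<^sub>0 \<and> 1 + a - d \<notin> \<int>\<^sub>\<le>\<^sub>0"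

(* L_fun a b c d e f g is L(a, b, c, d; e; f, g). *)
definition L_fun ::
  "complex \<Rightarrow> complex \<Rightarrow> complex \<Rightarrow> complex \<Rightarrow> complex \<Rightarrow> complex \<Rightarrow> complex \<Rightarrow> complex" where
  "L_fun a b c d e f g =
     F43 a b c d e f g / sin (of_real pi * e) *
       (rGamma (1 + a - e) * rGamma (1 + b - e) * rGamma (1 + c - e) * rGamma (1 + d - e) *
        rGamma e * rGamma f * rGamma g)
   - F43 (1 + a - e) (1 + b - e) (1 + c - e) (1 + d - e) (2 - e) (1 + f - e) (1 + g - e)
       / sin (of_real pi * e) *
       (rGamma a * rGamma b * rGamma c * rGamma d *
        rGamma (2 - e) * rGamma (1 + f - e) * rGamma (1 + g - e))"

definition L_defined ::
  "complex \<Rightarrow> complex \<Rightarrow> complex \<Rightarrow> complex \<Rightarrow> complex \<Rightarrow> complex \<Rightarrow> complex \<Rightarrow> bool" where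
  "L_defined a b c d e f g \<longleftrightarrow>
     sin (of_real pi * e) \<noteq> 0 \<and>
     e \<notin> \<int>\<^sub>\<le>\<^sub>0 \<and> f \<notin> \<int>\<^sub>\<le>\<^sub>0 \<and> g \<notin> \<int>\<^sub>\<le>\<^sub>0 \<and>
     2 - e \<notin> \<int>\<^sub>\<le>\<^sub>0 \<and> 1 + f - e \<notin> \<int>\<^sub>\<le>\<^sub>0 \<and> 1 + g - e \<notin> \<int>\<^sub>\<le>\<^sub>0"

fun K_p0 :: "param \<Rightarrow> complex" where
  "K_p0 (a, b, c, d, e, f, g) = K_fun a b c d e f g"

fun K_p0_defined :: "param \<Rightarrow> bool" where
  "K_p0_defined (a, b, c, d, e, f, g) \<longleftrightarrow> K_defined a b c d e f g"

fun L_6bar :: "param \<Rightarrow> complex" where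
  "L_6bar (a, b, c, d, e, f, g) =
     L_fun (1 - a) (1 - b) (1 - c) (1 - d) (2 - e) (2 - f) (2 - g)"

fun L_6bar_defined :: "param \<Rightarrow> bool" where
  "L_6bar_defined (a, b, c, d, e, f, g) \<longleftrightarrow>
     L_defined (1 - a) (1 - b) (1 - c) (1 - d) (2 - e) (2 - f) (2 - g)"

fun L_5 :: "param \<Rightarrow> complex" where
  "L_5 (a, b, c, d, e, f, g) = L_fun a b c d f e g"

fun L_5_defined :: "param \<Rightarrow> bool" where
  "L_5_defined (a, b, c, d, e, f, g) \<longleftrightarrow> L_defined a b c d f e g"

fun B_4 :: "param \<Rightarrow> complex" where
  "B_4 (a, b, c, d, e, f, g) =
     sinpi [f - a, g - a] * (sinpi [b, c, d] + sinpi [e - a, f, g]) / of_real pi ^ 4"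

end

theory Submission
  imports Defs "HOL-Complex_Analysis.Complex_Analysis" "HOL-Real_Asymp.Real_Asymp"
begin

text \<open>
  Write \<open>F43_reg\<close> for the series multiplied by the reciprocal Gamma factors of its lower parameters; this is
  entire along every line in the parameter space, so identities may be proved near one generic
  point and continued. Two ingredients suffice.

  First, the two-term relation \<open>L(a,b,c,d;f;e,g) = L(a,b,g-c,g-d;f-s;e-s,g)\<close> with \<open>s = c+d-g\<close>. For
  \<open>1/2 < Re s < 1\<close> Euler's transformation of the factor \<open>(c)\<^sub>n(d)\<^sub>n/(n!(g)\<^sub>n)\<close> turns the series into a double
  series whose inner sum is a nonterminating Saalschuetzian 3F2; as a function of the outer index it satisfies
  an inhomogeneous first-order recurrence, and so does a second, explicit 3F2. Comparing asymptotics leaves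
  the transformed series plus a double series \<open>J\<close>. The companion series of the transformed \<open>L\<close> produces the
  same \<open>J\<close> with the two summations exchanged, and eliminating \<open>J\<close> gives the relation. Three applications turn
  \<open>L(1-a,1-b,1-c,1-d;2-e;2-f,2-g)\<close> into an \<open>L\<close> built from the two series based at \<open>1-f\<close> and \<open>1-g\<close>.

  Second, the bilateral sum of \<open>\<Prod> 1 / (\<Gamma>(1 - a\<^sub>i - t) \<Gamma>(e\<^sub>i + t))\<close> over \<open>t \<in> w + \<int>\<close> is entire, has period 1 and is
  \<open>o(exp(4 pi |Im w|))\<close>, hence a trigonometric polynomial of degree 1 in \<open>exp(2 pi i w)\<close>. Its values at any four
  points are therefore linearly related, and at \<open>0\<close>, \<open>1-f\<close>, \<open>1-g\<close>, \<open>-a\<close> they are precisely the four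
  series that occur.
\<close>

section \<open>Asymptotics of Gamma quotients\<close>

text \<open>K is built on the base points \<open>0\<close> and \<open>-a\<close> of the bilateral
  sum, and \<open>L_5\<close> on \<open>0\<close> and \<open>1-f\<close>. The two series of
  \<open>L_6bar\<close> are not among its values as they stand, which is why the two-term relation
  is needed: it trades them for the pair \<open>1-f\<close>, \<open>1-g\<close>. Four values in a
  three-dimensional space then leave one relation. Multiplied by suitable Gamma products it cancels
  the series based at \<open>-a\<close> and \<open>1-g\<close>. The bracket of \<open>B_4\<close>
  appears at once as the coefficient of the series based at \<open>0\<close>, and a trigonometric
  identity shows that the series based at \<open>1-f\<close> carries the same bracket. The degree
  bound is delicate: growth of exact order exp(4 pi |Im w|) would admit degree 2, hence a
  five-dimensional space. The decay |t|^(-2) forced by the balance condition is what gains the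
  missing power of |Im w|.\<close>

lemma not_nonpos_Ints_add_nat:
  "x \<notin> \<int>\<^sub>\<le>\<^sub>0 \<Longrightarrow> x + of_nat n \<notin> \<int>\<^sub>\<le>\<^sub>0"
  by (metis add_diff_cancel_right' nonpos_Ints_diff_Nats of_nat_in_Nats)

text \<open>Euler's limit \<open>rGamma_series\<close>, with n^z replaced by (n+1)^z and the surplus
  factor z + n divided out. The base \<open>Suc n\<close> keeps every power nonzero, so that the
  later bounds hold from n = 0 on.\<close>

lemma Gamma_asymp:
  fixes z :: complex
  assumes "z \<notin> \<int>\<^sub>\<le>\<^sub>0"
  shows "(\<lambda>n. Gamma (z + of_nat n) / (fact n * of_nat (Suc n) powr (z - 1))) \<longlonglongrightarrow> 1"
proof -
  have 1: "(\<lambda>n. rGamma_series z n * Gamma z) \<longlonglongrightarrow> rGamma z * Gamma z"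
    by (intro tendsto_intros rGamma_series_LIMSEQ)
  have nz: "Gamma z \<noteq> 0" using assms by (simp add: Gamma_eq_zero_iff)
  have 2: "(\<lambda>n. complex_of_real (ln (real n) - ln (real (Suc n)))) \<longlonglongrightarrow> of_real 0"
    by (intro tendsto_of_real) real_asymp
  have 3: "(\<lambda>n. exp (z * complex_of_real (ln (real n) - ln (real (Suc n))))) \<longlonglongrightarrow> exp (z * of_real 0)"
    by (intro tendsto_intros 2)
  have inv: "(\<lambda>n. inverse (complex_of_real (real (Suc n)))) \<longlonglongrightarrow> of_real 0"
    unfolding of_real_inverse [symmetric] by (intro tendsto_of_real) real_asymp
  have 4: "(\<lambda>n. 1 / (1 + (z - 1) * inverse (complex_of_real (real (Suc n))))) \<longlonglongrightarrow> 1 / (1 + (z - 1) * of_real 0)"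
    by (intro tendsto_intros inv) auto
  have 5: "(\<lambda>n. rGamma_series z n * Gamma z * exp (z * complex_of_real (ln (real n) - ln (real (Suc n))))
      * (1 / (1 + (z - 1) * inverse (complex_of_real (real (Suc n)))))) \<longlonglongrightarrow> 
      rGamma z * Gamma z * exp (z * of_real 0) * (1 / (1 + (z - 1) * of_real 0))"
    by (intro tendsto_intros 1 3 4)
  have "eventually (\<lambda>n. rGamma_series z n * Gamma z * exp (z * complex_of_real (ln (real n) - ln (real (Suc n))))
      * (1 / (1 + (z - 1) * inverse (complex_of_real (real (Suc n))))) = 
      Gamma (z + of_nat n) / (fact n * of_nat (Suc n) powr (z - 1))) sequentially"
    using eventually_gt_at_top[of 0]
  proof eventually_elim
    case (elim n)
    have zn: "z + of_nat n \<noteq> 0" using assms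
      by (metis add_eq_0_iff2 minus_of_nat_in_nonpos_Ints)
    have p: "pochhammer z (n+1) = (z + of_nat n) * Gamma (z + of_nat n) / Gamma z"
      using pochhammer_Gamma[OF assms, of "n+1"] Gamma_plus1[OF not_nonpos_Ints_add_nat[OF assms, of n]]
      by (simp add: add_ac)
    define N where "N = of_nat (Suc n) powr (z - 1)"
    have nz': "of_nat (Suc n) \<noteq> (0::complex)" unfolding of_nat_eq_0_iff by simp
    have N: "of_nat (Suc n) powr (z - 1) = N" "N \<noteq> 0" using nz' by (auto simp: N_def simp del: of_nat_Suc)
    have e: "exp (z * complex_of_real (ln (real n) - ln (real (Suc n)))) =
       exp (z * of_real (ln (real n))) / (N * of_nat (Suc n))"
    proof -
      have "N = exp ((z - 1) * of_real (ln (real (Suc n))))"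
        unfolding N_def powr_def using Ln_of_nat[of "Suc n"] nz' by (simp del: of_nat_Suc)
      moreover have "(of_nat (Suc n) :: complex) = exp (of_real (ln (real (Suc n))))"
        by (metis exp_of_real exp_ln of_real_of_nat_eq of_nat_0_less_iff zero_less_Suc)
      ultimately have "N * of_nat (Suc n) = exp (z * of_real (ln (real (Suc n))))"
        by (simp add: exp_add [symmetric] algebra_simps)
      then show ?thesis by (simp add: right_diff_distrib exp_diff)
    qed
    have q: "1 / (1 + (z - 1) * inverse (complex_of_real (real (Suc n)))) = of_nat (Suc n) / (z + of_nat n)"
    proof -
      define S where "S = complex_of_real (real (Suc n))"
      have "S \<noteq> 0" unfolding S_def of_real_eq_0_iff of_nat_eq_0_iff by simp
      have S: "z + of_nat n = S + (z - 1)" by (simp add: S_def)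
      have "1 / (1 + w * inverse S) = S / (S + w)" if "S + w \<noteq> 0" for w
        using that \<open>S \<noteq> 0\<close> by (simp add: field_simps)
      from this[of "z - 1"] show ?thesis using zn unfolding S by (simp only: S_def of_real_of_nat_eq simp_thms)
    qed
    show ?case
      unfolding rGamma_series_def p N(1) e q using nz zn N(2) by (simp add: divide_simps del: of_nat_Suc)
  qed
  from Lim_transform_eventually[OF 5 this] show ?thesis using nz by (simp add: rGamma_inverse_Gamma)
qed

text \<open>The building block of the two-term part. Unlike a quotient of Pochhammer symbols it is
  asymptotic to (n+1)^(x-y) with constant exactly 1, so limits carry no Gamma factors. For y = 1 it
  is Gamma x times (x)_n / n!.\<close>

definition gamma_quot :: "complex \<Rightarrow> complex \<Rightarrow> nat \<Rightarrow> complex" where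
  "gamma_quot x y n = Gamma (x + of_nat n) * rGamma (y + of_nat n)"

lemma gamma_quot_asymp:
  assumes "x \<notin> \<int>\<^sub>\<le>\<^sub>0" "y \<notin> \<int>\<^sub>\<le>\<^sub>0"
  shows "(\<lambda>n. gamma_quot x y n * of_nat (Suc n) powr (y - x)) \<longlonglongrightarrow> 1"
proof -
  have "(\<lambda>n. (Gamma (x + of_nat n) / (fact n * of_nat (Suc n) powr (x - 1))) /
      (Gamma (y + of_nat n) / (fact n * of_nat (Suc n) powr (y - 1)))) \<longlonglongrightarrow> 1 / 1"
    by (intro tendsto_intros Gamma_asymp assms) auto
  also have "(\<lambda>n. (Gamma (x + of_nat n) / (fact n * of_nat (Suc n) powr (x - 1))) /
      (Gamma (y + of_nat n) / (fact n * of_nat (Suc n) powr (y - 1)))) = 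
      (\<lambda>n. gamma_quot x y n * of_nat (Suc n) powr (y - x))"
  proof
    fix n
    have "y - x = (y - 1) - (x - 1)" by simp
    then have *: "(of_nat (Suc n) :: complex) powr (y - x) = of_nat (Suc n) powr (y - 1) / of_nat (Suc n) powr (x - 1)"
      by (metis powr_diff)
    show "(Gamma (x + of_nat n) / (fact n * of_nat (Suc n) powr (x - 1))) /
      (Gamma (y + of_nat n) / (fact n * of_nat (Suc n) powr (y - 1))) = 
      gamma_quot x y n * of_nat (Suc n) powr (y - x)"
      unfolding * by (simp add: gamma_quot_def rGamma_inverse_Gamma field_simps del: of_nat_Suc)
  qed
  finally show ?thesis by simp
qed

lemma norm_Suc_powr: "norm (of_nat (Suc n) powr z :: complex) = real (Suc n) powr Re z"
  by (subst norm_powr_real_powr) (auto simp del: of_nat_Suc)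

lemma gamma_quot_bound:
  assumes "x \<notin> \<int>\<^sub>\<le>\<^sub>0" "y \<notin> \<int>\<^sub>\<le>\<^sub>0"
  obtains C where "C \<ge> 0" "\<And>n. norm (gamma_quot x y n) \<le> C * real (Suc n) powr Re (x - y)"
proof -
  from gamma_quot_asymp[OF assms] have "Bseq (\<lambda>n. gamma_quot x y n * of_nat (Suc n) powr (y - x))"
    by (intro convergent_imp_Bseq) (auto simp: convergent_def)
  then obtain C where C: "C > 0" "\<And>n. norm (gamma_quot x y n * of_nat (Suc n) powr (y - x)) \<le> C"
    by (auto elim: BseqE)
  have "norm (gamma_quot x y n) \<le> C * real (Suc n) powr Re (x - y)" for n
  proof -
    have "norm (gamma_quot x y n) * real (Suc n) powr Re (y - x) \<le> C"
      using C(2)[of n] by (simp add: norm_mult norm_Suc_powr del: of_nat_Suc)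
    then have "norm (gamma_quot x y n) \<le> C / real (Suc n) powr Re (y - x)"
      by (simp add: pos_le_divide_eq del: of_nat_Suc)
    also have "\<dots> = C * real (Suc n) powr Re (x - y)"
      by (metis minus_diff_eq powr_minus_divide uminus_complex.sel(1) times_divide_eq_right mult.right_neutral)
    finally show ?thesis .
  qed
  with C(1) show ?thesis by (intro that[of C]) auto
qed

lemma gamma_quot_Suc:
  assumes "x \<notin> \<int>\<^sub>\<le>\<^sub>0"
  shows "(y + of_nat n) * gamma_quot x y (Suc n) = (x + of_nat n) * gamma_quot x y n"
proof -
  have "Gamma (x + of_nat n + 1) = (x + of_nat n) * Gamma (x + of_nat n)"
    by (rule Gamma_plus1[OF not_nonpos_Ints_add_nat[OF assms]])
  moreover have "(y + of_nat n) * rGamma (y + of_nat n + 1) = rGamma (y + of_nat n)" by (rule rGamma_plus1)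
  ultimately show ?thesis by (simp add: gamma_quot_def add.assoc add.commute[of 1])
qed

section \<open>Summability and regrouping of double series\<close>

lemma summable_Suc_powr: "s < -1 \<Longrightarrow> summable (\<lambda>n. real (Suc n) powr s)"
  by (subst summable_Suc_iff) (simp add: summable_real_powr_iff)

text \<open>A majorant of product form makes the family absolutely summable over all pairs, so rows,
  columns and antidiagonals give the same sum. The exchange of rows and columns serves the double
  series \<open>J\<close>, the antidiagonals serve the Euler convolution.\<close>

lemma double_suminf:
  fixes f :: "nat \<Rightarrow> nat \<Rightarrow> complex"
  assumes le: "\<And>k m. norm (f k m) \<le> M k * N m" and M: "summable M" and N: "summable N"
    and pos: "\<And>k. M k \<ge> 0" "\<And>k. N k \<ge> 0"
  shows "summable (\<lambda>m. f k m)" "summable (\<lambda>k. f k m)" "summable (\<lambda>k. \<Sum>m. f k m)"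
    "(\<Sum>k. \<Sum>m. f k m) = (\<Sum>m. \<Sum>k. f k m)"
    "(\<lambda>n. \<Sum>k\<le>n. f k (n - k)) sums (\<Sum>k. \<Sum>m. f k m)"
proof -
  have row: "summable (\<lambda>m. norm (f k m))" for k
    by (rule summable_comparison_test'[of "\<lambda>m. M k * N m" 0]) (use le N in \<open>auto intro: summable_mult\<close>)
  have col: "summable (\<lambda>k. norm (f k m))" for m
    by (rule summable_comparison_test'[of "\<lambda>k. M k * N m" 0]) (use le M in \<open>auto intro: summable_mult2\<close>)
  show r1: "summable (\<lambda>m. f k m)" for k using row by (rule summable_norm_cancel)
  show c1: "summable (\<lambda>k. f k m)" for m using col by (rule summable_norm_cancel)
  have Ms: "M summable_on UNIV" and Ns: "N summable_on UNIV"
    using M N pos by (auto intro!: norm_summable_imp_summable_on)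
  have MN: "(\<lambda>(k,m). M k * N m) summable_on UNIV \<times> UNIV"
    by (rule summable_on_SigmaI[where g = "\<lambda>k. M k * infsum N UNIV"])
      (use Ms Ns pos in \<open>auto intro!: has_sum_cmult_right summable_on_cmult_left has_sum_infsum\<close>)
  have "(\<lambda>x. norm ((\<lambda>(k,m). f k m) x)) summable_on UNIV \<times> UNIV"
    by (rule Infinite_Sum.abs_summable_on_comparison_test'[OF MN]) (use le in auto)
  then have S: "(\<lambda>(k,m). f k m) summable_on UNIV \<times> UNIV" by (rule abs_summable_summable)
  have norm_row: "norm (\<Sum>m. f k m) \<le> M k * suminf N" for k
  proof -
    have "norm (\<Sum>m. f k m) \<le> (\<Sum>m. norm (f k m))" by (rule summable_norm[OF row])
    also have "\<dots> \<le> (\<Sum>m. M k * N m)" by (intro suminf_le le row summable_mult N)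
    finally show ?thesis by (simp add: suminf_mult N)
  qed
  have norm_col: "norm (\<Sum>k. f k m) \<le> suminf M * N m" for m
  proof -
    have "norm (\<Sum>k. f k m) \<le> (\<Sum>k. norm (f k m))" by (rule summable_norm[OF col])
    also have "\<dots> \<le> (\<Sum>k. M k * N m)" by (intro suminf_le le col summable_mult2 M)
    finally show ?thesis by (simp add: suminf_mult2 [OF M])
  qed
  have sr: "summable (\<lambda>k. norm (\<Sum>m. f k m))"
    by (rule summable_comparison_test'[of "\<lambda>k. M k * suminf N" 0]) (use norm_row M in \<open>auto intro: summable_mult2\<close>)
  have sc: "summable (\<lambda>m. norm (\<Sum>k. f k m))"
    by (rule summable_comparison_test'[of "\<lambda>m. suminf M * N m" 0]) (use norm_col N in \<open>auto intro: summable_mult\<close>)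
  show "summable (\<lambda>k. \<Sum>m. f k m)" using sr by (rule summable_norm_cancel)
  have iR: "infsum (f k) UNIV = (\<Sum>m. f k m)" for k
    by (rule infsumI, rule norm_summable_imp_has_sum[OF row]) (rule summable_sums[OF r1])
  have iC: "infsum (\<lambda>k. f k m) UNIV = (\<Sum>k. f k m)" for m
    by (rule infsumI, rule norm_summable_imp_has_sum[OF col]) (rule summable_sums[OF c1])
  have 1: "infsum (\<lambda>(k,m). f k m) (UNIV \<times> UNIV) = (\<Sum>k. \<Sum>m. f k m)"
    unfolding infsum_Sigma'_banach[OF S, symmetric] iR
    by (rule infsumI, rule norm_summable_imp_has_sum[OF sr]) (rule summable_sums[OF summable_norm_cancel[OF sr]])
  have bij_swap: "bij_betw prod.swap (UNIV \<times> UNIV :: (nat \<times> nat) set) (UNIV \<times> UNIV)"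
    by (rule bij_betwI[where g = prod.swap]) auto
  have sw: "(\<lambda>(m,k). f k m) summable_on UNIV \<times> UNIV"
    using summable_on_reindex_bij_betw[OF bij_swap, of "\<lambda>(k,m). f k m"] S by (simp add: case_prod_unfold)
  have "infsum (\<lambda>(k,m). f k m) (UNIV \<times> UNIV) = infsum (\<lambda>(m,k). f k m) (UNIV \<times> UNIV)"
    using infsum_swap_banach[OF S] infsum_Sigma'_banach[OF S] infsum_Sigma'_banach[OF sw] by simp
  also have "\<dots> = (\<Sum>m. \<Sum>k. f k m)"
    unfolding infsum_Sigma'_banach[OF sw, symmetric] iC
    by (rule infsumI, rule norm_summable_imp_has_sum[OF sc]) (rule summable_sums[OF summable_norm_cancel[OF sc]])
  finally show "(\<Sum>k. \<Sum>m. f k m) = (\<Sum>m. \<Sum>k. f k m)" using 1 by simp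
  let ?T = "Sigma UNIV (\<lambda>n. {..n::nat})"
  have bij: "bij_betw (\<lambda>(n,k). (k, n - k)) ?T (UNIV \<times> UNIV)"
    by (rule bij_betwI[where g = "\<lambda>(k,m). (k+m,k)"]) auto
  have ST: "(\<lambda>(n,k). f k (n - k)) summable_on ?T"
    using summable_on_reindex_bij_betw[OF bij, of "\<lambda>(k,m). f k m"] S by (simp add: case_prod_unfold)
  have "infsum (\<lambda>(k,m). f k m) (UNIV \<times> UNIV) = infsum (\<lambda>(n,k). f k (n - k)) ?T"
    using infsum_reindex_bij_betw[OF bij, of "\<lambda>(k,m). f k m"] by (simp add: case_prod_unfold)
  also have "\<dots> = infsum (\<lambda>n. \<Sum>k\<le>n. f k (n - k)) UNIV"
    unfolding infsum_Sigma'_banach[OF ST, symmetric] by simp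
  finally have "infsum (\<lambda>n. \<Sum>k\<le>n. f k (n - k)) UNIV = (\<Sum>k. \<Sum>m. f k m)" using 1 by simp
  moreover have "(\<lambda>n. \<Sum>k\<le>n. f k (n - k)) summable_on UNIV"
    using summable_on_Sigma_banach[OF ST] by simp
  ultimately have "((\<lambda>n. \<Sum>k\<le>n. f k (n - k)) has_sum (\<Sum>k. \<Sum>m. f k m)) UNIV"
    by (metis has_sum_infsum)
  then show "(\<lambda>n. \<Sum>k\<le>n. f k (n - k)) sums (\<Sum>k. \<Sum>m. f k m)"
    by (rule has_sum_imp_sums)
qed

section \<open>Gauss summation\<close>

lemma powr_shift_quotient:
  "(\<lambda>m. of_nat (Suc (m + k)) powr z / of_nat (Suc m) powr z :: complex) \<longlonglongrightarrow> 1"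
proof -
  have "(\<lambda>m. complex_of_real (ln (real (Suc (m + k))) - ln (real (Suc m)))) \<longlonglongrightarrow> of_real 0"
    by (intro tendsto_of_real) real_asymp
  then have "(\<lambda>m. exp (z * complex_of_real (ln (real (Suc (m + k))) - ln (real (Suc m))))) \<longlonglongrightarrow> exp (z * of_real 0)"
    by (rule tendsto_exp[OF tendsto_mult[OF tendsto_const]])
  moreover have "of_nat (Suc n) powr z = exp (z * complex_of_real (ln (real (Suc n))))" for n
    unfolding powr_def of_nat_eq_0_iff using Ln_of_nat[of "Suc n"] by (simp del: of_nat_Suc)
  ultimately show ?thesis by (simp add: right_diff_distrib exp_diff del: of_nat_Suc)
qed

lemma gamma_quot_asymp_diff:
  assumes "x \<notin> \<int>\<^sub>\<le>\<^sub>0" "y \<notin> \<int>\<^sub>\<le>\<^sub>0"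
  shows "(\<lambda>n. gamma_quot x y (n - k) * of_nat (Suc n) powr (y - x)) \<longlonglongrightarrow> 1"
proof (rule LIMSEQ_offset[of _ k])
  have "(\<lambda>m. gamma_quot x y m * of_nat (Suc m) powr (y - x) *
      (of_nat (Suc (m + k)) powr (y - x) / of_nat (Suc m) powr (y - x))) \<longlonglongrightarrow> 1 * 1"
    by (intro tendsto_mult gamma_quot_asymp powr_shift_quotient assms)
  then show "(\<lambda>n. gamma_quot x y (n + k - k) * of_nat (Suc (n + k)) powr (y - x)) \<longlonglongrightarrow> 1"
    by (simp del: of_nat_Suc)
qed

lemma Suc_le_dist_mult: "real (Suc n) \<le> real (Suc (n - k)) * real (Suc k)"
  unfolding of_nat_mult [symmetric] of_nat_le_iff by simp

text \<open>Distributes a growing weight in n over the two indices n - k and k of a convolution.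
  With truncated subtraction it stays true for k > n.\<close>

lemma powr_Suc_le:
  assumes "r \<ge> 0"
  shows "real (Suc n) powr r \<le> real (Suc (n - k)) powr r * real (Suc k) powr r"
proof -
  have "real (Suc n) powr r \<le> (real (Suc (n - k)) * real (Suc k)) powr r"
    using Suc_le_dist_mult assms by (intro powr_mono2) auto
  then show ?thesis by (subst (asm) powr_mult) auto
qed

text \<open>The coefficient of z^n in Euler's transformation F(c,d;g;z) = (1-z)^(g-c-d)
  F(g-c,g-d;g;z). Both sides satisfy the same first-order recurrence in n.\<close>

lemma euler_convolution:
  fixes c d g :: complex
  assumes "c \<notin> \<int>\<^sub>\<le>\<^sub>0" "d \<notin> \<int>\<^sub>\<le>\<^sub>0" "g - c \<notin> \<int>\<^sub>\<le>\<^sub>0" "g - d \<notin> \<int>\<^sub>\<le>\<^sub>0" "c + d - g \<notin> \<int>\<^sub>\<le>\<^sub>0" "g \<notin> \<int>\<^sub>\<le>\<^sub>0"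
  shows "Gamma (g - c) * Gamma (g - d) * Gamma (c + d - g) * (gamma_quot c 1 n * gamma_quot d g n) =
    Gamma c * Gamma d * (\<Sum>k\<le>n. gamma_quot (g - c) 1 k * gamma_quot (g - d) g k * gamma_quot (c + d - g) 1 (n - k))"
proof (induction n)
  case 0
  then show ?case by (simp add: gamma_quot_def)
next
  case (Suc n)
  define u where "u = (\<lambda>n. gamma_quot c 1 n * gamma_quot d g n)"
  define U where "U = (\<lambda>n. gamma_quot (g - c) 1 n * gamma_quot (g - d) g n)"
  define W where "W = gamma_quot (c + d - g) 1"
  have W: "(1 + of_nat m) * W (Suc m) = (c + d - g + of_nat m) * W m" for m
    unfolding W_def by (rule gamma_quot_Suc) fact
  have U: "(1 + of_nat m) * (g + of_nat m) * U (Suc m) = (g - c + of_nat m) * (g - d + of_nat m) * U m" for m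
    using gamma_quot_Suc[OF assms(3), of 1 m] gamma_quot_Suc[OF assms(4), of g m]
    unfolding U_def by (simp add: mult_ac)
  have u: "(1 + of_nat m) * (g + of_nat m) * u (Suc m) = (c + of_nat m) * (d + of_nat m) * u m" for m
    using gamma_quot_Suc[OF assms(1), of 1 m] gamma_quot_Suc[OF assms(2), of g m]
    unfolding u_def by (simp add: mult_ac)
  \<comment> \<open>Zeilberger certificate: \<open>H\<close> telescopes the recurrence in \<open>n\<close> applied to the summand.\<close>
  define H where "H = (\<lambda>k. of_nat k * (g + of_nat k - 1) * U k * W (Suc n - k))"
  have *: "(1 + of_nat n) * (g + of_nat n) * (U k * W (Suc n - k)) - (c + of_nat n) * (d + of_nat n) * (U k * W (n - k))
     = H k - H (Suc k)" if "k \<le> n" for k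
  proof -
    obtain m where n: "n = k + m" using \<open>k \<le> n\<close> le_Suc_ex by blast
    have "H (Suc k) = (1 + of_nat k) * (g + of_nat k) * U (Suc k) * W m"
      by (simp add: H_def n)
    also have "\<dots> = (g - c + of_nat k) * (g - d + of_nat k) * U k * W m" by (simp only: U)
    finally have 1: "H (Suc k) = (g - c + of_nat k) * (g - d + of_nat k) * U k * W m" .
    have 2: "H k = of_nat k * (g + of_nat k - 1) * U k * W (Suc m)" by (simp add: H_def n Suc_diff_le)
    have "(1 + of_nat n) * (g + of_nat n) * (U k * W (Suc n - k)) - H k =
       U k * (g + 2 * of_nat k + of_nat m) * ((1 + of_nat m) * W (Suc m))"
      unfolding 2 by (simp add: n Suc_diff_le algebra_simps)
    also have "\<dots> = (c + of_nat n) * (d + of_nat n) * (U k * W (n - k)) - H (Suc k)"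
      unfolding W 1 by (simp add: n algebra_simps)
    finally show ?thesis by (simp add: algebra_simps)
  qed
  have "(\<Sum>k\<le>n. (1 + of_nat n) * (g + of_nat n) * (U k * W (Suc n - k)) - (c + of_nat n) * (d + of_nat n) * (U k * W (n - k)))
     = (\<Sum>k\<le>n. H k - H (Suc k))" by (intro sum.cong refl *) auto
  also have "\<dots> = - H (Suc n)" by (subst sum_telescope) (simp add: H_def)
  finally have "(1 + of_nat n) * (g + of_nat n) * (\<Sum>k\<le>n. U k * W (Suc n - k)) -
      (c + of_nat n) * (d + of_nat n) * (\<Sum>k\<le>n. U k * W (n - k)) = - H (Suc n)"
    by (simp only: sum_subtractf sum_distrib_left)
  \<comment> \<open>The boundary term left by telescoping is precisely the summand k = n + 1 missing
    from the sum up to n.\<close>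
  moreover have "H (Suc n) = (1 + of_nat n) * (g + of_nat n) * (U (Suc n) * W (Suc n - Suc n))"
    by (simp add: H_def)
  ultimately have 1: "(1 + of_nat n) * (g + of_nat n) * (\<Sum>k\<le>Suc n. U k * W (Suc n - k)) =
      (c + of_nat n) * (d + of_nat n) * (\<Sum>k\<le>n. U k * W (n - k))"
    unfolding sum.atMost_Suc by (simp only: distrib_left) (simp only: diff_eq_eq add_uminus_conv_diff uminus_add_conv_diff, simp)
  have nz: "1 + of_nat n \<noteq> (0::complex)" by (metis of_nat_Suc of_nat_neq_0)
  have gz: "g + of_nat n \<noteq> 0" using assms(6) by (metis add_eq_0_iff2 minus_of_nat_in_nonpos_Ints)
  have "(1 + of_nat n) * (g + of_nat n) * (Gamma (g - c) * Gamma (g - d) * Gamma (c + d - g) * u (Suc n)) =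
     Gamma (g - c) * Gamma (g - d) * Gamma (c + d - g) * ((1 + of_nat n) * (g + of_nat n) * u (Suc n))"
    by (simp add: mult_ac)
  also have "\<dots> = (c + of_nat n) * (d + of_nat n) * (Gamma (g - c) * Gamma (g - d) * Gamma (c + d - g) * u n)"
    unfolding u by (simp add: mult_ac)
  also have "\<dots> = (c + of_nat n) * (d + of_nat n) * (Gamma c * Gamma d * (\<Sum>k\<le>n. U k * W (n - k)))"
    using Suc.IH unfolding u_def U_def W_def by simp
  also have "\<dots> = Gamma c * Gamma d * ((c + of_nat n) * (d + of_nat n) * (\<Sum>k\<le>n. U k * W (n - k)))"
    by (simp only: mult_ac)
  also have "\<dots> = (1 + of_nat n) * (g + of_nat n) * (Gamma c * Gamma d * (\<Sum>k\<le>Suc n. U k * W (Suc n - k)))"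
    unfolding 1 [symmetric] by (simp only: mult_ac)
  finally show ?case using nz gz unfolding u_def U_def W_def by simp
qed

text \<open>Compares the two sides of \<open>euler_convolution\<close>, with C - A and C - B in
  place of c and d, for large n. The left side is asymptotic to (n+1)^(\<sigma>-1) with \<sigma> = C
  - A - B; on the right, division by this power turns the convolution into the series itself in the
  limit.\<close>

lemma gauss_summation:
  fixes A B C :: complex
  assumes "A \<notin> \<int>\<^sub>\<le>\<^sub>0" "B \<notin> \<int>\<^sub>\<le>\<^sub>0" "C \<notin> \<int>\<^sub>\<le>\<^sub>0" "C - A \<notin> \<int>\<^sub>\<le>\<^sub>0" "C - B \<notin> \<int>\<^sub>\<le>\<^sub>0"
    and s: "1 / 2 < Re (C - A - B)" "Re (C - A - B) < 1"
  shows "(\<Sum>k. gamma_quot A 1 k * gamma_quot B C k) * (Gamma (C - A) * Gamma (C - B)) =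
    Gamma A * Gamma B * Gamma (C - A - B)"
proof -
  define \<sigma> where "\<sigma> = C - A - B"
  define W where "W = gamma_quot \<sigma> 1"
  define U where "U = (\<lambda>n. gamma_quot A 1 n * gamma_quot B C n)"
  have "Re x \<le> 0" if "x \<in> \<int>\<^sub>\<le>\<^sub>0" for x :: complex
    using that by (auto elim!: nonpos_Ints_cases)
  then have \<sigma>: "\<sigma> \<notin> \<int>\<^sub>\<le>\<^sub>0" using s by (force simp: \<sigma>_def)
  have one: "(1::complex) \<notin> \<int>\<^sub>\<le>\<^sub>0" by simp
  have eu: "Gamma A * Gamma B * Gamma \<sigma> * (gamma_quot (C - A) 1 n * gamma_quot (C - B) C n) =
    Gamma (C - A) * Gamma (C - B) * (\<Sum>k\<le>n. U k * W (n - k))" for n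
    using euler_convolution[of "C - A" "C - B" C n] assms \<sigma>
    by (simp add: \<sigma>_def U_def W_def algebra_simps)
  define P where "P = (\<lambda>n. of_nat (Suc n) powr (1 - \<sigma>) :: complex)"
  have L: "(\<lambda>n. gamma_quot (C - A) 1 n * gamma_quot (C - B) C n * P n) \<longlonglongrightarrow> 1"
  proof -
    have "(\<lambda>n. (gamma_quot (C - A) 1 n * of_nat (Suc n) powr (1 - (C - A))) * 
      (gamma_quot (C - B) C n * of_nat (Suc n) powr (C - (C - B)))) \<longlonglongrightarrow> 1 * 1"
      by (intro tendsto_mult gamma_quot_asymp assms one)
    moreover have "P n = of_nat (Suc n) powr (1 - (C - A)) * of_nat (Suc n) powr (C - (C - B))" for n
      unfolding P_def powr_add [symmetric] by (simp add: \<sigma>_def algebra_simps)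
    ultimately show ?thesis by (simp add: mult_ac)
  qed
  obtain C1 where C1: "C1 \<ge> 0" "\<And>n. norm (gamma_quot A 1 n) \<le> C1 * real (Suc n) powr Re (A - 1)"
    using gamma_quot_bound[OF assms(1) one] by blast
  obtain C2 where C2: "C2 \<ge> 0" "\<And>n. norm (gamma_quot B C n) \<le> C2 * real (Suc n) powr Re (B - C)"
    using gamma_quot_bound[OF assms(2,3)] by blast
  obtain C3 where C3: "C3 \<ge> 0" "\<And>n. norm (W n) \<le> C3 * real (Suc n) powr Re (\<sigma> - 1)"
    unfolding W_def using gamma_quot_bound[OF \<sigma> one] by blast
  have U: "norm (U n) \<le> C1 * C2 * real (Suc n) powr (-1 - Re \<sigma>)" for n
  proof -
    have "norm (U n) \<le> (C1 * real (Suc n) powr Re (A - 1)) * (C2 * real (Suc n) powr Re (B - C))"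
      unfolding U_def norm_mult by (intro mult_mono C1 C2) (use C1 in auto)
    also have "\<dots> = C1 * C2 * real (Suc n) powr (Re (A - 1) + Re (B - C))" by (simp add: powr_add)
    finally show ?thesis by (simp add: \<sigma>_def algebra_simps)
  qed
  \<comment> \<open>Padding by 0 for k > n turns the finite convolution into a series over all k, as
    Tannery's theorem requires.\<close>
  define a where "a = (\<lambda>k n. if k \<le> n then U k * W (n - k) * P n else 0)"
  have "((\<lambda>n. suminf (\<lambda>k. a k n)) \<longlongrightarrow> suminf U) sequentially"
  proof (rule conjunct2[OF conjunct2[OF tannerys_theorem]])
    fix k
    have "(\<lambda>n. U k * (W (n - k) * P n)) \<longlonglongrightarrow> U k * 1"
      unfolding W_def P_def by (intro tendsto_mult gamma_quot_asymp_diff tendsto_const \<sigma> one)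
    moreover have "eventually (\<lambda>n. U k * (W (n - k) * P n) = a k n) sequentially"
      using eventually_ge_at_top[of k] by eventually_elim (simp add: a_def)
    ultimately show "(\<lambda>n. a k n) \<longlonglongrightarrow> U k" using Lim_transform_eventually by force
  next
    have "norm (a k n) \<le> (C1 * C2 * C3) * real (Suc k) powr (- 2 * Re \<sigma>)" for k n
    proof (cases "k \<le> n")
      case True
      have "norm (a k n) = norm (U k) * (norm (W (n - k)) * real (Suc n) powr (1 - Re \<sigma>))"
        unfolding a_def P_def using True by (simp add: norm_mult norm_Suc_powr del: of_nat_Suc)
      \<comment> \<open>The weight (n+1)^(1 - Re \<sigma>) is split by \<open>powr_Suc_le\<close>;
        its part in n - k cancels the decay of \<open>W\<close> exactly, its part in k leaves
        (k+1)^(-2 Re \<sigma>), which is summable because Re \<sigma> > 1/2.\<close>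
      also have "\<dots> \<le> (C1 * C2 * real (Suc k) powr (-1 - Re \<sigma>)) * ((C3 * real (Suc (n - k)) powr Re (\<sigma> - 1)) *
          (real (Suc (n - k)) powr (1 - Re \<sigma>) * real (Suc k) powr (1 - Re \<sigma>)))"
        using s C1 C2 C3 by (intro mult_mono U powr_Suc_le) (auto simp: \<sigma>_def)
      also have "\<dots> = C1 * C2 * C3 * (real (Suc k) powr ((-1 - Re \<sigma>) + (1 - Re \<sigma>))) * (real (Suc (n - k)) powr (Re (\<sigma> - 1) + (1 - Re \<sigma>)))"
        unfolding powr_add by (simp add: mult_ac)
      finally show ?thesis by simp
    qed (use C1 C2 C3 in \<open>auto simp: a_def\<close>)
    then show "\<forall>\<^sub>F (k, n) in sequentially \<times>\<^sub>F sequentially. norm (a k n) \<le> (C1 * C2 * C3) * real (Suc k) powr (- 2 * Re \<sigma>)"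
      by (intro always_eventually) auto
    show "summable (\<lambda>k. (C1 * C2 * C3) * real (Suc k) powr (- 2 * Re \<sigma>))"
      using s by (intro summable_mult summable_Suc_powr) (simp add: \<sigma>_def)
  qed auto
  moreover have "suminf (\<lambda>k. a k n) = (\<Sum>k\<le>n. U k * W (n - k)) * P n" for n
    by (subst suminf_finite[of "{..n}"]) (auto simp: a_def sum_distrib_right)
  ultimately have "(\<lambda>n. (\<Sum>k\<le>n. U k * W (n - k)) * P n) \<longlonglongrightarrow> suminf U" by simp
  then have "(\<lambda>n. Gamma (C - A) * Gamma (C - B) * ((\<Sum>k\<le>n. U k * W (n - k)) * P n)) \<longlonglongrightarrow> Gamma (C - A) * Gamma (C - B) * suminf U"
    by (intro tendsto_mult tendsto_const)
  moreover have "(\<lambda>n. Gamma A * Gamma B * Gamma \<sigma> * (gamma_quot (C - A) 1 n * gamma_quot (C - B) C n * P n)) \<longlonglongrightarrow>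
     Gamma A * Gamma B * Gamma \<sigma> * 1" by (intro tendsto_mult tendsto_const L)
  moreover have "Gamma (C - A) * Gamma (C - B) * ((\<Sum>k\<le>n. U k * W (n - k)) * P n) = 
     Gamma A * Gamma B * Gamma \<sigma> * (gamma_quot (C - A) 1 n * gamma_quot (C - B) C n * P n)" for n
    using arg_cong[OF eu[of n], of "\<lambda>x. x * P n"] by (simp only: mult.assoc)
  ultimately have "Gamma (C - A) * Gamma (C - B) * suminf U = Gamma A * Gamma B * Gamma \<sigma> * 1"
    by (metis (no_types, lifting) ext LIMSEQ_unique)
  then show ?thesis by (simp add: U_def \<sigma>_def mult_ac)
qed

section \<open>The two-term relation\<close>

lemma not_Ints_shift:
  assumes "(x::complex) \<notin> \<int>"
  shows "x + of_nat n \<notin> \<int>\<^sub>\<le>\<^sub>0" "x - of_nat n \<notin> \<int>\<^sub>\<le>\<^sub>0" "x \<notin> \<int>\<^sub>\<le>\<^sub>0"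
proof -
  show "x + of_nat n \<notin> \<int>\<^sub>\<le>\<^sub>0" using assms Ints_diff[of "x + of_nat n" "of_nat n"] nonpos_Ints_subset_Ints by auto
  show "x - of_nat n \<notin> \<int>\<^sub>\<le>\<^sub>0" using assms Ints_add[of "x - of_nat n" "of_nat n"] nonpos_Ints_subset_Ints by auto
  show "x \<notin> \<int>\<^sub>\<le>\<^sub>0" using assms nonpos_Ints_subset_Ints by auto
qed

lemma sin_pi_eq_0_iff: "sin (of_real pi * z) = 0 \<longleftrightarrow> z \<in> \<int>" for z :: complex
proof -
  have "sin (of_real pi * z) = 0 \<longleftrightarrow> (\<exists>n::int. z = of_int n)"
    by (subst sin_eq_0) (auto simp: mult.commute)
  then show ?thesis by (auto elim!: Ints_cases)
qed

lemma telescope_suminf: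
  fixes G :: "nat \<Rightarrow> complex"
  assumes "\<And>m. f m = G (Suc m) - G m" "G \<longlonglongrightarrow> L"
  shows "f sums (L - G 0)"
  using telescope_sums[OF assms(2)] assms(1) by (simp add: fun_eq_iff cong: sums_cong)

lemma gamma_quot_bound2:
  assumes "x1 \<notin> \<int>\<^sub>\<le>\<^sub>0" "y1 \<notin> \<int>\<^sub>\<le>\<^sub>0" "x2 \<notin> \<int>\<^sub>\<le>\<^sub>0" "y2 \<notin> \<int>\<^sub>\<le>\<^sub>0"
  shows "\<exists>C\<ge>0. \<forall>n. norm (gamma_quot x1 y1 n * gamma_quot x2 y2 n) \<le> C * real (Suc n) powr Re (x1 - y1 + x2 - y2)"
proof -
  obtain C1 where C1: "C1 \<ge> 0" "\<And>n. norm (gamma_quot x1 y1 n) \<le> C1 * real (Suc n) powr Re (x1 - y1)"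
    using gamma_quot_bound[OF assms(1,2)] by blast
  obtain C2 where C2: "C2 \<ge> 0" "\<And>n. norm (gamma_quot x2 y2 n) \<le> C2 * real (Suc n) powr Re (x2 - y2)"
    using gamma_quot_bound[OF assms(3,4)] by blast
  have "norm (gamma_quot x1 y1 n * gamma_quot x2 y2 n) \<le> C1 * C2 * real (Suc n) powr Re (x1 - y1 + x2 - y2)" for n
  proof -
    have "norm (gamma_quot x1 y1 n * gamma_quot x2 y2 n) \<le> (C1 * real (Suc n) powr Re (x1 - y1)) * (C2 * real (Suc n) powr Re (x2 - y2))"
      unfolding norm_mult by (intro mult_mono C1 C2) (use C1 in auto)
    also have "\<dots> = C1 * C2 * real (Suc n) powr (Re (x1 - y1) + Re (x2 - y2))" by (simp add: powr_add)
    finally show ?thesis by (simp add: algebra_simps)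
  qed
  with C1 C2 show ?thesis by (intro exI[of _ "C1 * C2"]) auto
qed

lemma gamma_quot_Suc2:
  assumes "x1 \<notin> \<int>\<^sub>\<le>\<^sub>0" "x2 \<notin> \<int>\<^sub>\<le>\<^sub>0"
  shows "((y1 + of_nat n) * (y2 + of_nat n)) * (gamma_quot x1 y1 (Suc n) * gamma_quot x2 y2 (Suc n)) =
    ((x1 + of_nat n) * (x2 + of_nat n)) * (gamma_quot x1 y1 n * gamma_quot x2 y2 n)"
proof -
  have "((y1 + of_nat n) * gamma_quot x1 y1 (Suc n)) * ((y2 + of_nat n) * gamma_quot x2 y2 (Suc n)) =
     ((x1 + of_nat n) * gamma_quot x1 y1 n) * ((x2 + of_nat n) * gamma_quot x2 y2 n)"
    by (simp only: gamma_quot_Suc[OF assms(1)] gamma_quot_Suc[OF assms(2)])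
  then show ?thesis by (simp only: mult_ac)
qed

text \<open>Evaluates the boundary terms of the two telescoping sums below. A quadratic factor meets
  two sequences whose decay exponents add up to 2, so the limit is a nonzero constant; it becomes
  the inhomogeneity of the recurrences.\<close>

lemma square_asymp:
  fixes X Y :: "nat \<Rightarrow> complex"
  assumes X: "(\<lambda>m. X m * of_nat (Suc m) powr \<alpha>) \<longlonglongrightarrow> 1" and Y: "(\<lambda>m. Y m * of_nat (Suc m) powr \<beta>) \<longlonglongrightarrow> 1"
    and ab: "\<alpha> + \<beta> = 2"
  shows "(\<lambda>m. of_nat m * (z + of_nat m) * X m * Y m) \<longlonglongrightarrow> 1"
proof -
  have inv: "(\<lambda>n. inverse (complex_of_real (real (Suc n)))) \<longlonglongrightarrow> of_real 0"
    unfolding of_real_inverse [symmetric] by (intro tendsto_of_real) real_asymp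
  have lim: "(\<lambda>m. X m * of_nat (Suc m) powr \<alpha> * (Y m * of_nat (Suc m) powr \<beta>) *
     ((1 - inverse (complex_of_real (real (Suc m)))) * (1 + (z - 1) * inverse (complex_of_real (real (Suc m)))))) \<longlonglongrightarrow> 
     1 * 1 * ((1 - of_real 0) * (1 + (z - 1) * of_real 0))"
    by (intro tendsto_mult X Y tendsto_add tendsto_diff tendsto_const inv)
  have "X m * of_nat (Suc m) powr \<alpha> * (Y m * of_nat (Suc m) powr \<beta>) *
     ((1 - inverse (complex_of_real (real (Suc m)))) * (1 + (z - 1) * inverse (complex_of_real (real (Suc m))))) = 
     of_nat m * (z + of_nat m) * X m * Y m" for m
  proof -
    define N :: complex where "N = of_nat (Suc m)"
    have N: "N \<noteq> 0" unfolding N_def of_nat_eq_0_iff by simp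
    have m: "of_nat m = N - 1" by (simp add: N_def)
    have "N powr \<alpha> * N powr \<beta> = N ^ 2"
      using N by (simp add: powr_add [symmetric] ab)
    moreover have "N ^ 2 * ((1 - inverse N) * (1 + (z - 1) * inverse N)) = (N - 1) * (z + (N - 1))"
      using N by (simp add: field_simps power2_eq_square)
    ultimately have "(X m * Y m) * ((N powr \<alpha> * N powr \<beta>) * ((1 - inverse N) * (1 + (z - 1) * inverse N))) = (X m * Y m) * ((N - 1) * (z + (N - 1)))"
      by simp
    then show ?thesis unfolding of_real_of_nat_eq N_def [symmetric] m by (simp only: mult_ac)
  qed
  then show ?thesis using lim by (simp only: of_real_0 mult_1 diff_zero mult_zero_right add_0_right mult_1_right)
qed

section \<open>Regularised series\<close>

lemma Gamma_add_of_nat: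
  fixes x :: complex
  assumes "x \<notin> \<int>\<^sub>\<le>\<^sub>0"
  shows "Gamma (x + of_nat n) = Gamma x * pochhammer x n"
  using pochhammer_Gamma[OF assms, of n] Gamma_eq_zero_iff[of x] assms by simp

text \<open>The reciprocal Gamma factors stand inside the summand, shifted by n, instead of in front
  of Pochhammer denominators: nothing is divided by, so no lower parameter has to be
  excluded.\<close>

definition F43_reg :: "complex \<Rightarrow> complex \<Rightarrow> complex \<Rightarrow> complex \<Rightarrow> complex \<Rightarrow> complex \<Rightarrow> complex \<Rightarrow> complex" where
  "F43_reg a b c d e f g = (\<Sum>n. pochhammer a n * pochhammer b n * pochhammer c n * pochhammer d n / fact n *
     (rGamma (e + of_nat n) * rGamma (f + of_nat n) * rGamma (g + of_nat n)))"

text \<open>Where L is defined on the balanced hyperplane, this is sin(pi e) times L.\<close>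

definition L_reg :: "complex \<Rightarrow> complex \<Rightarrow> complex \<Rightarrow> complex \<Rightarrow> complex \<Rightarrow> complex \<Rightarrow> complex \<Rightarrow> complex" where
  "L_reg a b c d e f g = 
     F43_reg a b c d e f g * (rGamma (1 + a - e) * rGamma (1 + b - e) * rGamma (1 + c - e) * rGamma (1 + d - e)) -
     F43_reg (1 + a - e) (1 + b - e) (1 + c - e) (1 + d - e) (2 - e) (1 + f - e) (1 + g - e) *
       (rGamma a * rGamma b * rGamma c * rGamma d)"

lemma F43_reg_gamma_quot:
  assumes "a \<notin> \<int>\<^sub>\<le>\<^sub>0" "b \<notin> \<int>\<^sub>\<le>\<^sub>0" "c \<notin> \<int>\<^sub>\<le>\<^sub>0" "d \<notin> \<int>\<^sub>\<le>\<^sub>0"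
    and sm: "summable (\<lambda>n. gamma_quot c 1 n * gamma_quot d g n * (gamma_quot a e n * gamma_quot b f n))"
  shows "F43_reg a b c d e f g = rGamma a * rGamma b * rGamma c * rGamma d *
    (\<Sum>n. gamma_quot c 1 n * gamma_quot d g n * (gamma_quot a e n * gamma_quot b f n))"
proof -
  have "Gamma a * Gamma b * Gamma c * Gamma d * (pochhammer a n * pochhammer b n * pochhammer c n * pochhammer d n / fact n *
     (rGamma (e + of_nat n) * rGamma (f + of_nat n) * rGamma (g + of_nat n))) = 
    gamma_quot c 1 n * gamma_quot d g n * (gamma_quot a e n * gamma_quot b f n)" for n
  proof -
    have "rGamma (1 + of_nat n) = inverse (fact n :: complex)"
      by (simp add: rGamma_inverse_Gamma Gamma_fact [symmetric])
    then show ?thesis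
      by (simp add: gamma_quot_def Gamma_add_of_nat assms field_simps)
  qed
  note eq = this
  have inv: "rGamma a * rGamma b * rGamma c * rGamma d * (Gamma a * Gamma b * Gamma c * Gamma d) = 1"
    using assms by (simp add: rGamma_inverse_Gamma Gamma_eq_zero_iff field_simps)
  have "F43_reg a b c d e f g = (\<Sum>n. rGamma a * rGamma b * rGamma c * rGamma d * (gamma_quot c 1 n * gamma_quot d g n * (gamma_quot a e n * gamma_quot b f n)))"
    unfolding eq [symmetric] F43_reg_def mult.assoc[symmetric, of "rGamma a * rGamma b * rGamma c * rGamma d" "Gamma a * Gamma b * Gamma c * Gamma d"] inv
    by simp
  then show ?thesis unfolding suminf_mult[OF sm] .
qed

lemma F43_reg_perm_lower: "F43_reg a b c d e f g = F43_reg a b c d f e g" "F43_reg a b c d e f g = F43_reg a b c d f g e"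
  "F43_reg a b c d e f g = F43_reg a b c d g f e"
  unfolding F43_reg_def by (simp_all add: mult_ac)

text \<open>
  The bounds on \<open>Re \<sigma>\<close> make every dominated-convergence argument elementary: the majorants below are of
  order \<open>k powr (-2 * Re \<sigma>)\<close>, and \<open>\<rho>\<close> stays bounded. They are removed afterwards by analytic continuation.
\<close>

locale two_term =
  fixes a b c d e f g \<sigma> :: complex
  assumes ef: "e + f = 1 + a + b + \<sigma>" and cd: "c + d = g + \<sigma>"
    and \<sigma>: "1 / 2 < Re \<sigma>" "Re \<sigma> < 1"
    and nonint: "a \<notin> \<int>" "b \<notin> \<int>" "c \<notin> \<int>" "d \<notin> \<int>" "e \<notin> \<int>" "f \<notin> \<int>" "g \<notin> \<int>"
      "g - c \<notin> \<int>" "g - d \<notin> \<int>" "e - \<sigma> \<notin> \<int>" "f - \<sigma> \<notin> \<int>" "1 + a - f \<notin> \<int>" "1 + b - f \<notin> \<int>"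
      "1 + e - f \<notin> \<int>" "e - a \<notin> \<int>" "e - b \<notin> \<int>"
begin

lemma \<sigma>_nonpos: "\<sigma> \<notin> \<int>\<^sub>\<le>\<^sub>0" and one_nonpos: "(1::complex) \<notin> \<int>\<^sub>\<le>\<^sub>0"
  using \<sigma> by (auto elim!: nonpos_Ints_cases)

text \<open>The summand \<open>u n * v n\<close> is split so that the triple c, d, g subject to
  Euler's transformation stands apart in \<open>u\<close>. Primes mark the transformed series, and
  \<open>w\<close> holds the coefficients of (1-z)^(-\<sigma>) up to Gamma \<sigma>. Replacing
  \<open>u\<close> by the convolution of \<open>u'\<close> and \<open>w\<close> leaves
  \<open>S\<close> as inner sum.\<close>

definition "u n = gamma_quot c 1 n * gamma_quot d g n"
definition "v n = gamma_quot a e n * gamma_quot b f n"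
definition "u' n = gamma_quot (g - c) 1 n * gamma_quot (g - d) g n"
definition "v' n = gamma_quot a (e - \<sigma>) n * gamma_quot b (f - \<sigma>) n"
definition "w n = gamma_quot \<sigma> 1 n"
text \<open>With \<open>\<nu>\<close> and \<open>\<rho>\<close> the sum \<open>P\<close> is a second
  solution of the inhomogeneous recurrence of \<open>S\<close>. Its kernel \<open>\<rho> k m\<close>
  depends on m - k alone, which is what lets the roles of k and m be exchanged later.\<close>

definition "\<nu> n = gamma_quot (1 + a - f) 1 n * gamma_quot (1 + b - f) (1 + e - f) n"
definition "\<rho> k m = gamma_quot (1 + \<sigma> - f - of_nat k) (2 - f - of_nat k) m"
definition "S k = (\<Sum>m. w m * v (k + m))"
definition "P k = (\<Sum>m. \<nu> m * \<rho> k m)"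

lemma mixed_nonint: "1 + \<sigma> - f \<notin> \<int>" "2 - f \<notin> \<int>" "f - 1 \<notin> \<int>"
  using nonint(6,11) Ints_diff[of 1 "1 + \<sigma> - f"] Ints_diff[of 2 "2 - f"] Ints_add[of "f - 1" 1] by auto

lemma bounds:
  obtains C where "C \<ge> 0" "\<And>n. norm (u' n) \<le> C * real (Suc n) powr (-1 - Re \<sigma>)"
    "\<And>n. norm (v n) \<le> C * real (Suc n) powr (-1 - Re \<sigma>)"
    "\<And>n. norm (\<nu> n) \<le> C * real (Suc n) powr (-1 - Re \<sigma>)"
    "\<And>n. norm (w n) \<le> C * real (Suc n) powr (Re \<sigma> - 1)"
proof -
  note ni = nonint[THEN not_Ints_shift(3)] one_nonpos \<sigma>_nonpos
  have R: "Re e + Re f = 1 + Re a + Re b + Re \<sigma>" "Re c + Re d = Re g + Re \<sigma>"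
    using arg_cong[OF ef, of Re] arg_cong[OF cd, of Re] by simp_all
  obtain C1 where 1: "C1 \<ge> 0" "\<And>n. norm (u' n) \<le> C1 * real (Suc n) powr (Re (g - c - 1 + (g - d) - g))"
    using gamma_quot_bound2[of "g - c" 1 "g - d" g] ni unfolding u'_def by auto
  obtain C2 where 2: "C2 \<ge> 0" "\<And>n. norm (v n) \<le> C2 * real (Suc n) powr (Re (a - e + b - f))"
    using gamma_quot_bound2[of a e b f] ni unfolding v_def by auto
  obtain C3 where 3: "C3 \<ge> 0" "\<And>n. norm (\<nu> n) \<le> C3 * real (Suc n) powr (Re (1 + a - f - 1 + (1 + b - f) - (1 + e - f)))"
    using gamma_quot_bound2[of "1 + a - f" 1 "1 + b - f" "1 + e - f"] ni unfolding \<nu>_def by auto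
  obtain C4 where 4: "C4 \<ge> 0" "\<And>n. norm (w n) \<le> C4 * real (Suc n) powr (Re (\<sigma> - 1))"
    using gamma_quot_bound[of \<sigma> 1] ni unfolding w_def by auto
  have e: "Re (g - c - 1 + (g - d) - g) = -1 - Re \<sigma>" "Re (a - e + b - f) = -1 - Re \<sigma>"
    "Re (1 + a - f - 1 + (1 + b - f) - (1 + e - f)) = -1 - Re \<sigma>" "Re (\<sigma> - 1) = Re \<sigma> - 1"
    using R by simp_all
  define C where "C = C1 + C2 + C3 + C4"
  have le: "C1 * real (Suc n) powr r \<le> C * real (Suc n) powr r" "C2 * real (Suc n) powr r \<le> C * real (Suc n) powr r"
    "C3 * real (Suc n) powr r \<le> C * real (Suc n) powr r" "C4 * real (Suc n) powr r \<le> C * real (Suc n) powr r" for n r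
    using 1(1) 2(1) 3(1) 4(1) by (auto simp: C_def intro!: mult_right_mono)
  show thesis
    using 1(1) 2(1) 3(1) 4(1) 1(2)[THEN order_trans[OF _ le(1)]] 2(2)[THEN order_trans[OF _ le(2)]]
      3(2)[THEN order_trans[OF _ le(3)]] 4(2)[THEN order_trans[OF _ le(4)]]
    unfolding e by (intro that[of C]) (auto simp: C_def)
qed

definition r where "r = sin (of_real pi * f) / sin (of_real pi * (\<sigma> - f))"

lemma sin_nz: "sin (of_real pi * (\<sigma> - f)) \<noteq> 0" "sin (of_real pi * f) \<noteq> 0"
  using nonint(6,11) Ints_minus[of "\<sigma> - f"] by (auto simp: sin_pi_eq_0_iff)

text \<open>For m < k the Gamma arguments in \<open>\<rho>\<close> run to the left. The reflection
  formula moves them to the index k - m, and the signs (-1)^j of the two sines cancel, so the factor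
  \<open>r\<close> depends on neither k nor m.\<close>

lemma \<rho>_reflect:
  assumes "m \<le> k"
  shows "\<rho> k m = r * gamma_quot (f - 1) (f - \<sigma>) (k - m)"
proof -
  define j where "j = k - m"
  have k: "of_nat k = (of_nat j + of_nat m :: complex)" using assms by (simp add: j_def)
  let ?x = "1 + \<sigma> - f - of_nat j" and ?y = "2 - f - of_nat j"
  have gx: "Gamma ?x * rGamma ?x = 1" and gfs: "Gamma (f - 1 + of_nat j) * rGamma (f - 1 + of_nat j) = 1"
    using not_Ints_shift(2)[OF mixed_nonint(1), of j] not_Ints_shift(1)[OF mixed_nonint(3), of j]
    by (simp_all add: rGamma_inverse_Gamma Gamma_eq_zero_iff)
  have s: "sin (of_real pi * ?x) = (-1) ^ j * - sin (of_real pi * (\<sigma> - f))" 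
     "sin (of_real pi * ?y) = (-1) ^ j * - sin (of_real pi * f)"
  proof -
    have A: "sin (z - of_real pi * of_nat j) = (-1) ^ j * sin z" for z :: complex
    proof (induction j)
      case (Suc j)
      have "z - of_real pi * of_nat (Suc j) = (z - of_real pi * of_nat j) - of_real pi" by (simp add: algebra_simps)
      then show ?case unfolding power_Suc by (simp only: sin_diff[of _ "of_real pi"] Suc) simp
    qed simp
    have "of_real pi * ?x = (of_real pi * (\<sigma> - f) + of_real pi) - of_real pi * of_nat j" by (simp add: algebra_simps)
    then show "sin (of_real pi * ?x) = (-1) ^ j * - sin (of_real pi * (\<sigma> - f))" by (simp only: A) (simp add: sin_add)
    have "of_real pi * ?y = (2 * of_real pi - of_real pi * f) - of_real pi * of_nat j" by (simp add: algebra_simps)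
    then show "sin (of_real pi * ?y) = (-1) ^ j * - sin (of_real pi * f)" by (simp only: A) (simp add: sin_diff)
  qed
  have e: "1 - ?x = f - \<sigma> + of_nat j" "1 - ?y = f - 1 + of_nat j" by simp_all
  have 1: "rGamma ?x * rGamma (f - \<sigma> + of_nat j) = (-1) ^ j * - sin (of_real pi * (\<sigma> - f)) / of_real pi"
    using rGamma_reflection_complex[of ?x] unfolding s e .
  have 2: "rGamma ?y * rGamma (f - 1 + of_nat j) = (-1) ^ j * - sin (of_real pi * f) / of_real pi"
    using rGamma_reflection_complex[of ?y] unfolding s e .
  have "r * (rGamma ?x * rGamma (f - \<sigma> + of_nat j)) = rGamma ?y * rGamma (f - 1 + of_nat j)"
    unfolding 1 2 r_def using sin_nz by simp
  then have "Gamma ?x * Gamma (f - 1 + of_nat j) * (r * (rGamma ?x * rGamma (f - \<sigma> + of_nat j))) = 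
     Gamma ?x * Gamma (f - 1 + of_nat j) * (rGamma ?y * rGamma (f - 1 + of_nat j))" by simp
  then have "(Gamma ?x * rGamma ?x) * r * (Gamma (f - 1 + of_nat j) * rGamma (f - \<sigma> + of_nat j)) = 
      (Gamma (f - 1 + of_nat j) * rGamma (f - 1 + of_nat j)) * (Gamma ?x * rGamma ?y)"
    by (simp only: mult_ac)
  then have "r * gamma_quot (f - 1) (f - \<sigma>) j = Gamma ?x * rGamma ?y"
    unfolding gx gfs by (simp add: gamma_quot_def)
  moreover have "\<rho> k m = Gamma ?x * rGamma ?y"
    unfolding \<rho>_def gamma_quot_def k by (simp add: algebra_simps)
  ultimately show ?thesis by (simp add: j_def)
qed

text \<open>On either side of the diagonal \<open>\<rho>\<close> decays like a power of 1 + |k - m|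
  with exponent Re \<sigma> - 1 < 0: by reflection for m \<le> k, directly for m \<ge> k. The
  weighted bound is the one needed to let k tend to infinity inside \<open>P\<close>.\<close>

lemma \<rho>_bound:
  obtains C where "C \<ge> 0" "\<And>k m. norm (\<rho> k m) \<le> C" "\<And>k m. norm (\<rho> k m) * real (Suc k) powr (1 - Re \<sigma>) \<le> C * real (Suc m) powr (1 - Re \<sigma>)"
proof -
  obtain C1 where C1: "C1 \<ge> 0" "\<And>n. norm (gamma_quot (f - 1) (f - \<sigma>) n) \<le> C1 * real (Suc n) powr Re (f - 1 - (f - \<sigma>))"
    using gamma_quot_bound[of "f - 1" "f - \<sigma>"] nonint(11) mixed_nonint by (metis not_Ints_shift(3))
  obtain C2 where C2: "C2 \<ge> 0" "\<And>n. norm (gamma_quot (1 + \<sigma> - f) (2 - f) n) \<le> C2 * real (Suc n) powr Re (1 + \<sigma> - f - (2 - f))"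
    using gamma_quot_bound[of "1 + \<sigma> - f" "2 - f"] mixed_nonint by (metis not_Ints_shift(3))
  define C where "C = norm r * C1 + C2"
  have C0: "C \<ge> 0" using C1 C2 by (simp add: C_def)
  have le1: "norm (\<rho> k m) \<le> C * real (Suc (k - m)) powr (Re \<sigma> - 1)" if "m \<le> k" for k m
  proof -
    have "norm (\<rho> k m) \<le> norm r * (C1 * real (Suc (k - m)) powr (Re \<sigma> - 1))"
      unfolding \<rho>_reflect[OF that] norm_mult using C1(2)[of "k - m"] by (intro mult_left_mono) auto
    also have "\<dots> \<le> C * real (Suc (k - m)) powr (Re \<sigma> - 1)"
      unfolding C_def mult.assoc [symmetric] by (intro mult_right_mono) (use C2 in auto)
    finally show ?thesis .
  qed
  have le2: "norm (\<rho> k m) \<le> C" if "m \<ge> k" for k m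
  proof -
    obtain j where m: "m = k + j" using \<open>k \<le> m\<close> le_Suc_ex by blast
    have "x - of_nat k + of_nat m = x + of_nat j" for x :: complex by (simp add: m)
    then have "\<rho> k m = gamma_quot (1 + \<sigma> - f) (2 - f) j" by (simp only: \<rho>_def gamma_quot_def)
    then have "norm (\<rho> k m) \<le> C2 * real (Suc j) powr (Re \<sigma> - 1)" using C2(2)[of j] by simp
    also have "real (Suc j) powr (Re \<sigma> - 1) \<le> 1" using \<sigma> powr_mono[of "Re \<sigma> - 1" 0 "real (Suc j)"] by simp
    then have "C2 * real (Suc j) powr (Re \<sigma> - 1) \<le> C2 * 1" using C2 by (intro mult_left_mono)
    also have "\<dots> \<le> C" using C1 by (simp add: C_def)
    finally show ?thesis .
  qed
  show thesis
  proof (rule that[of C])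
    show "norm (\<rho> k m) \<le> C" for k m
    proof (cases "m \<le> k")
      case True
      have "real (Suc (k - m)) powr (Re \<sigma> - 1) \<le> 1" using \<sigma> powr_mono[of "Re \<sigma> - 1" 0 "real (Suc (k - m))"] by simp
      then have "C * real (Suc (k - m)) powr (Re \<sigma> - 1) \<le> C * 1" using C0 by (intro mult_left_mono)
      with le1[OF True] show ?thesis by simp
    qed (use le2 in auto)
    show "norm (\<rho> k m) * real (Suc k) powr (1 - Re \<sigma>) \<le> C * real (Suc m) powr (1 - Re \<sigma>)" for k m
    proof (cases "m \<le> k")
      case True
      have "norm (\<rho> k m) * real (Suc k) powr (1 - Re \<sigma>) \<le> (C * real (Suc (k - m)) powr (Re \<sigma> - 1)) *
          (real (Suc (k - m)) powr (1 - Re \<sigma>) * real (Suc m) powr (1 - Re \<sigma>))"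
        using \<sigma> C0 by (intro mult_mono le1 True powr_Suc_le) auto
      also have "\<dots> = C * (real (Suc (k - m)) powr ((Re \<sigma> - 1) + (1 - Re \<sigma>))) * real (Suc m) powr (1 - Re \<sigma>)"
        unfolding powr_add by (simp add: mult_ac)
      finally show ?thesis by simp
    next
      case False
      then show ?thesis using \<sigma> C0 le2[of k m] by (intro mult_mono powr_mono2) auto
    qed
  qed (rule C0)
qed

section \<open>Recurrences for the inner sums\<close>

definition "p k = (e - \<sigma> + of_nat k) * (f - \<sigma> + of_nat k)"
definition "q k = (a + of_nat k) * (b + of_nat k)"

lemma w_Suc: "(1 + of_nat m) * w (Suc m) = (\<sigma> + of_nat m) * w m"
  unfolding w_def by (rule gamma_quot_Suc[OF \<sigma>_nonpos])

lemma v_Suc: "((e + of_nat t) * (f + of_nat t)) * v (Suc t) = ((a + of_nat t) * (b + of_nat t)) * v t"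
  unfolding v_def by (rule gamma_quot_Suc2) (use nonint not_Ints_shift in auto)

lemma v'_Suc: "p t * v' (Suc t) = q t * v' t"
  unfolding v'_def p_def q_def by (rule gamma_quot_Suc2) (use nonint not_Ints_shift in auto)

lemma \<nu>_Suc: "((1 + of_nat t) * (1 + e - f + of_nat t)) * \<nu> (Suc t) = ((1 + a - f + of_nat t) * (1 + b - f + of_nat t)) * \<nu> t"
  unfolding \<nu>_def by (rule gamma_quot_Suc2) (use nonint not_Ints_shift in auto)

lemma \<rho>_Suc: "\<rho> (Suc k) (Suc m) = \<rho> k m" "(1 - f - of_nat k + of_nat m) * \<rho> k m = (\<sigma> - f - of_nat k + of_nat m) * \<rho> (Suc k) m"
proof -
  have 1: "1 + \<sigma> - f - of_nat (Suc k) = \<sigma> - f - of_nat k" "2 - f - of_nat (Suc k) = 1 - f - of_nat k" by simp_all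
  have "x - of_nat (Suc k) + of_nat (Suc m) = x - of_nat k + of_nat m" for x :: complex by simp
  then show 2: "\<rho> (Suc k) (Suc m) = \<rho> k m" unfolding \<rho>_def gamma_quot_def by metis
  have "\<sigma> - f - of_nat k \<notin> \<int>\<^sub>\<le>\<^sub>0"
    using not_Ints_shift(2)[OF mixed_nonint(1), of "Suc k"] unfolding 1 .
  from gamma_quot_Suc[OF this, of "1 - f - of_nat k" m]
  show "(1 - f - of_nat k + of_nat m) * \<rho> k m = (\<sigma> - f - of_nat k + of_nat m) * \<rho> (Suc k) m"
    unfolding 2 [symmetric] unfolding \<rho>_def 1 .
qed

text \<open>The linear factor in the certificate \<open>G\<close> is chosen so that p k and q k are
  completed to the coefficients (e+k+m)(f+k+m) and (a+k+m)(b+k+m) of \<open>v_Suc\<close>. Since G 0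
  = 0, the value -1 comes wholly from the limit of \<open>G\<close>.\<close>

lemma S_recurrence: "(\<lambda>m. p k * (w m * v (Suc k + m)) - q k * (w m * v (k + m))) sums -1"
proof -
  define G where "G m = - (of_nat m * (a + b + 2 * of_nat k + of_nat m) * w m * v (k + m))" for m
  have "(\<lambda>m. p k * (w m * v (Suc k + m)) - q k * (w m * v (k + m))) sums (-1 - G 0)"
  proof (rule telescope_suminf)
    fix m
    have "G (Suc m) = - ((1 + of_nat m) * w (Suc m) * (a + b + 2 * of_nat k + of_nat m + 1) * v (Suc (k + m)))"
      by (simp add: G_def algebra_simps)
    also have "\<dots> = - ((\<sigma> + of_nat m) * w m * (a + b + 2 * of_nat k + of_nat m + 1) * v (Suc (k + m)))"
      by (simp only: w_Suc)
    finally have 1: "G (Suc m) = - ((\<sigma> + of_nat m) * w m * (a + b + 2 * of_nat k + of_nat m + 1) * v (Suc (k + m)))" .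
    have e: "e = 1 + a + b + \<sigma> - f" using ef by (simp add: algebra_simps)
    have "p k + (\<sigma> + of_nat m) * (a + b + 2 * of_nat k + of_nat m + 1) = (e + of_nat (k + m)) * (f + of_nat (k + m))"
      unfolding p_def unfolding e by (simp add: algebra_simps)
    moreover have "q k + of_nat m * (a + b + 2 * of_nat k + of_nat m) = (a + of_nat (k + m)) * (b + of_nat (k + m))"
      unfolding q_def by (simp add: algebra_simps)
    ultimately have "w m * ((p k + (\<sigma> + of_nat m) * (a + b + 2 * of_nat k + of_nat m + 1)) * v (Suc (k + m))) =
       w m * ((q k + of_nat m * (a + b + 2 * of_nat k + of_nat m)) * v (k + m))"
      using v_Suc[of "k + m"] by simp
    then show "p k * (w m * v (Suc k + m)) - q k * (w m * v (k + m)) = G (Suc m) - G m"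
      unfolding 1 unfolding G_def by (simp add: algebra_simps)
  next
    have "(\<lambda>m. of_nat m * (a + b + 2 * of_nat k + of_nat m) * w m * v (k + m)) \<longlonglongrightarrow> 1"
    proof (rule square_asymp[where \<alpha> = "1 - \<sigma>" and \<beta> = "1 + \<sigma>"])
      show "(\<lambda>m. w m * of_nat (Suc m) powr (1 - \<sigma>)) \<longlonglongrightarrow> 1"
        unfolding w_def by (rule gamma_quot_asymp[OF \<sigma>_nonpos one_nonpos])
      have "(\<lambda>m. (gamma_quot (a + of_nat k) (e + of_nat k) m * of_nat (Suc m) powr (e + of_nat k - (a + of_nat k))) *
        (gamma_quot (b + of_nat k) (f + of_nat k) m * of_nat (Suc m) powr (f + of_nat k - (b + of_nat k)))) \<longlonglongrightarrow> 1 * 1"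
        by (intro tendsto_mult gamma_quot_asymp not_Ints_shift nonint)
      moreover have "(gamma_quot (a + of_nat k) (e + of_nat k) m * of_nat (Suc m) powr (e + of_nat k - (a + of_nat k))) *
        (gamma_quot (b + of_nat k) (f + of_nat k) m * of_nat (Suc m) powr (f + of_nat k - (b + of_nat k))) =
        v (k + m) * of_nat (Suc m) powr (1 + \<sigma>)" for m
      proof -
        have "1 + \<sigma> = (e + of_nat k - (a + of_nat k)) + (f + of_nat k - (b + of_nat k))"
          using ef by (simp add: algebra_simps)
        then have "of_nat (Suc m) powr (1 + \<sigma>) = of_nat (Suc m) powr (e + of_nat k - (a + of_nat k)) * of_nat (Suc m) powr (f + of_nat k - (b + of_nat k))"
          by (metis powr_add)
        then show ?thesis by (simp only: v_def gamma_quot_def of_nat_add add.assoc mult_ac)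
      qed
      ultimately show "(\<lambda>m. v (k + m) * of_nat (Suc m) powr (1 + \<sigma>)) \<longlonglongrightarrow> 1" by simp
    qed simp
    then show "G \<longlonglongrightarrow> -1" unfolding G_def by (rule tendsto_minus)
  qed
  then show ?thesis by (simp add: G_def)
qed

text \<open>The inhomogeneity is again -1, so \<open>S - P\<close> solves the homogeneous
  recurrence.\<close>

lemma P_recurrence: "(\<lambda>m. p k * (\<nu> m * \<rho> (Suc k) m) - q k * (\<nu> m * \<rho> k m)) sums -1"
proof -
  define G where "G m = - (of_nat m * (e - f + of_nat m) * \<nu> m * \<rho> (Suc k) m)" for m
  have "(\<lambda>m. p k * (\<nu> m * \<rho> (Suc k) m) - q k * (\<nu> m * \<rho> k m)) sums (-1 - G 0)"
  proof (rule telescope_suminf)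
    fix m
    have "G (Suc m) = - (((1 + of_nat m) * (1 + e - f + of_nat m)) * \<nu> (Suc m) * \<rho> k m)"
      by (simp add: G_def \<rho>_Suc algebra_simps)
    also have "\<dots> = - (((1 + a - f + of_nat m) * (1 + b - f + of_nat m)) * \<nu> m * \<rho> k m)"
      by (simp only: \<nu>_Suc)
    finally have 1: "G (Suc m) = - (((1 + a - f + of_nat m) * (1 + b - f + of_nat m)) * \<nu> m * \<rho> k m)" .
    have e: "e = 1 + a + b + \<sigma> - f" using ef by (simp add: algebra_simps)
    \<comment> \<open>Once the certificate is absorbed, both coefficients share the factor e -
      \<sigma> + k + m; the remaining linear factors are those that \<open>\<rho>_Suc\<close> trades
      between k and k + 1.\<close>
    have 2: "p k - of_nat m * (e - f + of_nat m) = - ((\<sigma> - f - of_nat k + of_nat m) * (e - \<sigma> + of_nat k + of_nat m))"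
      unfolding p_def unfolding e by (simp add: algebra_simps)
    have 3: "q k - (1 + a - f + of_nat m) * (1 + b - f + of_nat m) = - ((1 - f - of_nat k + of_nat m) * (e - \<sigma> + of_nat k + of_nat m))"
      unfolding q_def unfolding e by (simp add: algebra_simps)
    have "(p k - of_nat m * (e - f + of_nat m)) * \<rho> (Suc k) m = - ((e - \<sigma> + of_nat k + of_nat m) * ((\<sigma> - f - of_nat k + of_nat m) * \<rho> (Suc k) m))"
      unfolding 2 by (simp add: mult_ac)
    also have "\<dots> = - ((e - \<sigma> + of_nat k + of_nat m) * ((1 - f - of_nat k + of_nat m) * \<rho> k m))"
      by (simp only: \<rho>_Suc)
    also have "\<dots> = (q k - (1 + a - f + of_nat m) * (1 + b - f + of_nat m)) * \<rho> k m"
      unfolding 3 by (simp add: mult_ac)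
    finally have "\<nu> m * ((p k - of_nat m * (e - f + of_nat m)) * \<rho> (Suc k) m) = \<nu> m * ((q k - (1 + a - f + of_nat m) * (1 + b - f + of_nat m)) * \<rho> k m)"
      by simp
    then show "p k * (\<nu> m * \<rho> (Suc k) m) - q k * (\<nu> m * \<rho> k m) = G (Suc m) - G m"
      unfolding 1 unfolding G_def by (simp only: left_diff_distrib right_diff_distrib mult_ac) (simp add: diff_eq_eq)
  next
    have "(\<lambda>m. of_nat m * (e - f + of_nat m) * \<nu> m * \<rho> (Suc k) m) \<longlonglongrightarrow> 1"
    proof (rule square_asymp[where \<alpha> = "1 + \<sigma>" and \<beta> = "1 - \<sigma>"])
      have "(\<lambda>m. (gamma_quot (1 + a - f) 1 m * of_nat (Suc m) powr (1 - (1 + a - f))) *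
        (gamma_quot (1 + b - f) (1 + e - f) m * of_nat (Suc m) powr (1 + e - f - (1 + b - f)))) \<longlonglongrightarrow> 1 * 1"
        by (intro tendsto_mult gamma_quot_asymp not_Ints_shift nonint one_nonpos)
      moreover have "of_nat (Suc m) powr (1 + \<sigma>) = of_nat (Suc m) powr (1 - (1 + a - f)) * of_nat (Suc m) powr (1 + e - f - (1 + b - f))" for m
      proof -
        have "1 + \<sigma> = (1 - (1 + a - f)) + (1 + e - f - (1 + b - f))"
          using ef by (simp add: algebra_simps)
        then show ?thesis by (metis powr_add)
      qed
      ultimately show "(\<lambda>m. \<nu> m * of_nat (Suc m) powr (1 + \<sigma>)) \<longlonglongrightarrow> 1" by (simp add: \<nu>_def mult_ac)
      have "2 - f - of_nat (Suc k) - (1 + \<sigma> - f - of_nat (Suc k)) = 1 - \<sigma>" by simp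
      then show "(\<lambda>m. \<rho> (Suc k) m * of_nat (Suc m) powr (1 - \<sigma>)) \<longlonglongrightarrow> 1"
        using gamma_quot_asymp[OF not_Ints_shift(2)[OF mixed_nonint(1), of "Suc k"] not_Ints_shift(2)[OF mixed_nonint(2), of "Suc k"]]
        unfolding \<rho>_def by (simp only:)
    qed simp
    then show "G \<longlonglongrightarrow> -1" unfolding G_def by (rule tendsto_minus)
  qed
  then show ?thesis by (simp add: G_def)
qed


definition "E0 = (\<Sum>n. u n * v n)"
definition "E0' = (\<Sum>n. u' n * v' n)"
definition "J = (\<Sum>k. \<Sum>m. u' k * \<nu> m * \<rho> k m)"
definition "\<kappa> = - (r * suminf \<nu>)"

text \<open>The only use of Gauss's theorem: it evaluates the connection constant
  \<open>\<kappa>\<close>.\<close>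

lemma \<nu>_suminf: "suminf \<nu> * (Gamma (e - a) * Gamma (e - b)) = Gamma (1 + a - f) * Gamma (1 + b - f) * Gamma \<sigma>"
proof -
  have e: "1 + e - f - (1 + a - f) = e - a" "1 + e - f - (1 + b - f) = e - b" "e - a - (1 + b - f) = \<sigma>"
    using ef by (simp_all add: algebra_simps)
  have "(\<Sum>k. gamma_quot (1 + a - f) 1 k * gamma_quot (1 + b - f) (1 + e - f) k) *
    (Gamma (1 + e - f - (1 + a - f)) * Gamma (1 + e - f - (1 + b - f))) =
    Gamma (1 + a - f) * Gamma (1 + b - f) * Gamma (1 + e - f - (1 + a - f) - (1 + b - f))"
    using nonint[THEN not_Ints_shift(3)] \<sigma> by (intro gauss_summation, unfold e) assumption+
  then show ?thesis unfolding e \<nu>_def .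
qed

text \<open>The exponents Re \<sigma> - 1 of \<open>w\<close> and -1 - Re \<sigma> of
  \<open>v\<close> add up to -2, which bounds the inner terms uniformly in k and gives a product
  majorant. In \<open>S_lim\<close> the weight leaves a factor (k+m+1)^(-2 Re \<sigma>), so every
  term dies: \<open>S\<close> has no component of order (k+1)^(\<sigma>-1).\<close>

lemma summable_wv: "summable (\<lambda>m. w m * v (k + m))"
  and double_wv: "(\<lambda>n. \<Sum>k\<le>n. u' k * w (n - k) * v n) sums (\<Sum>k. u' k * S k)" "summable (\<lambda>k. u' k * S k)"
  and S_lim: "(\<lambda>k. S k * of_nat (Suc k) powr (1 - \<sigma>)) \<longlonglongrightarrow> 0"
proof -
  obtain C where C: "C \<ge> 0" "\<And>n. norm (u' n) \<le> C * real (Suc n) powr (-1 - Re \<sigma>)"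
    "\<And>n. norm (v n) \<le> C * real (Suc n) powr (-1 - Re \<sigma>)"
    "\<And>n. norm (w n) \<le> C * real (Suc n) powr (Re \<sigma> - 1)"
    using bounds by metis
  have v: "norm (v (k + m)) \<le> C * real (Suc m) powr (-1 - Re \<sigma>)" for k m
  proof -
    have "real (Suc (k + m)) powr (-1 - Re \<sigma>) \<le> real (Suc m) powr (-1 - Re \<sigma>)"
      using \<sigma> by (intro powr_mono2') auto
    then have "C * real (Suc (k + m)) powr (-1 - Re \<sigma>) \<le> C * real (Suc m) powr (-1 - Re \<sigma>)"
      using C by (intro mult_left_mono) auto
    with C(3)[of "k + m"] show ?thesis by linarith
  qed
  have wv: "norm (w m * v (k + m)) \<le> C * C * real (Suc m) powr (-2)" for k m
  proof -
    have "norm (w m * v (k + m)) \<le> (C * real (Suc m) powr (Re \<sigma> - 1)) * (C * real (Suc m) powr (-1 - Re \<sigma>))"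
      unfolding norm_mult by (intro mult_mono C v) (use C in auto)
    also have "\<dots> = C * C * real (Suc m) powr ((Re \<sigma> - 1) + (-1 - Re \<sigma>))" unfolding powr_add by (simp add: mult_ac)
    finally show ?thesis by simp
  qed
  show swv: "summable (\<lambda>m. w m * v (k + m))" for k
    by (rule summable_comparison_test'[of "\<lambda>m. C * C * real (Suc m) powr (-2)" 0])
      (use wv in \<open>auto intro!: summable_mult summable_Suc_powr simp del: of_nat_Suc\<close>)
  have le: "norm (u' k * w m * v (k + m)) \<le> (C * real (Suc k) powr (-1 - Re \<sigma>)) * (C * C * real (Suc m) powr (-2))" for k m
    unfolding mult.assoc[of "u' k"] norm_mult[of "u' k"] by (intro mult_mono C wv) (use C in auto)
  note ds = double_suminf[where f = "\<lambda>k m. u' k * w m * v (k + m)", OF le]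
  have sM: "summable (\<lambda>k. C * real (Suc k) powr (-1 - Re \<sigma>))" "summable (\<lambda>m. C * C * real (Suc m) powr (-2))"
    using \<sigma> by (auto intro!: summable_mult summable_Suc_powr simp del: of_nat_Suc)
  have S: "(\<Sum>m. u' k * w m * v (k + m)) = u' k * S k" for k
    unfolding S_def mult.assoc by (rule suminf_mult[OF swv])
  have "(\<lambda>n. \<Sum>k\<le>n. u' k * w (n - k) * v (k + (n - k))) sums (\<Sum>k. u' k * S k)"
    using ds(5)[OF sM] C(1) unfolding S by simp
  moreover have "(\<Sum>k\<le>n. u' k * w (n - k) * v (k + (n - k))) = (\<Sum>k\<le>n. u' k * w (n - k) * v n)" for n
    by (intro sum.cong) auto
  ultimately show "(\<lambda>n. \<Sum>k\<le>n. u' k * w (n - k) * v n) sums (\<Sum>k. u' k * S k)" by simp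
  show "summable (\<lambda>k. u' k * S k)" using ds(3)[OF sM] C(1) unfolding S by simp
  have wvk: "norm (w m * v (k + m) * of_nat (Suc k) powr (1 - \<sigma>)) \<le> C * C * real (Suc m) powr (Re \<sigma> - 1) * real (Suc (k + m)) powr (-2 * Re \<sigma>)" for k m
  proof -
    have pm: "real (Suc k) powr Re (1 - \<sigma>) \<le> real (Suc (k + m)) powr (1 - Re \<sigma>)"
      using \<sigma> by (simp del: of_nat_Suc, intro powr_mono2) auto
    have "norm (w m * v (k + m) * of_nat (Suc k) powr (1 - \<sigma>)) \<le>
       (C * real (Suc m) powr (Re \<sigma> - 1)) * (C * real (Suc (k + m)) powr (-1 - Re \<sigma>)) * real (Suc (k + m)) powr (1 - Re \<sigma>)"
      unfolding norm_mult norm_Suc_powr using pm by (intro mult_mono C) (use C in auto)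
    also have "\<dots> = C * C * real (Suc m) powr (Re \<sigma> - 1) * real (Suc (k + m)) powr ((-1 - Re \<sigma>) + (1 - Re \<sigma>))" unfolding powr_add by (simp add: mult_ac)
    finally show ?thesis by simp
  qed
  have "((\<lambda>k. suminf (\<lambda>m. w m * v (k + m) * of_nat (Suc k) powr (1 - \<sigma>))) \<longlongrightarrow> (\<Sum>m. 0)) sequentially"
  proof (rule conjunct2[OF conjunct2[OF tannerys_theorem]])
    fix m
    have "(\<lambda>k. C * C * real (Suc m) powr (Re \<sigma> - 1) * real (Suc (k + m)) powr (-2 * Re \<sigma>)) \<longlonglongrightarrow> C * C * real (Suc m) powr (Re \<sigma> - 1) * 0"
    proof (intro tendsto_mult tendsto_const)
      have "filterlim (\<lambda>k. real (Suc (k + m))) at_top sequentially" by real_asymp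
      then show "(\<lambda>k. real (Suc (k + m)) powr (-2 * Re \<sigma>)) \<longlonglongrightarrow> 0"
        using \<sigma> by (intro tendsto_neg_powr) auto
    qed
    then have z: "(\<lambda>k. C * C * real (Suc m) powr (Re \<sigma> - 1) * real (Suc (k + m)) powr (-2 * Re \<sigma>)) \<longlonglongrightarrow> 0" by simp
    show "(\<lambda>k. w m * v (k + m) * of_nat (Suc k) powr (1 - \<sigma>)) \<longlonglongrightarrow> 0"
      by (rule Lim_null_comparison[OF always_eventually z]) (use wvk in blast)
  next
    have "norm (w m * v (k + m) * of_nat (Suc k) powr (1 - \<sigma>)) \<le> C * C * real (Suc m) powr (-1 - Re \<sigma>)" for k m
    proof -
      have "real (Suc (k + m)) powr (-2 * Re \<sigma>) \<le> real (Suc m) powr (-2 * Re \<sigma>)"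
        using \<sigma> by (intro powr_mono2') auto
      then have "C * C * real (Suc m) powr (Re \<sigma> - 1) * real (Suc (k + m)) powr (-2 * Re \<sigma>) \<le> 
        C * C * real (Suc m) powr (Re \<sigma> - 1) * real (Suc m) powr (-2 * Re \<sigma>)"
        using C by (intro mult_left_mono) auto
      also have "\<dots> = C * C * real (Suc m) powr ((Re \<sigma> - 1) + (-2 * Re \<sigma>))" unfolding powr_add by (simp add: mult_ac)
      finally show ?thesis using wvk[of m k] by (simp add: algebra_simps)
    qed
    then show "\<forall>\<^sub>F (m, k) in sequentially \<times>\<^sub>F sequentially. norm (w m * v (k + m) * of_nat (Suc k) powr (1 - \<sigma>)) \<le> C * C * real (Suc m) powr (-1 - Re \<sigma>)"
      by (intro always_eventually) auto
    show "summable (\<lambda>m. C * C * real (Suc m) powr (-1 - Re \<sigma>))"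
      using \<sigma> by (intro summable_mult summable_Suc_powr) simp
  qed auto
  then show "(\<lambda>k. S k * of_nat (Suc k) powr (1 - \<sigma>)) \<longlonglongrightarrow> 0"
    unfolding S_def by (simp add: suminf_mult2[OF swv])
qed

text \<open>By reflection \<open>\<rho> k m\<close> behaves like r (k+1)^(\<sigma>-1) for each fixed
  m. Hence \<open>P\<close>, in contrast to \<open>S\<close>, has the leading coefficient r times
  the sum of \<open>\<nu>\<close>, which is \<open>- \<kappa>\<close>.\<close>

lemma summable_\<nu>\<rho>: "summable (\<lambda>m. \<nu> m * \<rho> k m)"
  and double_\<nu>\<rho>: "J = (\<Sum>m. \<Sum>k. u' k * \<nu> m * \<rho> k m)" "J = (\<Sum>k. u' k * P k)" "summable (\<lambda>k. u' k * P k)"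
  and P_lim: "(\<lambda>k. P k * of_nat (Suc k) powr (1 - \<sigma>)) \<longlonglongrightarrow> - \<kappa>"
proof -
  obtain C where C: "C \<ge> 0" "\<And>n. norm (u' n) \<le> C * real (Suc n) powr (-1 - Re \<sigma>)"
    "\<And>n. norm (\<nu> n) \<le> C * real (Suc n) powr (-1 - Re \<sigma>)"
    using bounds by metis
  obtain D where D: "D \<ge> 0" "\<And>k m. norm (\<rho> k m) \<le> D" "\<And>k m. norm (\<rho> k m) * real (Suc k) powr (1 - Re \<sigma>) \<le> D * real (Suc m) powr (1 - Re \<sigma>)"
    using \<rho>_bound by metis
  have \<nu>\<rho>: "norm (\<nu> m * \<rho> k m) \<le> C * real (Suc m) powr (-1 - Re \<sigma>) * D" for k m
    unfolding norm_mult by (intro mult_mono C D) (use C in auto)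
  have sN: "summable (\<lambda>m. C * real (Suc m) powr (-1 - Re \<sigma>) * D)" "summable (\<lambda>m. C * real (Suc m) powr (-1 - Re \<sigma>))"
    using \<sigma> by (auto intro!: summable_mult summable_Suc_powr summable_mult2 simp del: of_nat_Suc)
  show sV: "summable (\<lambda>m. \<nu> m * \<rho> k m)" for k
    by (rule summable_comparison_test'[OF sN(1), of 0]) (use \<nu>\<rho> in auto)
  have sV0: "summable \<nu>"
    by (rule summable_comparison_test'[OF sN(2), of 0]) (use C in auto)
  have le: "norm (u' k * \<nu> m * \<rho> k m) \<le> (C * real (Suc k) powr (-1 - Re \<sigma>)) * (C * real (Suc m) powr (-1 - Re \<sigma>) * D)" for k m
    unfolding mult.assoc[of "u' k"] norm_mult[of "u' k"] by (intro mult_mono C \<nu>\<rho>) (use C in auto)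
  note ds = double_suminf[where f = "\<lambda>k m. u' k * \<nu> m * \<rho> k m", OF le sN(2,1)]
  have P: "(\<Sum>m. u' k * \<nu> m * \<rho> k m) = u' k * P k" for k
    unfolding P_def mult.assoc by (rule suminf_mult[OF sV])
  show "J = (\<Sum>m. \<Sum>k. u' k * \<nu> m * \<rho> k m)"
    unfolding J_def using C(1) D(1) by (intro ds(4)) auto
  show "J = (\<Sum>k. u' k * P k)" unfolding J_def P ..
  show "summable (\<lambda>k. u' k * P k)" using ds(3) C(1) D(1) unfolding P by simp
  have "((\<lambda>k. suminf (\<lambda>m. \<nu> m * \<rho> k m * of_nat (Suc k) powr (1 - \<sigma>))) \<longlongrightarrow> (\<Sum>m. r * \<nu> m)) sequentially"
  proof (rule conjunct2[OF conjunct2[OF tannerys_theorem]])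
    fix m
    have "(\<lambda>k. r * \<nu> m * (gamma_quot (f - 1) (f - \<sigma>) (k - m) * of_nat (Suc k) powr (f - \<sigma> - (f - 1)))) \<longlonglongrightarrow> r * \<nu> m * 1"
      by (intro tendsto_mult gamma_quot_asymp_diff tendsto_const not_Ints_shift nonint mixed_nonint)
    moreover have "f - \<sigma> - (f - 1) = 1 - \<sigma>" by simp
    ultimately have "(\<lambda>k. r * \<nu> m * (gamma_quot (f - 1) (f - \<sigma>) (k - m) * of_nat (Suc k) powr (1 - \<sigma>))) \<longlonglongrightarrow> r * \<nu> m" by simp
    moreover have "eventually (\<lambda>k. r * \<nu> m * (gamma_quot (f - 1) (f - \<sigma>) (k - m) * of_nat (Suc k) powr (1 - \<sigma>)) = \<nu> m * \<rho> k m * of_nat (Suc k) powr (1 - \<sigma>)) sequentially"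
      using eventually_ge_at_top[of m] by eventually_elim (simp add: \<rho>_reflect)
    ultimately show "(\<lambda>k. \<nu> m * \<rho> k m * of_nat (Suc k) powr (1 - \<sigma>)) \<longlonglongrightarrow> r * \<nu> m"
      using Lim_transform_eventually by fast
  next
    have "norm (\<nu> m * \<rho> k m * of_nat (Suc k) powr (1 - \<sigma>)) \<le> C * D * real (Suc m) powr (-2 * Re \<sigma>)" for k m
    proof -
      have "norm (\<nu> m * \<rho> k m * of_nat (Suc k) powr (1 - \<sigma>)) = norm (\<nu> m) * (norm (\<rho> k m) * real (Suc k) powr (1 - Re \<sigma>))"
        by (simp add: norm_mult norm_Suc_powr del: of_nat_Suc)
      also have "\<dots> \<le> (C * real (Suc m) powr (-1 - Re \<sigma>)) * (D * real (Suc m) powr (1 - Re \<sigma>))"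
        by (intro mult_mono C D) (use C in auto)
      also have "\<dots> = C * D * real (Suc m) powr ((-1 - Re \<sigma>) + (1 - Re \<sigma>))" unfolding powr_add by (simp add: mult_ac)
      finally show ?thesis by simp
    qed
    then show "\<forall>\<^sub>F (m, k) in sequentially \<times>\<^sub>F sequentially. norm (\<nu> m * \<rho> k m * of_nat (Suc k) powr (1 - \<sigma>)) \<le> C * D * real (Suc m) powr (-2 * Re \<sigma>)"
      by (intro always_eventually) auto
    show "summable (\<lambda>m. C * D * real (Suc m) powr (-2 * Re \<sigma>))"
      using \<sigma> by (intro summable_mult summable_Suc_powr) simp
  qed auto
  moreover have "(\<Sum>m. \<nu> m * \<rho> k m * of_nat (Suc k) powr (1 - \<sigma>)) = P k * of_nat (Suc k) powr (1 - \<sigma>)" for k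
    unfolding P_def by (rule suminf_mult2[OF sV, symmetric])
  moreover have "(\<Sum>m. r * \<nu> m) = - \<kappa>" unfolding \<kappa>_def by (simp add: suminf_mult[OF sV0])
  ultimately show "(\<lambda>k. P k * of_nat (Suc k) powr (1 - \<sigma>)) \<longlonglongrightarrow> - \<kappa>" by simp
qed

text \<open>The difference S - P satisfies the homogeneous recurrence of \<open>v'\<close>, hence is
  a multiple of it. The factor is read off at infinity, where \<open>v'\<close> is asymptotic to
  (k+1)^(\<sigma>-1).\<close>

lemma S_decomposition: "S k = \<kappa> * v' k + P k"
proof -
  define X where "X k = S k - P k" for k
  have X_Suc: "p k * X (Suc k) = q k * X k" for k
  proof -
    have "(\<lambda>m. p k * (w m * v (Suc k + m)) - q k * (w m * v (k + m))) sums (p k * S (Suc k) - q k * S k)"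
      unfolding S_def by (intro sums_diff sums_mult summable_sums summable_wv)
    with S_recurrence have 1: "p k * S (Suc k) - q k * S k = -1" using sums_unique2 by blast
    have "(\<lambda>m. p k * (\<nu> m * \<rho> (Suc k) m) - q k * (\<nu> m * \<rho> k m)) sums (p k * P (Suc k) - q k * P k)"
      unfolding P_def by (intro sums_diff sums_mult summable_sums summable_\<nu>\<rho>)
    with P_recurrence have 2: "p k * P (Suc k) - q k * P k = -1" using sums_unique2 by blast
    have "p k * X (Suc k) - q k * X k = (p k * S (Suc k) - q k * S k) - (p k * P (Suc k) - q k * P k)"
      by (simp add: X_def right_diff_distrib)
    then show ?thesis unfolding 1 2 by simp
  qed
  have pnz: "p k \<noteq> 0" for k
    using nonint(10,11) unfolding p_def by (metis add_eq_0_iff2 minus_of_nat_in_nonpos_Ints mult_eq_0_iff not_Ints_shift(3))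
  have v'0: "v' 0 \<noteq> 0"
    using nonint[THEN not_Ints_shift(3)] by (simp add: v'_def gamma_quot_def Gamma_eq_zero_iff rGamma_eq_zero_iff)
  define K where "K = X 0 / v' 0"
  have X: "X k = K * v' k" for k
  proof (induction k)
    case (Suc k)
    have "p k * X (Suc k) = p k * (K * v' (Suc k))"
      using X_Suc[of k] v'_Suc[of k] Suc by (simp add: mult_ac)
    then show ?case using pnz[of k] by simp
  qed (use v'0 in \<open>simp add: K_def\<close>)
  have "(\<lambda>k. S k * of_nat (Suc k) powr (1 - \<sigma>) - P k * of_nat (Suc k) powr (1 - \<sigma>)) \<longlonglongrightarrow> 0 - (- \<kappa>)"
    by (intro tendsto_diff S_lim P_lim)
  moreover have "S k * of_nat (Suc k) powr (1 - \<sigma>) - P k * of_nat (Suc k) powr (1 - \<sigma>) = K * (v' k * of_nat (Suc k) powr (1 - \<sigma>))" for k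
    using X[of k] by (simp add: X_def left_diff_distrib [symmetric] mult.assoc del: of_nat_Suc)
  ultimately have "(\<lambda>k. K * (v' k * of_nat (Suc k) powr (1 - \<sigma>))) \<longlonglongrightarrow> \<kappa>" by simp
  moreover have "(\<lambda>k. K * (v' k * of_nat (Suc k) powr (1 - \<sigma>))) \<longlonglongrightarrow> K * 1"
  proof (intro tendsto_mult tendsto_const)
    have "(\<lambda>m. (gamma_quot a (e - \<sigma>) m * of_nat (Suc m) powr (e - \<sigma> - a)) *
        (gamma_quot b (f - \<sigma>) m * of_nat (Suc m) powr (f - \<sigma> - b))) \<longlonglongrightarrow> 1 * 1"
      by (intro tendsto_mult gamma_quot_asymp not_Ints_shift nonint)
    moreover have "of_nat (Suc m) powr (1 - \<sigma>) = of_nat (Suc m) powr (e - \<sigma> - a) * of_nat (Suc m) powr (f - \<sigma> - b)" for m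
    proof -
      have "1 - \<sigma> = (e - \<sigma> - a) + (f - \<sigma> - b)" using ef by (simp add: algebra_simps)
      then show ?thesis by (metis powr_add)
    qed
    ultimately show "(\<lambda>k. v' k * of_nat (Suc k) powr (1 - \<sigma>)) \<longlonglongrightarrow> 1" by (simp add: v'_def mult_ac)
  qed
  ultimately have "K = \<kappa>" using LIMSEQ_unique by fastforce
  then show ?thesis using X[of k] by (simp add: X_def algebra_simps)
qed

lemma u_eq: "u n = Gamma c * Gamma d / (Gamma (g - c) * Gamma (g - d) * Gamma \<sigma>) * (\<Sum>k\<le>n. u' k * w (n - k))"
proof -
  have gg: "Gamma (g - c) * Gamma (g - d) * Gamma \<sigma> \<noteq> 0"
    using nonint[THEN not_Ints_shift(3)] \<sigma>_nonpos by (simp add: Gamma_eq_zero_iff)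
  have s: "c + d - g = \<sigma>" using cd by (simp add: algebra_simps)
  have "Gamma (g - c) * Gamma (g - d) * Gamma \<sigma> * u n = Gamma c * Gamma d * (\<Sum>k\<le>n. u' k * w (n - k))"
    using euler_convolution[of c d g n] nonint[THEN not_Ints_shift(3)] \<sigma>_nonpos unfolding s u_def u'_def w_def by simp
  then show ?thesis using gg by (simp add: field_simps)
qed

lemma uv_sums: "(\<lambda>n. u n * v n) sums (Gamma c * Gamma d / (Gamma (g - c) * Gamma (g - d) * Gamma \<sigma>) * (\<Sum>k. u' k * S k))"
proof -
  have "u n * v n = Gamma c * Gamma d / (Gamma (g - c) * Gamma (g - d) * Gamma \<sigma>) * (\<Sum>k\<le>n. u' k * w (n - k) * v n)" for n
    unfolding u_eq by (simp add: sum_distrib_right mult.assoc)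
  then show ?thesis by (simp only: sums_mult[OF double_wv(1)])
qed

lemma summable_u'v': "summable (\<lambda>n. u' n * v' n)"
proof -
  have "\<exists>C\<ge>0. \<forall>n. norm (v' n) \<le> C * real (Suc n) powr Re (a - (e - \<sigma>) + b - (f - \<sigma>))"
    unfolding v'_def by (rule gamma_quot_bound2) (use nonint[THEN not_Ints_shift(3)] in auto)
  then obtain D where D: "D \<ge> 0" "\<And>n. norm (v' n) \<le> D * real (Suc n) powr Re (a - (e - \<sigma>) + b - (f - \<sigma>))" by blast
  have R: "Re (a - (e - \<sigma>) + b - (f - \<sigma>)) \<le> 0"
    using arg_cong[OF ef, of Re] \<sigma> by simp
  have v'b: "norm (v' n) \<le> D" for n
  proof -
    have "real (Suc n) powr Re (a - (e - \<sigma>) + b - (f - \<sigma>)) \<le> real (Suc n) powr 0"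
      by (rule powr_mono[OF R]) simp
    then have "D * real (Suc n) powr Re (a - (e - \<sigma>) + b - (f - \<sigma>)) \<le> D * 1" using D(1) by (intro mult_left_mono) auto
    with D(2)[of n] show ?thesis by simp
  qed
  obtain C where C: "C \<ge> 0" "\<And>n. norm (u' n) \<le> C * real (Suc n) powr (-1 - Re \<sigma>)" using bounds by metis
  have uv: "norm (u' n * v' n) \<le> C * real (Suc n) powr (-1 - Re \<sigma>) * D" for n
    unfolding norm_mult by (intro mult_mono C v'b) (use C in auto)
  have "summable (\<lambda>n. C * real (Suc n) powr (-1 - Re \<sigma>) * D)"
    using \<sigma> by (auto intro!: summable_mult summable_Suc_powr summable_mult2 simp del: of_nat_Suc)
  then show "summable (\<lambda>n. u' n * v' n)"
    by (rule summable_comparison_test'[of _ 0]) (rule uv)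
qed

text \<open>Summing \<open>S_decomposition\<close> against \<open>u'\<close> expresses the original
  series by the transformed one and the double series \<open>J\<close>.\<close>

lemma E0_decomposition: "Gamma (g - c) * Gamma (g - d) * Gamma \<sigma> * E0 = Gamma c * Gamma d * (\<kappa> * E0' + J)"
proof -
  have gg: "Gamma (g - c) * Gamma (g - d) * Gamma \<sigma> \<noteq> 0"
    using nonint[THEN not_Ints_shift(3)] \<sigma>_nonpos by (simp add: Gamma_eq_zero_iff)
  define Q where "Q = Gamma c * Gamma d / (Gamma (g - c) * Gamma (g - d) * Gamma \<sigma>)"
  have "E0 = Q * (\<Sum>k. u' k * S k)"
    unfolding E0_def Q_def using uv_sums by (simp add: sums_iff)
  also have "(\<Sum>k. u' k * S k) = (\<Sum>k. \<kappa> * (u' k * v' k) + u' k * P k)"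
    by (simp add: S_decomposition algebra_simps)
  also have "\<dots> = (\<Sum>k. \<kappa> * (u' k * v' k)) + (\<Sum>k. u' k * P k)"
    by (rule suminf_add [symmetric]) (intro summable_mult summable_u'v', rule double_\<nu>\<rho>(3))
  also have "\<dots> = \<kappa> * E0' + J" unfolding E0'_def double_\<nu>\<rho>(2) suminf_mult[OF summable_u'v'] ..
  finally show ?thesis using gg by (simp add: Q_def field_simps)
qed

lemma E0_eq: "E0 * (rGamma a * rGamma b * rGamma c * rGamma d) = F43_reg a b c d e f g"
  unfolding E0_def u_def v_def
  by (subst F43_reg_gamma_quot)
     (use nonint[THEN not_Ints_shift(3)] uv_sums in \<open>auto simp: sums_iff u_def v_def mult_ac\<close>)

lemma E0'_eq: "E0' * (rGamma a * rGamma b * rGamma (g - c) * rGamma (g - d)) = F43_reg a b (g - c) (g - d) (e - \<sigma>) (f - \<sigma>) g"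
  unfolding E0'_def u'_def v'_def
  by (subst F43_reg_gamma_quot)
     (use nonint[THEN not_Ints_shift(3)] summable_u'v' in \<open>auto simp: u'_def v'_def mult_ac\<close>)

lemma \<kappa>_eq: "\<kappa> * (Gamma (e - a) * Gamma (e - b)) = - (r * (Gamma (1 + a - f) * Gamma (1 + b - f) * Gamma \<sigma>))"
  unfolding \<kappa>_def \<nu>_suminf [symmetric] by simp

end

text \<open>Two instances of the decomposition involve four single series and, up to a factor, the
  same double series. Eliminating the latter pairs \<open>A.E0\<close> with \<open>B.E0'\<close>,
  which form the L on the left, and \<open>A.E0'\<close> with \<open>B.E0\<close>, which form the L
  on the right.\<close>

lemma two_term_relation_local:
  fixes a b c d e f g \<sigma> :: complex
  assumes A: "two_term a b c d e f g \<sigma>" and ni: "1 + c - f \<notin> \<int>" "1 + d - f \<notin> \<int>" "1 + g - f \<notin> \<int>" "1 + g - f + \<sigma> \<notin> \<int>"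
  shows "sin (of_real pi * (f - \<sigma>)) * L_reg a b c d f e g = sin (of_real pi * f) * L_reg a b (g - c) (g - d) (f - \<sigma>) (e - \<sigma>) g"
proof -
  interpret A: two_term a b c d e f g \<sigma> by (rule A)
  have dc: "c = g + \<sigma> - d" and ee: "e = 1 + a + b + \<sigma> - f" using A.cd A.ef by (simp_all add: algebra_simps)
  have s: "1 + e - f - (e - b) = 1 + b - f" "1 + e - f - (e - a) = 1 + a - f" "1 + g - f + \<sigma> - \<sigma> = 1 + g - f"
    "2 - f + \<sigma> - \<sigma> = 2 - f" "1 + (1 + c - f) - (2 - f + \<sigma>) = g - d" "1 + (1 + d - f) - (2 - f + \<sigma>) = g - c"
    "1 + (1 + g - f + \<sigma>) - (2 - f + \<sigma>) = g" "1 + g - f + \<sigma> - (1 + c - f) = d" "1 + g - f + \<sigma> - (1 + d - f) = c"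
    unfolding dc by (simp_all add: algebra_simps)
  \<comment> \<open>The companion series of the transformed \<open>L\<close>; its double series is that of \<open>A\<close> with the summations exchanged.\<close>
  interpret B: two_term "1 + c - f" "1 + d - f" "e - b" "e - a" "1 + g - f + \<sigma>" "2 - f + \<sigma>" "1 + e - f" \<sigma>
  proof
    show "1 + g - f + \<sigma> + (2 - f + \<sigma>) = 1 + (1 + c - f) + (1 + d - f) + \<sigma>" unfolding dc by (simp add: algebra_simps)
    show "e - b + (e - a) = 1 + e - f + \<sigma>" unfolding ee by (simp add: algebra_simps)
    show "2 - f + \<sigma> \<notin> \<int>" using A.mixed_nonint(1) Ints_diff[of "2 - f + \<sigma>" 1] by (auto simp: algebra_simps)
  qed (use A.\<sigma> A.nonint A.mixed_nonint ni in \<open>simp_all only: s not_False_eq_True\<close>)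
  define R where "R = sin (of_real pi * f) / sin (of_real pi * (f - \<sigma>))"
  have sm: "sin (of_real pi * (\<sigma> - f)) = - sin (of_real pi * (f - \<sigma>))"
    by (metis minus_diff_eq mult_minus_right sin_minus)
  have Ar: "A.r = - R" unfolding A.r_def R_def sm by simp
  have "sin (of_real pi * (2 - f + \<sigma>)) = sin (2 * of_real pi + of_real pi * (\<sigma> - f))" by (simp add: algebra_simps)
  also have "\<dots> = - sin (of_real pi * (f - \<sigma>))" by (simp add: sin_add sm)
  finally have 1: "sin (of_real pi * (2 - f + \<sigma>)) = - sin (of_real pi * (f - \<sigma>))" .
  have "sin (of_real pi * (\<sigma> - (2 - f + \<sigma>))) = sin (of_real pi * f - 2 * of_real pi)" by (simp add: algebra_simps)
  also have "\<dots> = sin (of_real pi * f)" by (simp add: sin_diff)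
  finally have Br: "B.r = - (1 / R)" unfolding B.r_def 1 R_def by simp
  have R0: "R \<noteq> 0" using A.sin_nz by (simp add: R_def sm)
  \<comment> \<open>Both kernels depend on the index difference only, and A.r * B.r = 1, so
    reflecting \<open>A.\<rho>\<close> below the diagonal and \<open>B.\<rho>\<close> above it
    yields the same constant.\<close>
  have rho: "A.\<rho> k m = A.r * B.\<rho> m k" for k m
  proof (cases "m \<le> k")
    case True
    then obtain j where k: "k = m + j" using le_Suc_ex by blast
    have "1 + \<sigma> - (2 - f + \<sigma>) - of_nat m + of_nat k = f - 1 + of_nat j" "2 - (2 - f + \<sigma>) - of_nat m + of_nat k = f - \<sigma> + of_nat j"
      by (simp_all add: k)
    then have "B.\<rho> m k = gamma_quot (f - 1) (f - \<sigma>) j" by (simp only: B.\<rho>_def gamma_quot_def)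
    then show ?thesis using A.\<rho>_reflect[OF True] by (simp add: k)
  next
    case False
    then obtain j where m: "m = k + j" using le_Suc_ex nat_le_linear by blast
    have "1 + \<sigma> - f - of_nat k + of_nat m = 1 + \<sigma> - f + of_nat j" "2 - f - of_nat k + of_nat m = 2 - f + of_nat j"
      by (simp_all add: m)
    then have "A.\<rho> k m = gamma_quot (1 + \<sigma> - f) (2 - f) j" by (simp only: A.\<rho>_def gamma_quot_def)
    moreover have e1: "2 - f + \<sigma> - 1 = 1 + \<sigma> - f" by simp
    have "B.\<rho> m k = B.r * gamma_quot (1 + \<sigma> - f) (2 - f) (m - k)" 
      using B.\<rho>_reflect[of k m] False unfolding s e1 by simp
    then have "B.\<rho> m k = B.r * gamma_quot (1 + \<sigma> - f) (2 - f) j" unfolding m by (simp only: add_diff_cancel_left')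
    ultimately show ?thesis using R0 by (simp add: Ar Br)
  qed
  have Bu: "B.u' k = A.\<nu> k" and BV: "B.\<nu> m = A.u' m" for k m
    unfolding B.u'_def A.\<nu>_def B.\<nu>_def A.u'_def s by (simp_all add: gamma_quot_def mult_ac)
  have inner: "(\<Sum>k. A.u' k * A.\<nu> m * A.\<rho> k m) = A.r * (B.u' m * B.P m)" for m
  proof -
    have "A.u' k * A.\<nu> m * A.\<rho> k m = A.r * (B.u' m * (B.\<nu> k * B.\<rho> m k))" for k
      unfolding rho Bu BV by (simp add: mult_ac)
    then show ?thesis
      unfolding B.P_def by (simp add: suminf_mult B.summable_\<nu>\<rho> summable_mult)
  qed
  have "A.J = (\<Sum>m. \<Sum>k. A.u' k * A.\<nu> m * A.\<rho> k m)" by (rule A.double_\<nu>\<rho>)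
  also have "\<dots> = A.r * B.J"
    unfolding inner B.double_\<nu>\<rho>(2) by (rule suminf_mult[OF B.double_\<nu>\<rho>(3)])
  finally have J: "A.J = - (R * B.J)" by (simp add: Ar)
  note np = A.nonint[THEN not_Ints_shift(3)] B.nonint[THEN not_Ints_shift(3)] A.\<sigma>_nonpos
  have G1: "Gamma x * rGamma x = 1" if "x \<notin> \<int>\<^sub>\<le>\<^sub>0" for x :: complex
    using that by (simp add: rGamma_inverse_Gamma Gamma_eq_zero_iff)
  \<comment> \<open>The Gamma constants match crosswise: \<open>X\<close> normalises
    \<open>A.E0\<close> and reappears in \<open>B.\<kappa>\<close>, while \<open>Y\<close>
    normalises \<open>B.E0\<close> and reappears in \<open>A.\<kappa>\<close>. After elimination
    each difference of series therefore carries a single factor.\<close>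
  define X where "X = Gamma (g - c) * Gamma (g - d) * Gamma \<sigma> * rGamma c * rGamma d"
  define Y where "Y = Gamma (1 + a - f) * Gamma (1 + b - f) * Gamma \<sigma> * rGamma (e - a) * rGamma (e - b)"
  have gg: "Gamma c * rGamma c = 1" "Gamma d * rGamma d = 1" "Gamma (e - a) * rGamma (e - a) = 1" "Gamma (e - b) * rGamma (e - b) = 1"
    by (rule G1, use np in blast)+
  have kA: "A.\<kappa> = R * Y"
  proof -
    have "A.\<kappa> * (Gamma (e - a) * rGamma (e - a)) * (Gamma (e - b) * rGamma (e - b)) = 
      A.\<kappa> * (Gamma (e - a) * Gamma (e - b)) * (rGamma (e - a) * rGamma (e - b))" by (simp only: mult_ac)
    also have "\<dots> = R * Y" unfolding A.\<kappa>_eq Ar Y_def by (simp add: mult_ac)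
    finally show ?thesis unfolding gg by simp
  qed
  have kB: "B.\<kappa> = X / R"
  proof -
    have "B.\<kappa> * (Gamma c * rGamma c) * (Gamma d * rGamma d) = 
      B.\<kappa> * (Gamma d * Gamma c) * (rGamma c * rGamma d)" by (simp only: mult_ac)
    also have "\<dots> = X / R" using B.\<kappa>_eq unfolding s Br X_def by (simp add: mult_ac)
    finally show ?thesis unfolding gg by simp
  qed
  have stA: "X * A.E0 = R * Y * A.E0' + A.J"
  proof -
    have "X * A.E0 = (Gamma (g - c) * Gamma (g - d) * Gamma \<sigma> * A.E0) * (rGamma c * rGamma d)" by (simp add: X_def mult_ac)
    also have "\<dots> = (Gamma c * rGamma c) * (Gamma d * rGamma d) * (A.\<kappa> * A.E0' + A.J)" unfolding A.E0_decomposition by (simp only: mult_ac)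
    finally show ?thesis unfolding gg kA by simp
  qed
  have stB: "Y * B.E0 = X / R * B.E0' + B.J"
  proof -
    have "Y * B.E0 = (Gamma (1 + b - f) * Gamma (1 + a - f) * Gamma \<sigma> * B.E0) * (rGamma (e - b) * rGamma (e - a))" by (simp add: Y_def mult_ac)
    also have "\<dots> = (Gamma (e - b) * rGamma (e - b)) * (Gamma (e - a) * rGamma (e - a)) * (B.\<kappa> * B.E0' + B.J)" 
      using B.E0_decomposition unfolding s by (simp only: mult_ac)
    finally show ?thesis unfolding gg kB by simp
  qed
  have "X * (A.E0 - B.E0') = R * Y * (A.E0' - B.E0)"
  proof -
    have "R * (Y * B.E0) = X * B.E0' + R * B.J" unfolding stB using R0 by (simp add: distrib_left)
    with stA J show ?thesis by (simp add: algebra_simps)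
  qed
  then have "sin (of_real pi * (f - \<sigma>)) * X * (A.E0 - B.E0') = sin (of_real pi * (f - \<sigma>)) * R * Y * (A.E0' - B.E0)"
    by (simp only: mult.assoc)
  also have "sin (of_real pi * (f - \<sigma>)) * R = sin (of_real pi * f)" using A.sin_nz by (simp add: R_def sm)
  finally have main: "sin (of_real pi * (f - \<sigma>)) * X * (A.E0 - B.E0') = sin (of_real pi * f) * Y * (A.E0' - B.E0)" .
  \<comment> \<open>A common multiplier of both sides: it turns \<open>X\<close> and
    \<open>Y\<close> into exactly the reciprocal Gamma products that normalise the two regularised L
    functions.\<close>
  define W where "W = rGamma a * rGamma b * rGamma (1 + c - f) * rGamma (1 + d - f) * rGamma (1 + a - f) * rGamma (1 + b - f) *
    rGamma (g - c) * rGamma (g - d) * rGamma \<sigma>"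
  have hh: "Gamma (g - c) * rGamma (g - c) = 1" "Gamma (g - d) * rGamma (g - d) = 1" "Gamma \<sigma> * rGamma \<sigma> = 1"
    "Gamma (1 + a - f) * rGamma (1 + a - f) = 1" "Gamma (1 + b - f) * rGamma (1 + b - f) = 1"
    by (rule G1, use np in blast)+
  have XW: "X * W = rGamma a * rGamma b * rGamma c * rGamma d *
      (rGamma (1 + a - f) * rGamma (1 + b - f) * rGamma (1 + c - f) * rGamma (1 + d - f))"
  proof -
    have "X * W = (Gamma (g - c) * rGamma (g - c)) * (Gamma (g - d) * rGamma (g - d)) * (Gamma \<sigma> * rGamma \<sigma>) *
      (rGamma a * rGamma b * rGamma c * rGamma d *
      (rGamma (1 + a - f) * rGamma (1 + b - f) * rGamma (1 + c - f) * rGamma (1 + d - f)))"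
      by (simp only: X_def W_def mult_ac)
    then show ?thesis unfolding hh by simp
  qed
  have YW: "Y * W = rGamma a * rGamma b * rGamma (g - c) * rGamma (g - d) *
      (rGamma (e - b) * rGamma (e - a) * rGamma (1 + d - f) * rGamma (1 + c - f))"
  proof -
    have "Y * W = (Gamma (1 + a - f) * rGamma (1 + a - f)) * (Gamma (1 + b - f) * rGamma (1 + b - f)) * (Gamma \<sigma> * rGamma \<sigma>) *
      (rGamma a * rGamma b * rGamma (g - c) * rGamma (g - d) *
      (rGamma (e - b) * rGamma (e - a) * rGamma (1 + d - f) * rGamma (1 + c - f)))"
      by (simp only: Y_def W_def mult_ac)
    then show ?thesis unfolding hh by simp
  qed
  have "L_reg a b c d f e g = (A.E0 - B.E0') * (X * W)"
  proof -
    have 1: "F43_reg (1 + a - f) (1 + b - f) (1 + c - f) (1 + d - f) (2 - f) (1 + e - f) (1 + g - f) = 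
      B.E0' * (rGamma (1 + c - f) * rGamma (1 + d - f) * rGamma (1 + b - f) * rGamma (1 + a - f))"
      using B.E0'_eq unfolding s by (simp add: F43_reg_def mult_ac)
    have 2: "F43_reg a b c d f e g = A.E0 * (rGamma a * rGamma b * rGamma c * rGamma d)"
      unfolding A.E0_eq by (rule F43_reg_perm_lower)
    show ?thesis unfolding L_reg_def 1 2 XW by (simp only: left_diff_distrib right_diff_distrib mult_ac)
  qed
  moreover have "L_reg a b (g - c) (g - d) (f - \<sigma>) (e - \<sigma>) g = (A.E0' - B.E0) * (Y * W)"
  proof -
    have t: "1 + a - (f - \<sigma>) = e - b" "1 + b - (f - \<sigma>) = e - a" "1 + (g - c) - (f - \<sigma>) = 1 + d - f"
      "1 + (g - d) - (f - \<sigma>) = 1 + c - f" "2 - (f - \<sigma>) = 2 - f + \<sigma>" "1 + (e - \<sigma>) - (f - \<sigma>) = 1 + e - f" "1 + g - (f - \<sigma>) = 1 + g - f + \<sigma>"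
      unfolding dc ee by (simp_all add: algebra_simps)
    have 1: "F43_reg (e - b) (e - a) (1 + d - f) (1 + c - f) (2 - f + \<sigma>) (1 + e - f) (1 + g - f + \<sigma>) = 
      B.E0 * (rGamma (1 + c - f) * rGamma (1 + d - f) * rGamma (e - b) * rGamma (e - a))"
      unfolding B.E0_eq by (simp add: F43_reg_def mult_ac)
    have 2: "F43_reg a b (g - c) (g - d) (f - \<sigma>) (e - \<sigma>) g = A.E0' * (rGamma a * rGamma b * rGamma (g - c) * rGamma (g - d))"
      unfolding A.E0'_eq by (rule F43_reg_perm_lower)
    show ?thesis unfolding L_reg_def t 1 2 YW by (simp only: left_diff_distrib right_diff_distrib mult_ac)
  qed
  moreover have "sin (of_real pi * (f - \<sigma>)) * X * (A.E0 - B.E0') * W = sin (of_real pi * f) * Y * (A.E0' - B.E0) * W"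
    unfolding main ..
  ultimately show ?thesis by (simp only: mult_ac)
qed

section \<open>Analytic dependence on the parameters\<close>

text \<open>The expansion f = 1 + \<alpha>/T + O(1/T^2) with bounded \<alpha>. An arbitrary filter
  is allowed so that the same calculus serves n tending to infinity uniformly over a compact set,
  and complex t tending to infinity.\<close>

definition first_order :: "'x filter \<Rightarrow> ('x \<Rightarrow> complex) \<Rightarrow> ('x \<Rightarrow> complex) \<Rightarrow> ('x \<Rightarrow> complex) \<Rightarrow> bool" where
  "first_order F T f \<alpha> \<longleftrightarrow> \<alpha> \<in> O[F](\<lambda>_. 1) \<and> (\<lambda>x. f x - 1 - \<alpha> x / T x) \<in> O[F](\<lambda>x. 1 / T x ^ 2)"

lemma inverse_at_infinity_bigo:
  assumes "filterlim T at_infinity F"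
  shows "(\<lambda>x. 1 / T x :: complex) \<in> O[F](\<lambda>_. 1)" "(\<lambda>x. 1 / T x ^ 2 :: complex) \<in> O[F](\<lambda>_. 1)"
proof -
  have ev: "eventually (\<lambda>x. norm (T x) \<ge> 1) F"
    using assms by (auto simp: filterlim_at_infinity[OF order.refl])
  show "(\<lambda>x. 1 / T x :: complex) \<in> O[F](\<lambda>_. 1)"
    by (rule bigoI[of _ 1], use ev in eventually_elim) (auto simp: norm_divide divide_simps)
  show "(\<lambda>x. 1 / T x ^ 2 :: complex) \<in> O[F](\<lambda>_. 1)"
    by (rule bigoI[of _ 1], use ev in eventually_elim) (auto simp: norm_divide norm_power divide_simps intro: order_trans[OF _ self_le_power])
qed

lemma first_order_mult:
  assumes T: "filterlim T at_infinity F" and f: "first_order F T f \<alpha>" and g: "first_order F T g \<beta>"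
  shows "first_order F T (\<lambda>x. f x * g x) (\<lambda>x. \<alpha> x + \<beta> x)"
proof -
  note tau = inverse_at_infinity_bigo[OF T]
  have a: "\<alpha> \<in> O[F](\<lambda>_. 1)" and b: "\<beta> \<in> O[F](\<lambda>_. 1)"
    and f': "(\<lambda>x. f x - 1 - \<alpha> x / T x) \<in> O[F](\<lambda>x. 1 / T x ^ 2)"
    and g': "(\<lambda>x. g x - 1 - \<beta> x / T x) \<in> O[F](\<lambda>x. 1 / T x ^ 2)"
    using f g by (auto simp: first_order_def)
  have aT: "(\<lambda>x. 1 + \<alpha> x / T x) \<in> O[F](\<lambda>_. 1)"
    using sum_in_bigo(1)[OF _ landau_o.big.mult[OF a tau(1)], of "\<lambda>_. 1"] by simp
  have bT: "(\<lambda>x. 1 + \<beta> x / T x) \<in> O[F](\<lambda>_. 1)"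
    using sum_in_bigo(1)[OF _ landau_o.big.mult[OF b tau(1)], of "\<lambda>_. 1"] by simp
  have g1: "g \<in> O[F](\<lambda>_. 1)"
    using sum_in_bigo(1)[OF landau_o.big_trans[OF g' tau(2)] bT] by (simp add: algebra_simps)
  have 1: "(\<lambda>x. (f x - 1 - \<alpha> x / T x) * g x) \<in> O[F](\<lambda>x. 1 / T x ^ 2)"
    using landau_o.big.mult[OF f' g1] by simp
  have 2: "(\<lambda>x. (1 + \<alpha> x / T x) * (g x - 1 - \<beta> x / T x)) \<in> O[F](\<lambda>x. 1 / T x ^ 2)"
    using landau_o.big.mult[OF aT g'] by simp
  have 3: "(\<lambda>x. \<alpha> x * \<beta> x * (1 / T x ^ 2)) \<in> O[F](\<lambda>x. 1 / T x ^ 2)"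
    using landau_o.big.mult[OF landau_o.big.mult[OF a b], of "\<lambda>x. 1 / T x ^ 2" "\<lambda>x. 1 / T x ^ 2"] by simp
  have "(\<lambda>x. (f x - 1 - \<alpha> x / T x) * g x + (1 + \<alpha> x / T x) * (g x - 1 - \<beta> x / T x) + \<alpha> x * \<beta> x * (1 / T x ^ 2)) \<in> O[F](\<lambda>x. 1 / T x ^ 2)"
    by (intro sum_in_bigo 1 2 3)
  also have "(\<lambda>x. (f x - 1 - \<alpha> x / T x) * g x + (1 + \<alpha> x / T x) * (g x - 1 - \<beta> x / T x) + \<alpha> x * \<beta> x * (1 / T x ^ 2)) =
    (\<lambda>x. f x * g x - 1 - (\<alpha> x + \<beta> x) / T x)"
    by (auto simp: fun_eq_iff algebra_simps power2_eq_square add_divide_distrib)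
  finally show ?thesis unfolding first_order_def using sum_in_bigo(1)[OF a b] by auto
qed

text \<open>The remainder is explicit: (a+T)/(e+T) - 1 - (a-e)/T = - (a-e) e / (T (e+T)), and
  T/(e+T) is bounded.\<close>

lemma first_order_quotient:
  assumes T: "filterlim T at_infinity F" and a: "a \<in> O[F](\<lambda>_. 1)" and e: "e \<in> O[F](\<lambda>_. 1)"
  shows "first_order F T (\<lambda>x. (a x + T x) / (e x + T x)) (\<lambda>x. a x - e x)"
proof -
  obtain C where C: "C > 0" "eventually (\<lambda>x. norm (e x) \<le> C) F"
    using e by (auto elim!: landau_o.bigE)
  have ev: "eventually (\<lambda>x. norm (T x) \<ge> 2 * C + 1) F"
    using T C(1) by (auto simp: filterlim_at_infinity[OF order.refl])
  have ae: "(\<lambda>x. a x - e x) \<in> O[F](\<lambda>_. 1)" by (intro sum_in_bigo a e)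
  have nz: "eventually (\<lambda>x. norm (e x + T x) \<ge> norm (T x) / 2 \<and> T x \<noteq> 0 \<and> e x + T x \<noteq> 0) F"
    using C(2) ev
  proof eventually_elim
    case (elim x)
    have "norm (T x) \<le> norm (e x + T x) + norm (e x)" using norm_triangle_ineq4[of "e x + T x" "e x"] by simp
    with elim C(1) have "norm (e x + T x) \<ge> norm (T x) / 2" "norm (T x) > 0" by linarith+
    then show ?case by auto
  qed
  have "(\<lambda>x. T x / (e x + T x)) \<in> O[F](\<lambda>_. 1)"
    by (rule bigoI[of _ 2], use nz in eventually_elim) (auto simp: norm_divide divide_simps)
  from landau_o.big.mult[OF landau_o.big.mult[OF landau_o.big.mult[OF ae e] this], of "\<lambda>x. 1 / T x ^ 2" "\<lambda>x. 1 / T x ^ 2"]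
  have 1: "(\<lambda>x. - ((a x - e x) * e x * (T x / (e x + T x)) * (1 / T x ^ 2))) \<in> O[F](\<lambda>x. 1 / T x ^ 2)"
    by (simp del: times_divide_eq_right times_divide_eq_left)
  have "eventually (\<lambda>x. - ((a x - e x) * e x * (T x / (e x + T x)) * (1 / T x ^ 2)) = (a x + T x) / (e x + T x) - 1 - (a x - e x) / T x) F"
    using nz by eventually_elim (auto simp: divide_simps power2_eq_square, simp add: algebra_simps)
  from landau_o.big.in_cong[OF this, of "\<lambda>x. 1 / T x ^ 2"] 1 ae show ?thesis
    by (simp add: first_order_def)
qed

lemma first_order_bound:
  assumes "first_order F T f (\<lambda>_. \<delta>)"
  obtains C where "C > 0" "eventually (\<lambda>x. norm (f x - 1 - \<delta> / T x) \<le> C / norm (T x) ^ 2) F"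
  using assms unfolding first_order_def by (auto elim!: landau_o.bigE simp: norm_divide norm_power)

text \<open>Covers both kinds of series: \<open>F43_reg\<close>, where the fourth lower parameter is
  the 1 coming from n!, and the bilateral half-sums. The recurrence is stated without division, so
  lower factors may vanish; \<open>balance\<close> makes the term ratio 1 - 2/n + O(1/n^2).\<close>

locale saalschutz_terms =
  fixes t :: "nat \<Rightarrow> complex \<Rightarrow> complex" and a1 a2 a3 a4 e1 e2 e3 e4 :: "complex \<Rightarrow> complex"
  assumes hol: "\<And>n. t n holomorphic_on UNIV"
    and cont: "continuous_on UNIV a1" "continuous_on UNIV a2" "continuous_on UNIV a3" "continuous_on UNIV a4"
      "continuous_on UNIV e1" "continuous_on UNIV e2" "continuous_on UNIV e3" "continuous_on UNIV e4"
    and balance: "\<And>u. e1 u + e2 u + e3 u + e4 u - (a1 u + a2 u + a3 u + a4 u) = 2"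
    and rec: "\<And>n u. t (Suc n) u * ((e1 u + of_nat n) * (e2 u + of_nat n) * (e3 u + of_nat n) * (e4 u + of_nat n)) =
      t n u * ((a1 u + of_nat n) * (a2 u + of_nat n) * (a3 u + of_nat n) * (a4 u + of_nat n))"
begin

text \<open>A Raabe test uniform on compact sets: from some N on, |t n u| n^(3/2) decreases in n for
  all u in K at once.\<close>

lemma dominated:
  assumes K: "compact K"
  obtains M N where "summable M" "\<And>n u. n \<ge> N \<Longrightarrow> u \<in> K \<Longrightarrow> norm (t n u) \<le> M n"
proof -
  let ?F = "sequentially \<times>\<^sub>F principal K"
  let ?T = "\<lambda>(n, u). of_nat n :: complex"
  have bd: "(\<lambda>(n,u). h u) \<in> O[?F](\<lambda>_. 1)" if "continuous_on UNIV h" for h :: "complex \<Rightarrow> complex"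
  proof -
    have "compact (h ` K)" by (intro compact_continuous_image[OF continuous_on_subset[OF that] K]) auto
    then obtain B where "\<forall>x\<in>h ` K. norm x \<le> B" using compact_imp_bounded bounded_iff by blast
    then have "eventually (\<lambda>(n,u). norm (h u) \<le> B) ?F"
      by (auto simp: eventually_prod_filter eventually_principal intro!: exI[of _ "\<lambda>_. True"] exI[of _ "\<lambda>u. u \<in> K"])
    then show ?thesis by (intro bigoI[of _ B]) (auto elim!: eventually_mono)
  qed
  have T: "filterlim ?T at_infinity ?F"
  proof -
    have "filterlim (\<lambda>x. of_nat (fst x) :: complex) at_infinity ?F"
      by (rule filterlim_compose[OF tendsto_of_nat filterlim_fst])
    then show ?thesis by (simp add: case_prod_unfold)
  qed
  define q where "q = (\<lambda>(n,u). ((a1 u + of_nat n) / (e1 u + of_nat n)) * ((a2 u + of_nat n) / (e2 u + of_nat n)) *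
     ((a3 u + of_nat n) / (e3 u + of_nat n)) * ((a4 u + of_nat n) / (e4 u + of_nat n)))"
  have "first_order ?F ?T (\<lambda>x. ((\<lambda>(n,u). a1 u) x + ?T x) / ((\<lambda>(n,u). e1 u) x + ?T x) * (((\<lambda>(n,u). a2 u) x + ?T x) / ((\<lambda>(n,u). e2 u) x + ?T x)) *
      (((\<lambda>(n,u). a3 u) x + ?T x) / ((\<lambda>(n,u). e3 u) x + ?T x)) * (((\<lambda>(n,u). a4 u) x + ?T x) / ((\<lambda>(n,u). e4 u) x + ?T x)))
     (\<lambda>x. (\<lambda>(n,u). a1 u) x - (\<lambda>(n,u). e1 u) x + ((\<lambda>(n,u). a2 u) x - (\<lambda>(n,u). e2 u) x) + ((\<lambda>(n,u). a3 u) x - (\<lambda>(n,u). e3 u) x) + ((\<lambda>(n,u). a4 u) x - (\<lambda>(n,u). e4 u) x))"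
    by (intro first_order_mult first_order_quotient T bd cont)
  also have "(\<lambda>x. (\<lambda>(n,u). a1 u) x - (\<lambda>(n,u). e1 u) x + ((\<lambda>(n,u). a2 u) x - (\<lambda>(n,u). e2 u) x) + ((\<lambda>(n,u). a3 u) x - (\<lambda>(n,u). e3 u) x) + ((\<lambda>(n,u). a4 u) x - (\<lambda>(n,u). e4 u) x))
     = (\<lambda>x::nat \<times> complex. - 2)"
  proof
    fix x :: "nat \<times> complex"
    show "(\<lambda>(n,u). a1 u) x - (\<lambda>(n,u). e1 u) x + ((\<lambda>(n,u). a2 u) x - (\<lambda>(n,u). e2 u) x) + ((\<lambda>(n,u). a3 u) x - (\<lambda>(n,u). e3 u) x) + ((\<lambda>(n,u). a4 u) x - (\<lambda>(n,u). e4 u) x) = -2"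
      using balance[of "snd x"] by (simp add: case_prod_unfold algebra_simps)
  qed
  finally have "first_order ?F ?T q (\<lambda>_. -2)" unfolding q_def by (simp add: case_prod_unfold)
  then obtain C where C: "C > 0" "eventually (\<lambda>x. norm (q x - 1 - (- 2) / ?T x) \<le> C / norm (?T x) ^ 2) ?F"
    by (rule first_order_bound)
  then obtain N1 where N1: "\<And>n u. n \<ge> N1 \<Longrightarrow> u \<in> K \<Longrightarrow> norm (q (n,u) - 1 + 2 / of_nat n) \<le> C / real n ^ 2"
  proof -
    obtain Pf Pg where P: "eventually Pf sequentially" "eventually Pg (principal K)"
      "\<And>n u. Pf n \<Longrightarrow> Pg u \<Longrightarrow> norm (q (n, u) - 1 - (- 2) / ?T (n, u)) \<le> C / norm (?T (n, u)) ^ 2"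
      using C(2) unfolding eventually_prod_filter by blast
    from P(1) obtain N1 where "\<And>n. n \<ge> N1 \<Longrightarrow> Pf n" unfolding eventually_sequentially by blast
    then show thesis using P(2,3) by (intro that[of N1]) (auto simp: eventually_principal)
  qed
  have nzev: "\<exists>N. \<forall>n\<ge>N. \<forall>u\<in>K. h u + of_nat n \<noteq> 0" if "continuous_on UNIV h" for h :: "complex \<Rightarrow> complex"
  proof -
    have "compact (h ` K)" by (intro compact_continuous_image[OF continuous_on_subset[OF that] K]) auto
    then obtain B where B: "\<forall>x\<in>h ` K. norm x \<le> B" using compact_imp_bounded bounded_iff by blast
    obtain N where N: "real N > B" using reals_Archimedean2 by blast
    show ?thesis
    proof (intro exI allI ballI impI notI)
      fix n u assume *: "n \<ge> N" "u \<in> K" "h u + of_nat n = 0"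
      have "h u = - of_nat n" using *(3) by (simp add: eq_neg_iff_add_eq_0)
      then have "norm (h u) = real n" by simp
      with * B N show False by fastforce
    qed
  qed
  obtain N2 where N2: "\<And>n u. n \<ge> N2 \<Longrightarrow> u \<in> K \<Longrightarrow> e1 u + of_nat n \<noteq> 0" using nzev[OF cont(5)] by blast
  obtain N3 where N3: "\<And>n u. n \<ge> N3 \<Longrightarrow> u \<in> K \<Longrightarrow> e2 u + of_nat n \<noteq> 0" using nzev[OF cont(6)] by blast
  obtain N4 where N4: "\<And>n u. n \<ge> N4 \<Longrightarrow> u \<in> K \<Longrightarrow> e3 u + of_nat n \<noteq> 0" using nzev[OF cont(7)] by blast
  obtain N5 where N5: "\<And>n u. n \<ge> N5 \<Longrightarrow> u \<in> K \<Longrightarrow> e4 u + of_nat n \<noteq> 0" using nzev[OF cont(8)] by blast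
  \<comment> \<open>The exponent 3/2 lies strictly between 1, needed for summability, and 2, the
    true order of decay; the gap absorbs the error C/n^2.\<close>
  have "eventually (\<lambda>n. \<bar>1 - 2 / real n\<bar> + C / real n ^ 2 \<le> (real n / real (Suc n)) powr (3/2)) sequentially"
    by real_asymp
  then obtain N6 where N6: "\<And>n. n \<ge> N6 \<Longrightarrow> \<bar>1 - 2 / real n\<bar> + C / real n ^ 2 \<le> (real n / real (Suc n)) powr (3/2)"
    unfolding eventually_sequentially by blast
  define N where "N = N1 + N2 + N3 + N4 + N5 + N6 + 1"
  have N: "N \<ge> N1" "N \<ge> N2" "N \<ge> N3" "N \<ge> N4" "N \<ge> N5" "N \<ge> N6" "N \<ge> 1" by (simp_all add: N_def)
  have decr: "norm (t (Suc n) u) * real (Suc n) powr (3/2) \<le> norm (t n u) * real n powr (3/2)" if n: "n \<ge> N" "u \<in> K" for n u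
  proof -
    have nz: "e1 u + of_nat n \<noteq> 0" "e2 u + of_nat n \<noteq> 0" "e3 u + of_nat n \<noteq> 0" "e4 u + of_nat n \<noteq> 0"
      using N2[OF order_trans[OF N(2) n(1)] n(2)] N3[OF order_trans[OF N(3) n(1)] n(2)] N4[OF order_trans[OF N(4) n(1)] n(2)]
        N5[OF order_trans[OF N(5) n(1)] n(2)] by simp_all
    have "x = y * (p1 / q1 * (p2 / q2) * (p3 / q3) * (p4 / q4))"
      if "x * (q1 * q2 * q3 * q4) = y * (p1 * p2 * p3 * p4)" "q1 \<noteq> 0" "q2 \<noteq> 0" "q3 \<noteq> 0" "q4 \<noteq> 0"
      for x y p1 p2 p3 p4 q1 q2 q3 q4 :: complex
      using that by (simp add: field_simps)
    from this[OF rec[of n u] nz] have "t (Suc n) u = t n u * q (n, u)" by (simp add: q_def)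
    moreover have "norm (q (n, u)) \<le> (real n / real (Suc n)) powr (3/2)"
    proof -
      have "norm (q (n, u)) \<le> norm (1 - 2 / of_nat n :: complex) + norm (q (n,u) - 1 + 2 / of_nat n)"
        using norm_triangle_ineq[of "1 - 2 / of_nat n :: complex" "q (n,u) - 1 + 2 / of_nat n"] by simp
      also have "(1 - 2 / of_nat n :: complex) = of_real (1 - 2 / real n)" by simp
      also have "norm (of_real (1 - 2 / real n) :: complex) = \<bar>1 - 2 / real n\<bar>" by (rule norm_of_real)
      finally show ?thesis using N1[of n u] N6[of n] n N by linarith
    qed
    ultimately have "norm (t (Suc n) u) \<le> norm (t n u) * (real n / real (Suc n)) powr (3/2)"
      by (simp add: norm_mult mult_left_mono del: of_nat_Suc)
    then have "norm (t (Suc n) u) * real (Suc n) powr (3/2) \<le> norm (t n u) * (real n / real (Suc n)) powr (3/2) * real (Suc n) powr (3/2)"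
      by (intro mult_right_mono) auto
    also have "\<dots> = norm (t n u) * real n powr (3/2)" by (simp add: powr_divide del: of_nat_Suc)
    finally show ?thesis .
  qed
  have "compact (t N ` K)" by (intro compact_continuous_image K holomorphic_on_imp_continuous_on holomorphic_on_subset[OF hol]) auto
  then obtain B where B: "\<forall>x\<in>t N ` K. norm x \<le> B" using compact_imp_bounded bounded_iff by blast
  show thesis
  proof (rule that[of "\<lambda>n. B * real N powr (3/2) * real n powr (-3/2)" N])
    show "summable (\<lambda>n. B * real N powr (3/2) * real n powr (-3/2))"
      by (intro summable_mult) (simp add: summable_real_powr_iff)
    fix n u assume n: "n \<ge> N" and u: "u \<in> K"
    from n have "norm (t n u) * real n powr (3/2) \<le> norm (t N u) * real N powr (3/2)"
    proof (induction n rule: dec_induct)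
      case (step n)
      then show ?case using decr[of n u] u by linarith
    qed simp
    also have "\<dots> \<le> B * real N powr (3/2)" using B u by (intro mult_right_mono) auto
    finally have "norm (t n u) \<le> B * real N powr (3/2) / real n powr (3/2)"
      using n N by (subst pos_le_divide_eq) auto
    then show "norm (t n u) \<le> B * real N powr (3/2) * real n powr (-3/2)"
      by (simp add: powr_minus_divide[of _ "3/2", simplified])
  qed
qed

lemma summable_terms: "summable (\<lambda>n. t n u)"
proof -
  obtain M N where M: "summable M" "\<And>n v. n \<ge> N \<Longrightarrow> v \<in> {u} \<Longrightarrow> norm (t n v) \<le> M n"
    using dominated[of "{u}"] by auto
  show ?thesis by (rule summable_comparison_test'[OF M(1)]) (use M(2) in auto)
qed

lemma holomorphic_suminf: "(\<lambda>u. \<Sum>n. t n u) holomorphic_on UNIV"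
proof (rule holomorphic_uniform_sequence[of UNIV "\<lambda>k u. \<Sum>n<k. t n u"])
  show "(\<lambda>u. \<Sum>n<k. t n u) holomorphic_on UNIV" for k by (intro holomorphic_on_sum hol)
  fix x :: complex
  have "uniform_limit (cball x 1) (\<lambda>k u. \<Sum>n<k. t n u) (\<lambda>u. \<Sum>n. t n u) sequentially"
  proof -
    obtain M N where M: "summable M" "\<And>n v. n \<ge> N \<Longrightarrow> v \<in> cball x 1 \<Longrightarrow> norm (t n v) \<le> M n"
      using dominated[of "cball x 1"] by auto
    show ?thesis
      by (rule Weierstrass_m_test_ev[OF _ M(1)]) (rule eventually_sequentiallyI[of N], use M(2) in blast)
  qed
  then show "\<exists>d>0. cball x d \<subseteq> UNIV \<and> uniform_limit (cball x d) (\<lambda>k u. \<Sum>n<k. t n u) (\<lambda>u. \<Sum>n. t n u) sequentially"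
    by (intro exI[of _ 1]) auto
qed auto

end

lemma F43_terms:
  fixes a b c d e f g :: "complex \<Rightarrow> complex"
  assumes h: "a holomorphic_on UNIV" "b holomorphic_on UNIV" "c holomorphic_on UNIV" "d holomorphic_on UNIV" 
    "e holomorphic_on UNIV" "f holomorphic_on UNIV" "g holomorphic_on UNIV"
    and V: "\<And>u. e u + f u + g u = 1 + a u + b u + c u + d u"
  shows "saalschutz_terms (\<lambda>n u. pochhammer (a u) n * pochhammer (b u) n * pochhammer (c u) n * pochhammer (d u) n / fact n *
     (rGamma (e u + of_nat n) * rGamma (f u + of_nat n) * rGamma (g u + of_nat n))) a b c d e f g (\<lambda>_. 1)"
proof
  show "(\<lambda>u. pochhammer (a u) n * pochhammer (b u) n * pochhammer (c u) n * pochhammer (d u) n / fact n *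
     (rGamma (e u + of_nat n) * rGamma (f u + of_nat n) * rGamma (g u + of_nat n))) holomorphic_on UNIV" for n
    by (intro holomorphic_on_mult holomorphic_on_divide holomorphic_pochhammer holomorphic_rGamma' holomorphic_on_add h holomorphic_on_const) auto
  show "e u + f u + g u + 1 - (a u + b u + c u + d u) = 2" for u
    using V[of u] by (simp add: algebra_simps)
  fix n u
  have r: "rGamma (x + of_nat n) = (x + of_nat n) * rGamma (x + of_nat (Suc n))" for x :: complex
    using rGamma_plus1[of "x + of_nat n"] by (simp add: add_ac)
  have nz: "1 + of_nat n \<noteq> (0::complex)" by (metis of_nat_Suc of_nat_neq_0)
  have eq: "(p1 * x1) * (p2 * x2) * (p3 * x3) * (p4 * x4) / (m * F) * (r1 * r2 * r3) * (y1 * y2 * y3 * m) =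
     p1 * p2 * p3 * p4 / F * ((y1 * r1) * (y2 * r2) * (y3 * r3)) * (x1 * x2 * x3 * x4)" if "m \<noteq> 0"
    for m F p1 p2 p3 p4 x1 x2 x3 x4 r1 r2 r3 y1 y2 y3 :: complex
    using that by simp
  have fact: "fact (Suc n) = (1 + of_nat n) * (fact n :: complex)" by simp
  show "pochhammer (a u) (Suc n) * pochhammer (b u) (Suc n) * pochhammer (c u) (Suc n) * pochhammer (d u) (Suc n) / fact (Suc n) *
     (rGamma (e u + of_nat (Suc n)) * rGamma (f u + of_nat (Suc n)) * rGamma (g u + of_nat (Suc n))) *
     ((e u + of_nat n) * (f u + of_nat n) * (g u + of_nat n) * (1 + of_nat n)) =
    pochhammer (a u) n * pochhammer (b u) n * pochhammer (c u) n * pochhammer (d u) n / fact n *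
     (rGamma (e u + of_nat n) * rGamma (f u + of_nat n) * rGamma (g u + of_nat n)) *
     ((a u + of_nat n) * (b u + of_nat n) * (c u + of_nat n) * (d u + of_nat n))"
    unfolding r[of "e u"] r[of "f u"] r[of "g u"] pochhammer_Suc fact by (rule eq[OF nz])
qed (auto intro!: holomorphic_on_imp_continuous_on h)

lemma holomorphic_F43_reg:
  fixes a b c d e f g :: "complex \<Rightarrow> complex"
  assumes "a holomorphic_on UNIV" "b holomorphic_on UNIV" "c holomorphic_on UNIV" "d holomorphic_on UNIV" 
    "e holomorphic_on UNIV" "f holomorphic_on UNIV" "g holomorphic_on UNIV"
    and "\<And>u. e u + f u + g u = 1 + a u + b u + c u + d u"
  shows "(\<lambda>u. F43_reg (a u) (b u) (c u) (d u) (e u) (f u) (g u)) holomorphic_on UNIV"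
  unfolding F43_reg_def by (rule saalschutz_terms.holomorphic_suminf[OF F43_terms[OF assms]])

lemma holomorphic_L_reg:
  fixes a b c d e f g :: "complex \<Rightarrow> complex"
  assumes h: "a holomorphic_on UNIV" "b holomorphic_on UNIV" "c holomorphic_on UNIV" "d holomorphic_on UNIV" 
    "e holomorphic_on UNIV" "f holomorphic_on UNIV" "g holomorphic_on UNIV"
    and V: "\<And>u. e u + f u + g u = 1 + a u + b u + c u + d u"
  shows "(\<lambda>u. L_reg (a u) (b u) (c u) (d u) (e u) (f u) (g u)) holomorphic_on UNIV"
  unfolding L_reg_def using V by (intro holomorphic_intros holomorphic_F43_reg h) (auto simp: algebra_simps)

section \<open>Continuation along lines in the parameter space\<close>

lemma holomorphic_zero_if_eventually:
  assumes "f holomorphic_on UNIV" "eventually (\<lambda>u. f u = 0) (at \<xi>)"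
  shows "f w = (0::complex)"
proof (rule analytic_continuation[of f UNIV "{u. f u = 0}" \<xi>])
  show "\<xi> islimpt {u. f u = 0}"
    unfolding islimpt_iff_eventually
  proof
    assume "eventually (\<lambda>y. y \<notin> {u. f u = 0}) (at \<xi>)"
    with assms(2) have "eventually (\<lambda>_. False) (at \<xi>)" by eventually_elim auto
    then show False by simp
  qed
qed (use assms in auto)

text \<open>Genericity near an end point is secured through imaginary parts: a combination that is
  nonreal there stays off the integers nearby.\<close>

lemma eventually_Im_nonzero:
  assumes "isCont h \<xi>" "Im (h \<xi>) \<noteq> 0"
  shows "eventually (\<lambda>u. h u \<notin> \<int>) (at \<xi>)"
proof -
  have "((\<lambda>u. Im (h u)) \<longlongrightarrow> Im (h \<xi>)) (at \<xi>)" using assms(1) by (intro tendsto_Im) (simp add: isCont_def)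
  from tendsto_imp_eventually_ne[OF this assms(2)] show ?thesis
    by eventually_elim (auto elim!: Ints_cases)
qed

text \<open>The given parameters sit at u = 0, the generic point at u = 1. Being affine, the line
  stays inside the balanced hyperplane once both ends lie in it.\<close>

definition line :: "complex \<Rightarrow> complex \<Rightarrow> complex \<Rightarrow> complex" where
  "line x y u = x + u * (y - x)"

lemma line_simps [simp]: "line x y 0 = x" "line x y 1 = y" by (simp_all add: line_def)
lemma holomorphic_line [holomorphic_intros]: "line x y holomorphic_on A" unfolding line_def by (intro holomorphic_intros)
lemma isCont_line [continuous_intros]: "isCont (line x y) \<xi>" unfolding line_def by (intro continuous_intros)

theorem two_term_relation:
  assumes V: "e + f + g = 1 + a + b + c + d"
  shows "sin (of_real pi * (f - (c + d - g))) * L_reg a b c d f e g = 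
    sin (of_real pi * f) * L_reg a b (g - c) (g - d) (f - (c + d - g)) (e - (c + d - g)) g"
proof -
  \<comment> \<open>At the end point of this line no combination that must avoid the integers is real, and \<open>\<sigma> = 3/4\<close>.\<close>
  define A where "A = line a \<i>"
  define B where "B = line b (2 * \<i>)"
  define C where "C = line c (4 * \<i>)"
  define D where "D = line d (8 * \<i>)"
  define F where "F = line f (16 * \<i>)"
  \<comment> \<open>The imaginary part 12 = 4 + 8 makes C + D - G real at the end point; the end
    point of \<open>E\<close> is then forced by the balance condition.\<close>
  define G where "G = line g (12 * \<i> - 3 / 4)"
  define E where "E = line e (7 / 4 - 13 * \<i>)"
  note defs = A_def B_def C_def D_def E_def F_def G_def
  have VV: "E u + F u + G u = 1 + A u + B u + C u + D u" for u
  proof -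
    have "E u + F u + G u - (1 + A u + B u + C u + D u) = (1 - u) * (e + f + g - (1 + a + b + c + d))"
      unfolding defs line_def by (simp add: algebra_simps)
    then show ?thesis using V by simp
  qed
  have hol: "A holomorphic_on UNIV" "B holomorphic_on UNIV" "C holomorphic_on UNIV" "D holomorphic_on UNIV"
    "E holomorphic_on UNIV" "F holomorphic_on UNIV" "G holomorphic_on UNIV"
    unfolding defs by (intro holomorphic_intros)+
  have con: "isCont A 1" "isCont B 1" "isCont C 1" "isCont D 1" "isCont E 1" "isCont F 1" "isCont G 1"
    unfolding defs by (intro continuous_intros)+
  have one: "A 1 = \<i>" "B 1 = 2 * \<i>" "C 1 = 4 * \<i>" "D 1 = 8 * \<i>" "F 1 = 16 * \<i>" "G 1 = 12 * \<i> - 3 / 4" "E 1 = 7 / 4 - 13 * \<i>"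
    unfolding defs by simp_all
  define S where "S u = C u + D u - G u" for u
  have S1: "S 1 = 3 / 4" by (simp add: S_def one)
  have conS: "isCont S 1" unfolding S_def by (intro continuous_intros con)
  define \<phi> where "\<phi> u = sin (of_real pi * (F u - S u)) * L_reg (A u) (B u) (C u) (D u) (F u) (E u) (G u) - 
    sin (of_real pi * F u) * L_reg (A u) (B u) (G u - C u) (G u - D u) (F u - S u) (E u - S u) (G u)" for u
  have "\<phi> holomorphic_on UNIV"
    unfolding \<phi>_def S_def using VV by (intro holomorphic_intros holomorphic_L_reg hol) (auto simp: algebra_simps)
  moreover have "eventually (\<lambda>u. \<phi> u = 0) (at 1)"
  proof -
    have ReS: "((\<lambda>u. Re (S u)) \<longlongrightarrow> 3 / 4) (at 1)"
      using tendsto_Re[OF isContD[OF conS]] by (simp add: S1)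
    have "eventually (\<lambda>u. A u \<notin> \<int> \<and> B u \<notin> \<int> \<and> C u \<notin> \<int> \<and> D u \<notin> \<int> \<and> E u \<notin> \<int> \<and> F u \<notin> \<int> \<and> G u \<notin> \<int> \<and>
      G u - C u \<notin> \<int> \<and> G u - D u \<notin> \<int> \<and> E u - S u \<notin> \<int> \<and> F u - S u \<notin> \<int> \<and> 1 + A u - F u \<notin> \<int> \<and> 1 + B u - F u \<notin> \<int> \<and>
      1 + E u - F u \<notin> \<int> \<and> E u - A u \<notin> \<int> \<and> E u - B u \<notin> \<int> \<and> 1 + C u - F u \<notin> \<int> \<and> 1 + D u - F u \<notin> \<int> \<and>
      1 + G u - F u \<notin> \<int> \<and> 1 + G u - F u + S u \<notin> \<int>) (at 1)"
      by (intro eventually_conj eventually_Im_nonzero continuous_intros con conS) (simp_all add: one S1)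
    moreover have "eventually (\<lambda>u. Re (S u) > 1 / 2) (at 1)" by (rule order_tendstoD[OF ReS]) simp
    moreover have "eventually (\<lambda>u. Re (S u) < 1) (at 1)" by (rule order_tendstoD[OF ReS]) simp
    ultimately show ?thesis
    proof eventually_elim
      case (elim u)
      have "two_term (A u) (B u) (C u) (D u) (E u) (F u) (G u) (S u)"
      proof
        show "E u + F u = 1 + A u + B u + S u" using VV[of u] by (simp add: S_def algebra_simps)
        show "C u + D u = G u + S u" by (simp add: S_def)
      qed (use elim in blast)+
      from two_term_relation_local[OF this] elim show ?case by (simp add: \<phi>_def)
    qed
  qed
  ultimately have "\<phi> 0 = 0" by (rule holomorphic_zero_if_eventually)
  then show ?thesis by (simp add: \<phi>_def defs S_def)
qed

section \<open>Bilateral sums\<close>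

lemma not_nonpos_Ints_large:
  fixes x t :: complex
  assumes "Re t \<ge> 0" "norm t > 2 * norm x"
  shows "x + t \<notin> \<int>\<^sub>\<le>\<^sub>0"
proof
  assume "x + t \<in> \<int>\<^sub>\<le>\<^sub>0"
  then obtain n where n: "x + t = - of_nat n" by (auto elim!: nonpos_Ints_cases')
  have "Re x + Re t = - real n" using arg_cong[OF n, of Re] by simp
  with assms(1) have "real n \<le> norm x" using abs_Re_le_cmod[of x] by linarith
  moreover have "norm t \<le> norm (x + t) + norm x" using norm_triangle_ineq4[of "x + t" x] by simp
  ultimately show False using assms(2) n by simp
qed

text \<open>Rather than from Stirling's formula, the bound comes from comparing t with t + n for n
  tending to infinity. The normalised product \<open>h\<close> changes by a factor 1 + O(1/|t|^2)
  per unit step and tends to 1, so it is bounded by a convergent product that is uniform in the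
  half-plane.\<close>

lemma gamma_product_bound:
  fixes a1 a2 a3 a4 e1 e2 e3 e4 :: complex
  assumes bal: "e1 + e2 + e3 + e4 - (a1 + a2 + a3 + a4) = 2"
  obtains C M where "C \<ge> 0" "\<And>t. Re t \<ge> 0 \<Longrightarrow> norm t \<ge> M \<Longrightarrow>
    norm (Gamma (a1 + t) * rGamma (e1 + t) * (Gamma (a2 + t) * rGamma (e2 + t)) * (Gamma (a3 + t) * rGamma (e3 + t)) * (Gamma (a4 + t) * rGamma (e4 + t))) \<le> C / norm t ^ 2"
    "\<And>t. Re t \<ge> 0 \<Longrightarrow> norm t \<ge> M \<Longrightarrow> a1 + t \<notin> \<int>\<^sub>\<le>\<^sub>0 \<and> a2 + t \<notin> \<int>\<^sub>\<le>\<^sub>0 \<and> a3 + t \<notin> \<int>\<^sub>\<le>\<^sub>0 \<and> a4 + t \<notin> \<int>\<^sub>\<le>\<^sub>0"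
proof -
  define R where "R t = Gamma (a1 + t) * rGamma (e1 + t) * (Gamma (a2 + t) * rGamma (e2 + t)) * (Gamma (a3 + t) * rGamma (e3 + t)) * (Gamma (a4 + t) * rGamma (e4 + t))" for t
  \<comment> \<open>The last factor comes from t (t+1) / ((t+1) (t+2)); its first-order coefficient
    -2 cancels the 2 of the balance, so \<open>q\<close> has no 1/t term. Writing 0 + t fits the
    shape of \<open>first_order_quotient\<close>.\<close>
  define q where "q t = (e1 + t) / (a1 + t) * ((e2 + t) / (a2 + t)) * ((e3 + t) / (a3 + t)) * ((e4 + t) / (a4 + t)) * ((0 + t) / (2 + t))" for t
  define h where "h t = R t * (t * (t + 1))" for t
  have T: "filterlim (\<lambda>t::complex. t) at_infinity at_infinity" by (rule filterlim_ident)
  have "first_order at_infinity (\<lambda>t. t) q (\<lambda>_. e1 - a1 + (e2 - a2) + (e3 - a3) + (e4 - a4) + (0 - 2))"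
    unfolding q_def by (intro first_order_mult first_order_quotient T) simp_all
  also have "e1 - a1 + (e2 - a2) + (e3 - a3) + (e4 - a4) + (0 - 2) = 0" using bal by (simp add: algebra_simps)
  finally obtain C0 where C0: "C0 > 0" "eventually (\<lambda>t. norm (q t - 1 - 0 / t) \<le> C0 / norm t ^ 2) at_infinity"
    by (rule first_order_bound)
  then obtain b where b: "\<And>t. norm t \<ge> b \<Longrightarrow> norm (q t - 1) \<le> C0 / norm t ^ 2"
    unfolding eventually_at_infinity by auto
  define M where "M = \<bar>b\<bar> + 2 * norm a1 + 2 * norm a2 + 2 * norm a3 + 2 * norm a4 + 2 * norm e1 + 2 * norm e2 + 2 * norm e3 + 2 * norm e4 + 1"
  have Mb: "b \<le> M" "1 \<le> M" "2 * norm a1 < M" "2 * norm a2 < M" "2 * norm a3 < M" "2 * norm a4 < M" 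
     "2 * norm e1 < M" "2 * norm e2 < M" "2 * norm e3 < M" "2 * norm e4 < M"
    unfolding M_def using norm_ge_zero[of a1] norm_ge_zero[of a2] norm_ge_zero[of a3] norm_ge_zero[of a4]
      norm_ge_zero[of e1] norm_ge_zero[of e2] norm_ge_zero[of e3] norm_ge_zero[of e4] by linarith+
  have ni: "a1 + t \<notin> \<int>\<^sub>\<le>\<^sub>0 \<and> a2 + t \<notin> \<int>\<^sub>\<le>\<^sub>0 \<and> a3 + t \<notin> \<int>\<^sub>\<le>\<^sub>0 \<and> a4 + t \<notin> \<int>\<^sub>\<le>\<^sub>0"
     "e1 + t \<notin> \<int>\<^sub>\<le>\<^sub>0 \<and> e2 + t \<notin> \<int>\<^sub>\<le>\<^sub>0 \<and> e3 + t \<notin> \<int>\<^sub>\<le>\<^sub>0 \<and> e4 + t \<notin> \<int>\<^sub>\<le>\<^sub>0" if "Re t \<ge> 0" "norm t \<ge> M" for t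
    using Mb(3-10)[THEN order.strict_trans2[OF _ that(2)], THEN not_nonpos_Ints_large[OF that(1)]] by simp_all
  \<comment> \<open>In the half-plane the steps only move away from 0. With |t| \<ge> 1 the k-th
    exponent is at most C0 / (1 + k^2), independently of t.\<close>
  have nt: "norm (t + of_nat k) ^ 2 \<ge> norm t ^ 2 + real k ^ 2" if "Re t \<ge> 0" for t k
    using mult_nonneg_nonneg[OF that, of "real k"] unfolding cmod_power2 by (simp add: power2_sum)
  have nt': "norm (t + of_nat k) \<ge> norm t" if "Re t \<ge> 0" for t k
    by (rule power2_le_imp_le) (use nt[OF that, of k] zero_le_power2[of "real k"] in linarith, simp)
  have step: "norm (h t) \<le> norm (h (t + 1)) * exp (C0 / norm t ^ 2)" if t: "Re t \<ge> 0" "norm t \<ge> M" for t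
  proof -
    have g: "Gamma (x + t) * rGamma (y + t) = (y + t) / (x + t) * (Gamma (x + (t + 1)) * rGamma (y + (t + 1)))" if "x + t \<notin> \<int>\<^sub>\<le>\<^sub>0" for x y
    proof -
      have "x + t \<noteq> 0" using that by auto
      moreover have "Gamma (x + t + 1) = (x + t) * Gamma (x + t)" using that by (rule Gamma_plus1)
      moreover have "(y + t) * rGamma (y + t + 1) = rGamma (y + t)" by (rule rGamma_plus1)
      ultimately show ?thesis by (simp add: add.assoc [symmetric])
    qed
    have "Re (2 + t) > 0" using t by simp
    then have t2: "2 + t \<noteq> 0" by (metis less_irrefl zero_complex.sel(1))
    have "h t = q t * h (t + 1)"
      unfolding h_def R_def g[OF conjunct1[OF ni(1)[OF t]]] g[OF conjunct1[OF conjunct2[OF ni(1)[OF t]]]]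
        g[OF conjunct1[OF conjunct2[OF conjunct2[OF ni(1)[OF t]]]]] g[OF conjunct2[OF conjunct2[OF conjunct2[OF ni(1)[OF t]]]]] q_def
      using t2 by (simp add: add_ac) (simp add: mult_ac)
    moreover have "norm (q t) \<le> exp (C0 / norm t ^ 2)"
    proof -
      have "norm (q t) \<le> 1 + norm (q t - 1)" using norm_triangle_ineq[of 1 "q t - 1"] by simp
      also have "\<dots> \<le> 1 + C0 / norm t ^ 2" using b[of t] t Mb by simp
      also have "\<dots> \<le> exp (C0 / norm t ^ 2)" by (rule exp_ge_add_one_self)
      finally show ?thesis .
    qed
    ultimately show ?thesis using mult_right_mono[of "norm (q t)" _ "norm (h (t + 1))"]
      by (metis norm_ge_zero norm_mult mult.commute)
  qed
  define K where "K = C0 * (\<Sum>k. 1 / (1 + real k ^ 2))"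
  have sK: "summable (\<lambda>k. 1 / (1 + real k ^ 2))"
  proof (rule summable_comparison_test'[of "\<lambda>k. 1 / real k ^ 2" 1])
    show "summable (\<lambda>k. 1 / real k ^ 2)" using inverse_power_summable[of 2, where 'a = real] by (simp add: divide_inverse)
    fix n :: nat assume "n \<ge> 1"
    moreover have "1 + real n ^ 2 > 0" by (simp add: add_pos_nonneg)
    ultimately show "norm (1 / (1 + real n ^ 2)) \<le> 1 / real n ^ 2" by (simp add: frac_le)
  qed
  have hb: "norm (h t) \<le> norm (h (t + of_nat n)) * exp (C0 * (\<Sum>k<n. 1 / (1 + real k ^ 2)))" if t: "Re t \<ge> 0" "norm t \<ge> M" for t n
  proof (induction n)
    case (Suc n)
    have "norm (h (t + of_nat n)) \<le> norm (h (t + of_nat n + 1)) * exp (C0 / norm (t + of_nat n) ^ 2)"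
      by (rule step) (use t nt'[of t n] in auto)
    also have "\<dots> \<le> norm (h (t + of_nat (Suc n))) * exp (C0 * (1 / (1 + real n ^ 2)))"
    proof -
      have "1 + real n ^ 2 \<le> norm (t + of_nat n) ^ 2"
      proof -
        have "1 \<le> norm t ^ 2" using t Mb by (simp add: power2_eq_square mult_ge1_I)
        then show ?thesis using nt[OF t(1), of n] by linarith
      qed
      then have "C0 / norm (t + of_nat n) ^ 2 \<le> C0 * (1 / (1 + real n ^ 2))"
      proof -
        have "1 + real n ^ 2 > 0" by (simp add: add_pos_nonneg)
        with \<open>1 + real n ^ 2 \<le> _\<close> show ?thesis using C0(1) by (simp add: frac_le)
      qed
      then show ?thesis by (simp add: add_ac mult_left_mono)
    qed
    finally have "norm (h (t + of_nat n)) * exp (C0 * (\<Sum>k<n. 1 / (1 + real k ^ 2))) \<le> 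
      norm (h (t + of_nat (Suc n))) * exp (C0 * (1 / (1 + real n ^ 2))) * exp (C0 * (\<Sum>k<n. 1 / (1 + real k ^ 2)))"
      by (intro mult_right_mono) auto
    note * = order_trans[OF Suc this]
    have "exp (C0 * (\<Sum>k<Suc n. 1 / (1 + real k ^ 2))) = exp (C0 * (1 / (1 + real n ^ 2))) * exp (C0 * (\<Sum>k<n. 1 / (1 + real k ^ 2)))"
      by (simp add: exp_add distrib_left)
    with * show ?case by (simp only: mult.assoc)
  qed simp
  have lim: "(\<lambda>n. h (t + of_nat n)) \<longlonglongrightarrow> 1" if t: "Re t \<ge> 0" "norm t \<ge> M" for t
  proof -
    have inv: "(\<lambda>n. inverse (complex_of_real (real (Suc n)))) \<longlonglongrightarrow> of_real 0"
      unfolding of_real_inverse [symmetric] by (intro tendsto_of_real) real_asymp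
    define x1 x2 x3 x4 where "x1 = e1 + t - (a1 + t)" and "x2 = e2 + t - (a2 + t)" and "x3 = e3 + t - (a3 + t)" and "x4 = e4 + t - (a4 + t)"
    note xd = x1_def x2_def x3_def x4_def
    have "(\<lambda>n. (gamma_quot (a1 + t) (e1 + t) n * of_nat (Suc n) powr x1) * (gamma_quot (a2 + t) (e2 + t) n * of_nat (Suc n) powr x2) *
      (gamma_quot (a3 + t) (e3 + t) n * of_nat (Suc n) powr x3) * (gamma_quot (a4 + t) (e4 + t) n * of_nat (Suc n) powr x4) *
      (1 + (t - 1) * inverse (complex_of_real (real (Suc n)))) * (1 + t * inverse (complex_of_real (real (Suc n))))) \<longlonglongrightarrow> 1 * 1 * 1 * 1 * (1 + (t - 1) * of_real 0) * (1 + t * of_real 0)"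
      unfolding xd using ni[OF t] by (intro tendsto_mult gamma_quot_asymp tendsto_add tendsto_const inv) auto
    moreover have "(gamma_quot (a1 + t) (e1 + t) n * of_nat (Suc n) powr x1) * (gamma_quot (a2 + t) (e2 + t) n * of_nat (Suc n) powr x2) *
      (gamma_quot (a3 + t) (e3 + t) n * of_nat (Suc n) powr x3) * (gamma_quot (a4 + t) (e4 + t) n * of_nat (Suc n) powr x4) *
      (1 + (t - 1) * inverse (complex_of_real (real (Suc n)))) * (1 + t * inverse (complex_of_real (real (Suc n)))) = h (t + of_nat n)" for n
    proof -
      define N :: complex where "N = of_nat (Suc n)"
      have N: "N \<noteq> 0" unfolding N_def of_nat_eq_0_iff by simp
      have "x1 + x2 + x3 + x4 = 2" using bal by (simp add: xd algebra_simps)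
      then have "N powr x1 * N powr x2 * N powr x3 * N powr x4 = N ^ 2"
        using N by (simp only: powr_add [symmetric]) simp
      moreover have "N ^ 2 * ((1 + (t - 1) * inverse N) * (1 + t * inverse N)) = (t + (N - 1)) * ((t + (N - 1)) + 1)"
        using N by (simp add: field_simps power2_eq_square)
      moreover have "N - 1 = of_nat n" by (simp add: N_def)
      ultimately have e: "(N powr x1 * N powr x2 * N powr x3 * N powr x4) * ((1 + (t - 1) * inverse N) * (1 + t * inverse N)) = (t + of_nat n) * (t + of_nat n + 1)"
        by simp
      have "h (t + of_nat n) = gamma_quot (a1 + t) (e1 + t) n * gamma_quot (a2 + t) (e2 + t) n * gamma_quot (a3 + t) (e3 + t) n * gamma_quot (a4 + t) (e4 + t) n *
         ((t + of_nat n) * (t + of_nat n + 1))"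
        by (simp only: h_def R_def gamma_quot_def add.assoc)
      then show ?thesis unfolding e [symmetric] of_real_of_nat_eq N_def [symmetric] by (simp only: mult_ac)
    qed
    ultimately show ?thesis by simp
  qed
  have hK: "norm (h t) \<le> exp K" if t: "Re t \<ge> 0" "norm t \<ge> M" for t
  proof -
    have "(\<lambda>n. norm (h (t + of_nat n)) * exp K) \<longlonglongrightarrow> norm (1::complex) * exp K"
      by (intro tendsto_mult tendsto_norm lim t tendsto_const)
    moreover have "norm (h t) \<le> norm (h (t + of_nat n)) * exp K" for n
    proof -
      have "(\<Sum>k<n. 1 / (1 + real k ^ 2)) \<le> (\<Sum>k. 1 / (1 + real k ^ 2))" by (intro sum_le_suminf sK) auto
      then have "exp (C0 * (\<Sum>k<n. 1 / (1 + real k ^ 2))) \<le> exp K" using C0 by (simp add: K_def)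
      then have "norm (h (t + of_nat n)) * exp (C0 * (\<Sum>k<n. 1 / (1 + real k ^ 2))) \<le> norm (h (t + of_nat n)) * exp K"
        by (intro mult_left_mono) auto
      with hb[OF t, of n] show ?thesis by linarith
    qed
    ultimately show ?thesis using LIMSEQ_le_const[of _ _ "norm (h t)"] by (metis (no_types, lifting) mult_1 norm_one)
  qed
  show thesis
  proof (rule that[of "exp K" M])
    fix t assume t: "Re t \<ge> 0" "norm t \<ge> M"
    have t0: "norm t > 0" using t Mb by linarith
    have "norm (R t) * norm t ^ 2 \<le> norm (R t) * (norm t * norm (t + 1))"
      using nt'[OF t(1), of 1] unfolding power2_eq_square by (intro mult_left_mono) auto
    also have "\<dots> = norm (h t)" by (simp add: h_def norm_mult)
    also have "\<dots> \<le> exp K" by (rule hK[OF t])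
    finally show "norm (Gamma (a1 + t) * rGamma (e1 + t) * (Gamma (a2 + t) * rGamma (e2 + t)) * (Gamma (a3 + t) * rGamma (e3 + t)) * (Gamma (a4 + t) * rGamma (e4 + t))) \<le> exp K / norm t ^ 2"
      unfolding R_def using t0 by (subst pos_le_divide_eq) auto
    show "a1 + t \<notin> \<int>\<^sub>\<le>\<^sub>0 \<and> a2 + t \<notin> \<int>\<^sub>\<le>\<^sub>0 \<and> a3 + t \<notin> \<int>\<^sub>\<le>\<^sub>0 \<and> a4 + t \<notin> \<int>\<^sub>\<le>\<^sub>0" using ni t by blast
  qed simp
qed

text \<open>Here 1/Gamma(1-a-t) replaces Gamma(a+t). The two differ by sin(pi (a+t)) / pi, which
  makes the term entire, and the four sign changes per unit step cancel. The fourth lower parameter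
  \<open>p\<close>, equal to 1 in the application, is kept free so that any lower parameter can be
  moved to its place.\<close>

definition bil_term :: "complex \<Rightarrow> complex \<Rightarrow> complex \<Rightarrow> complex \<Rightarrow> complex \<Rightarrow> complex \<Rightarrow> complex \<Rightarrow> complex \<Rightarrow> complex \<Rightarrow> complex" where
  "bil_term a b c d p e f g t = rGamma (1 - a - t) * rGamma (1 - b - t) * rGamma (1 - c - t) * rGamma (1 - d - t) *
     (rGamma (p + t) * rGamma (e + t) * rGamma (f + t) * rGamma (g + t))"

definition bil_half :: "complex \<Rightarrow> complex \<Rightarrow> complex \<Rightarrow> complex \<Rightarrow> complex \<Rightarrow> complex \<Rightarrow> complex \<Rightarrow> complex \<Rightarrow> complex \<Rightarrow> complex" where
  "bil_half a b c d p e f g w = (\<Sum>n. bil_term a b c d p e f g (w + of_nat n))"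

text \<open>The second half-sum covers the negative indices: by \<open>bil_term_reflect\<close> its
  n-th term is the original term at w - 1 - n. Both halves are thus sums to the right and obey the
  same estimates.\<close>

definition bil :: "complex \<Rightarrow> complex \<Rightarrow> complex \<Rightarrow> complex \<Rightarrow> complex \<Rightarrow> complex \<Rightarrow> complex \<Rightarrow> complex \<Rightarrow> complex \<Rightarrow> complex" where
  "bil a b c d p e f g w = bil_half a b c d p e f g w +
     bil_half (1 - p) (1 - e) (1 - f) (1 - g) (1 - a) (1 - b) (1 - c) (1 - d) (1 - w)"

lemma bil_term_reflect:
  "bil_term (1 - p) (1 - e) (1 - f) (1 - g) (1 - a) (1 - b) (1 - c) (1 - d) (- t) = bil_term a b c d p e f g t"
  by (simp add: bil_term_def mult_ac)

lemma norm_sin_le: "norm (sin z) \<le> exp \<bar>Im z\<bar>" for z :: complex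
proof -
  have "norm (exp (\<i> * z) - exp (- (\<i> * z))) \<le> norm (exp (\<i> * z)) + norm (exp (- (\<i> * z)))" by (rule norm_triangle_ineq4)
  also have "\<dots> \<le> exp \<bar>Im z\<bar> + exp \<bar>Im z\<bar>" unfolding norm_exp_eq_Re by (intro add_mono) auto
  finally show ?thesis by (simp add: sin_exp_eq norm_divide norm_mult)
qed

lemma bil_half_terms:
  assumes "p + e + f + g - (a + b + c + d) = 2"
  shows "saalschutz_terms (\<lambda>n u. bil_term a b c d p e f g (u + of_nat n)) (\<lambda>u. a + u) (\<lambda>u. b + u) (\<lambda>u. c + u) (\<lambda>u. d + u)
     (\<lambda>u. p + u) (\<lambda>u. e + u) (\<lambda>u. f + u) (\<lambda>u. g + u)"
proof
  show "(\<lambda>u. bil_term a b c d p e f g (u + of_nat n)) holomorphic_on UNIV" for n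
    unfolding bil_term_def by (intro holomorphic_on_mult holomorphic_rGamma' holomorphic_on_add holomorphic_on_diff holomorphic_on_const holomorphic_on_ident)
  show "p + u + (e + u) + (f + u) + (g + u) - (a + u + (b + u) + (c + u) + (d + u)) = 2" for u
    using assms by (simp add: algebra_simps)
  fix n u
  have r1: "rGamma (1 - x - (u + of_nat (Suc n))) = - (x + u + of_nat n) * rGamma (1 - x - (u + of_nat n))" for x :: complex
    using rGamma_plus1[of "1 - x - (u + of_nat (Suc n))"] by (simp add: algebra_simps)
  have r2: "rGamma (x + (u + of_nat n)) = (x + u + of_nat n) * rGamma (x + (u + of_nat (Suc n)))" for x :: complex
    using rGamma_plus1[of "x + (u + of_nat n)"] by (simp add: algebra_simps)
  show "bil_term a b c d p e f g (u + of_nat (Suc n)) * ((p + u + of_nat n) * (e + u + of_nat n) * (f + u + of_nat n) * (g + u + of_nat n)) =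
     bil_term a b c d p e f g (u + of_nat n) * ((a + u + of_nat n) * (b + u + of_nat n) * (c + u + of_nat n) * (d + u + of_nat n))"
    unfolding bil_term_def r1 r2 by (simp only: mult_minus_left mult_minus_right minus_minus mult_ac)
qed (intro continuous_intros)+

lemma bil_half_Suc:
  assumes "p + e + f + g - (a + b + c + d) = 2"
  shows "bil_half a b c d p e f g w = bil_term a b c d p e f g w + bil_half a b c d p e f g (w + 1)"
  using suminf_split_head[OF saalschutz_terms.summable_terms[OF bil_half_terms[OF assms], of w]]
  unfolding bil_half_def by (simp add: add_ac)

lemma reflected_balance:
  fixes a b c d p e f g :: complex
  assumes "p + e + f + g - (a + b + c + d) = 2"
  shows "1 - a + (1 - b) + (1 - c) + (1 - d) - (1 - p + (1 - e) + (1 - f) + (1 - g)) = 2"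
  using assms by (simp add: algebra_simps)

lemma bil_plus_1:
  assumes "p + e + f + g - (a + b + c + d) = 2"
  shows "bil a b c d p e f g (w + 1) = bil a b c d p e f g w"
  using bil_half_Suc[OF assms, of w] bil_half_Suc[OF reflected_balance[OF assms], of "- w"] bil_term_reflect[of p e f g a b c d w]
  by (simp add: bil_def)

lemma bil_add_int:
  assumes "p + e + f + g - (a + b + c + d) = 2"
  shows "bil a b c d p e f g (w + of_int n) = bil a b c d p e f g w"
proof -
  have nat: "bil a b c d p e f g (w + of_nat k) = bil a b c d p e f g w" for k w
  proof (induction k)
    case (Suc k)
    then show ?case using bil_plus_1[OF assms, of "w + of_nat k"] by (simp add: add_ac)
  qed simp
  show ?thesis
  proof (cases n rule: int_cases)
    case (neg k)
    have "w + of_int n = w - of_nat (Suc k)" by (simp add: neg)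
    then show ?thesis using nat[of "w - of_nat (Suc k)" "Suc k"] by (simp only: diff_add_cancel)
  qed (simp add: nat)
qed

text \<open>Four sines contribute exp(4 pi |Im w|), and \<open>gamma_product_bound\<close> leaves |w
  + n|^(-2), part of which is kept as decay in |Im w|.\<close>

lemma bil_half_growth:
  assumes bal: "p + e + f + g - (a + b + c + d) = 2"
  obtains C M where "C \<ge> 0" "M \<ge> 1" "\<And>w. 0 \<le> Re w \<Longrightarrow> \<bar>Im w\<bar> \<ge> M \<Longrightarrow>
    norm (bil_half a b c d p e f g w) \<le> C * (exp (4 * pi * \<bar>Im w\<bar>) * \<bar>Im w\<bar> powr (-1/2))"
proof -
  obtain C M where C: "C \<ge> 0" and R: "\<And>t. Re t \<ge> 0 \<Longrightarrow> norm t \<ge> M \<Longrightarrow>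
    norm (Gamma (a + t) * rGamma (p + t) * (Gamma (b + t) * rGamma (e + t)) * (Gamma (c + t) * rGamma (f + t)) * (Gamma (d + t) * rGamma (g + t))) \<le> C / norm t ^ 2"
    and ni: "\<And>t. Re t \<ge> 0 \<Longrightarrow> norm t \<ge> M \<Longrightarrow> a + t \<notin> \<int>\<^sub>\<le>\<^sub>0 \<and> b + t \<notin> \<int>\<^sub>\<le>\<^sub>0 \<and> c + t \<notin> \<int>\<^sub>\<le>\<^sub>0 \<and> d + t \<notin> \<int>\<^sub>\<le>\<^sub>0"
    using gamma_product_bound[OF bal] by blast
  define E where "E = exp (pi * (\<bar>Im a\<bar> + \<bar>Im b\<bar> + \<bar>Im c\<bar> + \<bar>Im d\<bar>))"
  have term_le: "norm (bil_term a b c d p e f g t) \<le> E * exp (4 * pi * \<bar>Im t\<bar>) * (C / norm t ^ 2)" if t: "Re t \<ge> 0" "norm t \<ge> M" for t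
  proof -
    have r: "rGamma (1 - x - t) = sin (of_real pi * (x + t)) / of_real pi * Gamma (x + t)" if "x + t \<notin> \<int>\<^sub>\<le>\<^sub>0" for x
    proof -
      have "rGamma (1 - x - t) * (rGamma (x + t) * Gamma (x + t)) = sin (of_real pi * (x + t)) / of_real pi * Gamma (x + t)"
        using rGamma_reflection_complex[of "x + t"] by (simp add: algebra_simps)
      moreover have "rGamma (x + t) * Gamma (x + t) = 1" using that by (simp add: rGamma_inverse_Gamma Gamma_eq_zero_iff)
      ultimately show ?thesis by simp
    qed
    have s: "norm (sin (of_real pi * (x + t)) / of_real pi) \<le> exp (pi * \<bar>Im x\<bar>) * exp (pi * \<bar>Im t\<bar>)" for x
    proof -
      have "norm (sin (of_real pi * (x + t))) \<le> exp (pi * (\<bar>Im x\<bar> + \<bar>Im t\<bar>))"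
      proof (rule order_trans[OF norm_sin_le])
        have "\<bar>Im (of_real pi * (x + t))\<bar> = pi * \<bar>Im x + Im t\<bar>" by (simp add: abs_mult)
        also have "\<dots> \<le> pi * (\<bar>Im x\<bar> + \<bar>Im t\<bar>)" by (intro mult_left_mono) auto
        finally show "exp \<bar>Im (of_real pi * (x + t))\<bar> \<le> exp (pi * (\<bar>Im x\<bar> + \<bar>Im t\<bar>))" by simp
      qed
      moreover have "norm (sin (of_real pi * (x + t)) / of_real pi) \<le> norm (sin (of_real pi * (x + t)))"
        using pi_ge_two by (simp add: norm_divide divide_le_eq mult_le_cancel_left1)
      ultimately show ?thesis by (simp add: exp_add distrib_left)
    qed
    let ?s = "\<lambda>x. sin (of_real pi * (x + t)) / of_real pi"
    note ni' = ni[OF t]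
    have "bil_term a b c d p e f g t = (?s a * ?s b * ?s c * ?s d) *
      (Gamma (a + t) * rGamma (p + t) * (Gamma (b + t) * rGamma (e + t)) * (Gamma (c + t) * rGamma (f + t)) * (Gamma (d + t) * rGamma (g + t)))"
      unfolding bil_term_def r[OF conjunct1[OF ni']] r[OF conjunct1[OF conjunct2[OF ni']]] r[OF conjunct1[OF conjunct2[OF conjunct2[OF ni']]]]
        r[OF conjunct2[OF conjunct2[OF conjunct2[OF ni']]]] by (simp only: mult_ac)
    then have "norm (bil_term a b c d p e f g t) \<le> norm (?s a * ?s b * ?s c * ?s d) * (C / norm t ^ 2)"
      using mult_left_mono[OF R[OF t] norm_ge_zero, of "?s a * ?s b * ?s c * ?s d"] by (simp only: norm_mult)
    note le1 = this
    have "norm (?s a * ?s b * ?s c * ?s d) \<le> (exp (pi * \<bar>Im a\<bar>) * exp (pi * \<bar>Im t\<bar>)) * (exp (pi * \<bar>Im b\<bar>) * exp (pi * \<bar>Im t\<bar>)) * 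
       (exp (pi * \<bar>Im c\<bar>) * exp (pi * \<bar>Im t\<bar>)) * (exp (pi * \<bar>Im d\<bar>) * exp (pi * \<bar>Im t\<bar>))"
      unfolding norm_mult by (intro mult_mono s mult_nonneg_nonneg norm_ge_zero) auto
    also have "\<dots> = E * exp (4 * pi * \<bar>Im t\<bar>)"
      unfolding E_def exp_add [symmetric] by (simp add: algebra_simps)
    finally have "norm (?s a * ?s b * ?s c * ?s d) * (C / norm t ^ 2) \<le> E * exp (4 * pi * \<bar>Im t\<bar>) * (C / norm t ^ 2)"
      using C by (intro mult_right_mono) auto
    with le1 show ?thesis by linarith
  qed
  define Z where "Z = (\<Sum>n. real (Suc n) powr (-3/2))"
  have sZ: "summable (\<lambda>n. real (Suc n) powr (-3/2))" by (rule summable_Suc_powr) simp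
  show thesis
  proof (rule that[of "E * C * 2 * Z" "max M 1"])
    show "0 \<le> E * C * 2 * Z" using C suminf_nonneg[OF sZ] by (simp add: E_def Z_def)
    fix w assume w: "0 \<le> Re w" "max M 1 \<le> \<bar>Im w\<bar>"
    define y where "y = \<bar>Im w\<bar>"
    have y: "y \<ge> 1" "y \<ge> M" using w by (auto simp: y_def)
    have tl: "norm (bil_term a b c d p e f g (w + of_nat n)) \<le> (E * C * 2 * (exp (4 * pi * y) * y powr (-1/2))) * real (Suc n) powr (-3/2)" for n
    proof -
      have n2: "norm (w + of_nat n) ^ 2 \<ge> y ^ 2 + real n ^ 2"
      proof -
        have "(Re w + real n) ^ 2 \<ge> real n ^ 2" using w by (intro power_mono) auto
        then show ?thesis unfolding cmod_power2 by (simp add: y_def)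
      qed
      then have "y ^ 2 \<le> norm (w + of_nat n) ^ 2" using zero_le_power2[of "real n"] by linarith
      then have yn: "y \<le> norm (w + of_nat n)" by (rule power2_le_imp_le) simp
      \<comment> \<open>The exponent 2 is shared out: 3/2 makes the sum over n converge, and the
        remaining 1/2 is the gain in y. Any positive gain would do.\<close>
      have "y powr (1/2) * real (Suc n) powr (3/2) \<le> (real n + y) powr (1/2) * (real n + y) powr (3/2)"
        using y by (intro mult_mono powr_mono2) auto
      also have "\<dots> = (real n + y) ^ 2" using y by (simp add: powr_add [symmetric])
      also have "\<dots> \<le> 2 * (y ^ 2 + real n ^ 2)" using sum_squares_bound[of "real n" y] by (simp add: power2_sum)
      also have "\<dots> \<le> 2 * norm (w + of_nat n) ^ 2" using n2 by simp
      finally have le: "y powr (1/2) * real (Suc n) powr (3/2) \<le> 2 * norm (w + of_nat n) ^ 2" .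
      have pos: "y powr (1/2) * real (Suc n) powr (3/2) > 0" using y by (intro mult_pos_pos) auto
      have "C / norm (w + of_nat n) ^ 2 = 2 * C / (2 * norm (w + of_nat n) ^ 2)" by simp
      also have "\<dots> \<le> 2 * C / (y powr (1/2) * real (Suc n) powr (3/2))"
        using C by (intro frac_le le pos) auto
      also have "\<dots> = 2 * C * (y powr (-1/2) * real (Suc n) powr (-3/2))"
        by (simp add: powr_minus_divide[of _ "1/2", simplified] powr_minus_divide[of _ "3/2", simplified])
      finally have "E * exp (4 * pi * y) * (C / norm (w + of_nat n) ^ 2) \<le> E * exp (4 * pi * y) * (2 * C * (y powr (-1/2) * real (Suc n) powr (-3/2)))"
        by (intro mult_left_mono) (auto simp: E_def)
      moreover have "norm (bil_term a b c d p e f g (w + of_nat n)) \<le> E * exp (4 * pi * y) * (C / norm (w + of_nat n) ^ 2)"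
        using term_le[of "w + of_nat n"] w yn y by (simp add: y_def)
      ultimately show ?thesis by (simp add: mult_ac)
    qed
    have sn: "summable (\<lambda>n. norm (bil_term a b c d p e f g (w + of_nat n)))"
      by (rule summable_comparison_test'[OF summable_mult[OF sZ], of 0]) (use tl in simp)
    have "norm (bil_half a b c d p e f g w) \<le> (\<Sum>n. norm (bil_term a b c d p e f g (w + of_nat n)))"
      unfolding bil_half_def by (rule summable_norm[OF sn])
    also have "\<dots> \<le> (\<Sum>n. (E * C * 2 * (exp (4 * pi * y) * y powr (-1/2))) * real (Suc n) powr (-3/2))"
      by (intro suminf_le tl sn summable_mult sZ)
    also have "\<dots> = (E * C * 2 * (exp (4 * pi * y) * y powr (-1/2))) * Z" unfolding Z_def by (rule suminf_mult[OF sZ])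
    finally show "norm (bil_half a b c d p e f g w) \<le> E * C * 2 * Z * (exp (4 * pi * \<bar>Im w\<bar>) * \<bar>Im w\<bar> powr (-1/2))"
      by (simp add: y_def mult_ac)
  qed simp
qed

lemma bil_growth:
  assumes bal: "p + e + f + g - (a + b + c + d) = 2"
  obtains C M where "C \<ge> 0" "M \<ge> 1" "\<And>w. \<bar>Im w\<bar> \<ge> M \<Longrightarrow>
    norm (bil a b c d p e f g w) \<le> C * (exp (4 * pi * \<bar>Im w\<bar>) * \<bar>Im w\<bar> powr (-1/2))"
proof -
  obtain C1 M1 where 1: "C1 \<ge> 0" "M1 \<ge> 1" "\<And>w. 0 \<le> Re w \<Longrightarrow> \<bar>Im w\<bar> \<ge> M1 \<Longrightarrow>
    norm (bil_half a b c d p e f g w) \<le> C1 * (exp (4 * pi * \<bar>Im w\<bar>) * \<bar>Im w\<bar> powr (-1/2))"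
    using bil_half_growth[OF bal] by metis
  obtain C2 M2 where 2: "C2 \<ge> 0" "M2 \<ge> 1" "\<And>w. 0 \<le> Re w \<Longrightarrow> \<bar>Im w\<bar> \<ge> M2 \<Longrightarrow>
    norm (bil_half (1 - p) (1 - e) (1 - f) (1 - g) (1 - a) (1 - b) (1 - c) (1 - d) w) \<le> C2 * (exp (4 * pi * \<bar>Im w\<bar>) * \<bar>Im w\<bar> powr (-1/2))"
    using bil_half_growth[OF reflected_balance[OF bal]] by metis
  show thesis
  proof (rule that[of "C1 + C2" "max M1 M2"])
    fix w :: complex assume w: "\<bar>Im w\<bar> \<ge> max M1 M2"
    \<comment> \<open>Periodicity moves w into the strip where v and 1 - v both have nonnegative
      real part, as the two half-sums require.\<close>
    define v where "v = w - of_int \<lfloor>Re w\<rfloor>"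
    have v: "0 \<le> Re v" "0 \<le> Re (1 - v)" "Im v = Im w" "Im (1 - v) = - Im w" by (auto simp: v_def) linarith
    have "bil a b c d p e f g w = bil a b c d p e f g v"
      using bil_add_int[OF bal, of v "\<lfloor>Re w\<rfloor>"] by (simp add: v_def)
    then have "norm (bil a b c d p e f g w) \<le> norm (bil_half a b c d p e f g v) + norm (bil_half (1 - p) (1 - e) (1 - f) (1 - g) (1 - a) (1 - b) (1 - c) (1 - d) (1 - v))"
      unfolding bil_def by (metis norm_triangle_ineq)
    also have "\<dots> \<le> C1 * (exp (4 * pi * \<bar>Im w\<bar>) * \<bar>Im w\<bar> powr (-1/2)) + C2 * (exp (4 * pi * \<bar>Im w\<bar>) * \<bar>Im w\<bar> powr (-1/2))"
      using 1(3)[of v] 2(3)[of "1 - v"] v w by (intro add_mono) auto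
    finally show "norm (bil a b c d p e f g w) \<le> (C1 + C2) * (exp (4 * pi * \<bar>Im w\<bar>) * \<bar>Im w\<bar> powr (-1/2))"
      by (simp add: distrib_right)
  qed (use 1 2 in auto)
qed

lemma holomorphic_bil:
  assumes bal: "p + e + f + g - (a + b + c + d) = 2"
  shows "bil a b c d p e f g holomorphic_on UNIV"
proof -
  have 1: "bil_half a b c d p e f g holomorphic_on UNIV"
    unfolding bil_half_def by (rule saalschutz_terms.holomorphic_suminf[OF bil_half_terms[OF bal]])
  have 2: "bil_half (1 - p) (1 - e) (1 - f) (1 - g) (1 - a) (1 - b) (1 - c) (1 - d) holomorphic_on UNIV"
    unfolding bil_half_def by (rule saalschutz_terms.holomorphic_suminf[OF bil_half_terms[OF reflected_balance[OF bal]]])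
  have "(bil_half (1 - p) (1 - e) (1 - f) (1 - g) (1 - a) (1 - b) (1 - c) (1 - d) \<circ> (\<lambda>w. 1 - w)) holomorphic_on UNIV"
    by (rule holomorphic_on_compose) (auto intro!: holomorphic_intros holomorphic_on_subset[OF 2])
  with 1 have "(\<lambda>w. bil_half a b c d p e f g w + bil_half (1 - p) (1 - e) (1 - f) (1 - g) (1 - a) (1 - b) (1 - c) (1 - d) (1 - w)) holomorphic_on UNIV"
    by (intro holomorphic_on_add) (simp_all add: o_def)
  then show ?thesis by (simp add: bil_def [abs_def])
qed

section \<open>The bilateral sum as a Laurent polynomial\<close>

context
  fixes a b c d p e f g :: complex
  assumes bal: "p + e + f + g - (a + b + c + d) = 2"
begin

private abbreviation "B \<equiv> bil a b c d p e f g"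
private definition "L z = B (Ln z / (2 * of_real pi * \<i>))"

lemma bil_cong_exp:
  assumes "exp (2 * of_real pi * \<i> * v) = exp (2 * of_real pi * \<i> * w)"
  shows "B v = B w"
proof -
  obtain n :: int where n: "2 * of_real pi * \<i> * v = 2 * of_real pi * \<i> * w + (of_int (2 * n) * pi) * \<i>"
    using assms unfolding exp_eq by auto
  have "2 * of_real pi * \<i> * v = 2 * of_real pi * \<i> * (w + of_int n)" using n by (simp add: algebra_simps)
  then have "v = w + of_int n" by simp
  then show ?thesis using bil_add_int[OF bal] by simp
qed

private lemma L_exp: "L (exp (2 * of_real pi * \<i> * w)) = B w"
  unfolding L_def by (rule bil_cong_exp) simp

text \<open>Periodicity lets B descend to z = exp(2 pi i w). The cut of \<open>Ln\<close> is only
  apparent: across it Ln(-z) is used, and the half period 1/2 compensates the change of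
  sign.\<close>

private lemma holomorphic_L: "L holomorphic_on - {0}"
proof -
  have B: "(\<lambda>z. B (h z)) holomorphic_on S" if "h holomorphic_on S" for h S
    using holomorphic_on_compose[OF that holomorphic_on_subset[OF holomorphic_bil[OF bal]]] by (simp add: o_def)
  have 1: "L holomorphic_on - \<real>\<^sub>\<le>\<^sub>0"
    unfolding L_def by (intro B holomorphic_intros) auto
  have "(\<lambda>z. B (Ln (- z) / (2 * of_real pi * \<i>) + 1 / 2)) holomorphic_on - \<real>\<^sub>\<ge>\<^sub>0"
    by (intro B holomorphic_intros) (auto simp: complex_nonpos_Reals_iff complex_nonneg_Reals_iff)
  moreover have "B (Ln (- z) / (2 * of_real pi * \<i>) + 1 / 2) = L z" if "z \<in> - \<real>\<^sub>\<ge>\<^sub>0" for z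
    unfolding L_def
  proof (rule bil_cong_exp)
    have z: "z \<noteq> 0" using that by auto
    have "2 * of_real pi * \<i> * (Ln (- z) / (2 * of_real pi * \<i>) + 1 / 2) = Ln (- z) + of_real pi * \<i>"
      by (simp add: field_simps)
    moreover have "exp (Ln (- z) + of_real pi * \<i>) = z" using z by (simp add: exp_add)
    ultimately show "exp (2 * of_real pi * \<i> * (Ln (- z) / (2 * of_real pi * \<i>) + 1 / 2)) = exp (2 * of_real pi * \<i> * (Ln z / (2 * of_real pi * \<i>)))"
      using z by simp
  qed
  ultimately have 2: "L holomorphic_on - \<real>\<^sub>\<ge>\<^sub>0" by (rule holomorphic_transform)
  have "- {0::complex} = - \<real>\<^sub>\<le>\<^sub>0 \<union> - \<real>\<^sub>\<ge>\<^sub>0"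
    by (auto simp: complex_nonpos_Reals_iff complex_nonneg_Reals_iff complex_eq_iff)
  then show ?thesis using holomorphic_on_Un[OF 1 2] closed_nonpos_Reals_complex closed_nonneg_Reals_complex by (simp add: open_Compl)
qed

private lemma L_growth:
  obtains C M where "C \<ge> 0" "M \<ge> 1" "\<And>z. z \<noteq> 0 \<Longrightarrow> \<bar>ln (norm z)\<bar> \<ge> M \<Longrightarrow> norm (L z) \<le> C * exp (2 * \<bar>ln (norm z)\<bar>) * \<bar>ln (norm z)\<bar> powr (-1/2)"
proof -
  obtain C M where C: "C \<ge> 0" "M \<ge> 1" "\<And>w. \<bar>Im w\<bar> \<ge> M \<Longrightarrow> norm (B w) \<le> C * (exp (4 * pi * \<bar>Im w\<bar>) * \<bar>Im w\<bar> powr (-1/2))"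
    using bil_growth[OF bal] by metis
  define K where "K = C * (1 / (2 * pi)) powr (-1/2)"
  show thesis
  proof (rule that[of K "2 * pi * M"])
    show "K \<ge> 0" using C by (simp add: K_def)
    show "2 * pi * M \<ge> 1" using C(2) pi_ge_two mult_mono[of 1 "2 * pi" 1 M] by simp
    fix z :: complex assume z: "z \<noteq> 0" "2 * pi * M \<le> \<bar>ln (norm z)\<bar>"
    let ?w = "Ln z / (2 * of_real pi * \<i>)"
    have "?w = - \<i> * Ln z / of_real (2 * pi)" by (simp add: field_simps)
    then have "Im ?w = - ln (norm z) / (2 * pi)" using z by (simp add: Im_divide_of_real)
    then have I: "\<bar>Im ?w\<bar> = 1 / (2 * pi) * \<bar>ln (norm z)\<bar>" by (simp add: abs_divide)
    have "M \<le> \<bar>Im ?w\<bar>" unfolding I using z(2) by (simp add: field_simps)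
    from C(3)[OF this] have "norm (L z) \<le> C * (exp (2 * \<bar>ln (norm z)\<bar>) * (1 / (2 * pi) * \<bar>ln (norm z)\<bar>) powr (-1/2))"
      unfolding I L_def by simp
    then show "norm (L z) \<le> K * exp (2 * \<bar>ln (norm z)\<bar>) * \<bar>ln (norm z)\<bar> powr (-1/2)"
      by (subst (asm) powr_mult) (simp_all add: K_def mult_ac)
  qed
qed

text \<open>The growth bound makes z^2 L(z) entire and of polynomial growth of degree at most 4. The
  extra factor |ln |z||^(-1/2) removes the two extreme coefficients, at 0 and at infinity, leaving
  z, z^2 and z^3.\<close>

lemma bil_trig_polynomial:
  obtains \<alpha> \<beta> \<gamma> where "\<And>w. exp (2 * of_real pi * \<i> * w) * B w = \<alpha> + \<beta> * exp (2 * of_real pi * \<i> * w) + \<gamma> * exp (2 * of_real pi * \<i> * w) ^ 2"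
proof -
  obtain C M where C: "C \<ge> 0" "M \<ge> 1" and L: "\<And>z. z \<noteq> 0 \<Longrightarrow> \<bar>ln (norm z)\<bar> \<ge> M \<Longrightarrow> norm (L z) \<le> C * exp (2 * \<bar>ln (norm z)\<bar>) * \<bar>ln (norm z)\<bar> powr (-1/2)"
    using L_growth by metis
  \<comment> \<open>The value 0 at the origin is the limit there, since \<open>small\<close> tends
    to 0; the singularity is therefore removable, and the constant coefficient vanishes.\<close>
  define H where "H z = (if z = 0 then 0 else z ^ 2 * L z)" for z
  have small: "norm (H z) \<le> C * (- ln (norm z)) powr (-1/2)" if "z \<noteq> 0" "norm z \<le> exp (- M)" for z
  proof -
    have "ln (norm z) \<le> - M" using that by (metis ln_exp ln_le_cancel_iff exp_gt_zero zero_less_norm_iff)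
    then have l: "\<bar>ln (norm z)\<bar> = - ln (norm z)" "\<bar>ln (norm z)\<bar> \<ge> M" using C by auto
    have "exp (- 2 * ln (norm z)) = inverse (norm z ^ 2)"
      using that by (simp add: exp_minus exp_double)
    then have "norm (L z) \<le> C * inverse (norm z ^ 2) * (- ln (norm z)) powr (-1/2)"
      using L[OF that(1) l(2)] unfolding l(1) by simp
    then have "norm z ^ 2 * norm (L z) \<le> norm z ^ 2 * (C * inverse (norm z ^ 2) * (- ln (norm z)) powr (-1/2))"
      by (intro mult_left_mono) auto
    also have "\<dots> = C * (- ln (norm z)) powr (-1/2)" using that by (simp add: field_simps)
    finally show ?thesis using that by (simp add: H_def norm_mult norm_power)
  qed
  have large: "norm (H z) \<le> C * ln (norm z) powr (-1/2) * norm z ^ 4" if "norm z \<ge> exp M" for z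
  proof -
    have z: "norm z > 0" using that by (meson exp_gt_zero less_le_trans)
    have "ln (norm z) \<ge> M" using that z by (metis ln_exp ln_le_cancel_iff exp_gt_zero)
    then have l: "\<bar>ln (norm z)\<bar> = ln (norm z)" "\<bar>ln (norm z)\<bar> \<ge> M" using C by auto
    have "exp (2 * ln (norm z)) = norm z ^ 2" using z by (simp add: exp_double)
    then have "norm (L z) \<le> C * norm z ^ 2 * ln (norm z) powr (-1/2)"
      using L[OF _ l(2)] z unfolding l(1) by auto
    then have "norm z ^ 2 * norm (L z) \<le> norm z ^ 2 * (C * norm z ^ 2 * ln (norm z) powr (-1/2))"
      by (intro mult_left_mono) auto
    also have "\<dots> = C * ln (norm z) powr (-1/2) * norm z ^ 4" by (simp add: power2_eq_square power4_eq_xxxx mult_ac)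
    finally show ?thesis using z by (simp add: H_def norm_mult norm_power)
  qed
  have "(\<lambda>z. z ^ 2 * L z) holomorphic_on - {0}" by (intro holomorphic_intros holomorphic_L)
  then have H0: "H holomorphic_on (UNIV - {0})"
    by (rule holomorphic_transform[OF holomorphic_on_subset]) (auto simp: H_def)
  have lim0: "(H \<longlongrightarrow> H 0) (at 0)"
  proof -
    have "filterlim (\<lambda>z::complex. norm z) (at_right 0) (at 0)"
      by (auto simp: filterlim_at eventually_at intro!: tendsto_eq_intros exI[of _ 1])
    moreover have "((\<lambda>r. C * (- ln r) powr (-1/2)) \<longlongrightarrow> 0) (at_right 0)" by real_asymp
    ultimately have z: "((\<lambda>z::complex. C * (- ln (norm z)) powr (-1/2)) \<longlongrightarrow> 0) (at 0)"
      by (rule filterlim_compose[rotated])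
    have ev: "eventually (\<lambda>z. norm (H z) \<le> C * (- ln (norm z)) powr (-1/2)) (at 0)"
      unfolding eventually_at using small by (intro exI[of _ "exp (- M)"]) (auto simp: dist_norm)
    have "H 0 = 0" by (simp add: H_def)
    with Lim_null_comparison[OF ev z] show ?thesis by simp
  qed
  have "continuous_on UNIV H"
    unfolding continuous_on_eq_continuous_at[OF open_UNIV]
  proof
    fix x
    show "isCont H x"
    proof (cases "x = 0")
      case True
      then show ?thesis using lim0 by (simp add: isCont_def)
    next
      case False
      have "continuous_on (UNIV - {0}) H" by (rule holomorphic_on_imp_continuous_on[OF H0])
      then show ?thesis using False by (simp add: continuous_on_eq_continuous_at open_delete)
    qed
  qed
  then have hol: "H holomorphic_on UNIV"
    by (rule no_isolated_singularity[OF _ H0]) auto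
  define h where "h k = (deriv ^^ k) H 0 / fact k" for k
  have H: "H z = (\<Sum>k\<le>4. h k * z ^ k)" for z
    unfolding h_def
  proof (rule Liouville_polynomial[OF hol])
    fix z :: complex assume z: "exp M \<le> norm z"
    have "M \<le> ln (norm z)" using z by (metis ln_exp ln_le_cancel_iff exp_gt_zero less_le_trans)
    then have "ln (norm z) powr (-1/2) \<le> 1" using C powr_mono[of "-1/2" 0 "ln (norm z)"] by simp
    then have "C * ln (norm z) powr (-1/2) * norm z ^ 4 \<le> C * 1 * norm z ^ 4"
      using C by (intro mult_right_mono mult_left_mono) auto
    with large[OF z] show "norm (H z) \<le> C * norm z ^ 4" by simp
  qed
  have sum4: "(\<Sum>k\<le>4. h k * z ^ k) = h 0 + h 1 * z + h 2 * z ^ 2 + h 3 * z ^ 3 + h 4 * z ^ 4" for z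
    by (simp add: numeral_eq_Suc)
  have h0: "h 0 = 0" using H[of 0] unfolding sum4 by (simp add: H_def)
  have h4: "h 4 = 0"
  proof -
    have inv: "((\<lambda>x. inverse (complex_of_real x)) \<longlongrightarrow> of_real 0) at_top"
      unfolding of_real_inverse [symmetric] by (intro tendsto_of_real) real_asymp
    have "((\<lambda>x. h 1 * inverse (complex_of_real x) ^ 3 + h 2 * inverse (complex_of_real x) ^ 2 + h 3 * inverse (complex_of_real x) + h 4) \<longlongrightarrow>
      h 1 * of_real 0 ^ 3 + h 2 * of_real 0 ^ 2 + h 3 * of_real 0 + h 4) at_top"
      by (intro tendsto_add tendsto_mult tendsto_power tendsto_const inv)
    moreover have "eventually (\<lambda>x. h 1 * inverse (complex_of_real x) ^ 3 + h 2 * inverse (complex_of_real x) ^ 2 + h 3 * inverse (complex_of_real x) + h 4 = 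
       H (of_real x) / of_real x ^ 4) at_top"
      using eventually_gt_at_top[of 0]
      by eventually_elim (simp add: H sum4 h0 field_simps power2_eq_square power3_eq_cube power4_eq_xxxx)
    ultimately have l1: "((\<lambda>x. H (of_real x) / of_real x ^ 4) \<longlongrightarrow> h 4) at_top"
      using Lim_transform_eventually by (fastforce simp: tendsto_cong)
    have z: "((\<lambda>x. C * ln x powr (-1/2)) \<longlongrightarrow> 0) at_top" by real_asymp
    have "eventually (\<lambda>x. norm (H (of_real x) / of_real x ^ 4) \<le> C * ln x powr (-1/2)) at_top"
      using eventually_ge_at_top[of "exp M"]
    proof eventually_elim
      case (elim x)
      have x: "x > 0" using elim by (meson exp_gt_zero less_le_trans)
      then have "norm (H (of_real x)) \<le> C * ln x powr (-1/2) * x ^ 4" using large[of "of_real x"] elim by simp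
      then show ?case using x by (simp add: norm_divide norm_power divide_le_eq)
    qed
    \<comment> \<open>Along the positive reals H(x)/x^4 tends to the top coefficient and, by the
      logarithmic gain, also to 0.\<close>
    from Lim_null_comparison[OF this z] have l2: "((\<lambda>x. H (of_real x) / of_real x ^ 4) \<longlongrightarrow> 0) at_top" .
    show ?thesis by (rule tendsto_unique[OF _ l1 l2]) simp
  qed
  show thesis
  proof (rule that[of "h 1" "h 2" "h 3"])
    fix w
    define z where "z = exp (2 * of_real pi * \<i> * w)"
    have z: "z \<noteq> 0" by (simp add: z_def)
    have "z ^ 2 * B w = H z" using z L_exp[of w] by (simp add: H_def z_def)
    also have "\<dots> = z * (h 1 + h 2 * z + h 3 * z ^ 2)"
      unfolding H sum4 h0 h4 by (simp add: algebra_simps power2_eq_square power3_eq_cube)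
    finally have "z * (z * B w) = z * (h 1 + h 2 * z + h 3 * z ^ 2)" by (simp add: power2_eq_square mult_ac)
    then show "exp (2 * of_real pi * \<i> * w) * B w = h 1 + h 2 * exp (2 * of_real pi * \<i> * w) + h 3 * exp (2 * of_real pi * \<i> * w) ^ 2"
      using z by (simp add: z_def)
  qed
qed

end

lemma sin_pi_diff_exp:
  "sin (of_real pi * (v - w)) * (2 * \<i> * exp (of_real pi * \<i> * v) * exp (of_real pi * \<i> * w)) =
    exp (2 * of_real pi * \<i> * v) - exp (2 * of_real pi * \<i> * w)"
proof -
  have "sin (of_real pi * (v - w)) * (2 * \<i>) = exp (of_real pi * \<i> * v - of_real pi * \<i> * w) - exp (of_real pi * \<i> * w - of_real pi * \<i> * v)"
  proof -
    have "sin X * (2 * \<i>) = exp (\<i> * X) - exp (- (\<i> * X))" for X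
      by (subst nonzero_eq_divide_eq [symmetric]) (simp, rule sin_exp_eq)
    moreover have "\<i> * (of_real pi * (v - w)) = of_real pi * \<i> * v - of_real pi * \<i> * w" 
      "- (\<i> * (of_real pi * (v - w))) = of_real pi * \<i> * w - of_real pi * \<i> * v" by (simp_all add: algebra_simps)
    ultimately show ?thesis by metis
  qed
  then have "sin (of_real pi * (v - w)) * (2 * \<i>) * (exp (of_real pi * \<i> * v) * exp (of_real pi * \<i> * w)) = 
     exp (of_real pi * \<i> * v - of_real pi * \<i> * w) * (exp (of_real pi * \<i> * v) * exp (of_real pi * \<i> * w)) - 
     exp (of_real pi * \<i> * w - of_real pi * \<i> * v) * (exp (of_real pi * \<i> * v) * exp (of_real pi * \<i> * w))"
    by (simp only: left_diff_distrib)
  then show ?thesis by (simp only: exp_add [symmetric] mult.assoc) (simp add: algebra_simps)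
qed

text \<open>At four points the values of z * B are those of one quadratic polynomial, so the 4x4
  determinant with these values beside the columns 1, z, z^2 vanishes. Its cofactors are Vandermonde
  products, and each difference z_i - z_j is a sine up to exponential factors, which are the same in
  all four terms.\<close>

lemma bil_four_points:
  assumes bal: "p + e + f + g - (a + b + c + d) = 2"
  shows "bil a b c d p e f g w1 * (sin (of_real pi * (w2 - w3)) * sin (of_real pi * (w2 - w4)) * sin (of_real pi * (w3 - w4)))
    - bil a b c d p e f g w2 * (sin (of_real pi * (w1 - w3)) * sin (of_real pi * (w1 - w4)) * sin (of_real pi * (w3 - w4)))
    + bil a b c d p e f g w3 * (sin (of_real pi * (w1 - w2)) * sin (of_real pi * (w1 - w4)) * sin (of_real pi * (w2 - w4)))
    - bil a b c d p e f g w4 * (sin (of_real pi * (w1 - w2)) * sin (of_real pi * (w1 - w3)) * sin (of_real pi * (w2 - w3))) = 0"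
proof -
  obtain \<alpha> \<beta> \<gamma> where t: "\<And>w. exp (2 * of_real pi * \<i> * w) * bil a b c d p e f g w = \<alpha> + \<beta> * exp (2 * of_real pi * \<i> * w) + \<gamma> * exp (2 * of_real pi * \<i> * w) ^ 2"
    using bil_trig_polynomial[OF bal] by metis
  define E where "E w = exp (of_real pi * \<i> * w)" for w
  define z where "z w = exp (2 * of_real pi * \<i> * w)" for w
  have zE: "z w = E w * E w" for w by (simp add: z_def E_def exp_add [symmetric] algebra_simps)
  have nz: "E w \<noteq> 0" "z w \<noteq> 0" for w by (auto simp: E_def z_def)
  have s: "sin (of_real pi * (v - w)) = (z v - z w) / (2 * \<i> * E v * E w)" for v w
    using sin_pi_diff_exp[of v w] nz by (simp add: z_def E_def eq_divide_eq)
  have B: "bil a b c d p e f g w = (\<alpha> + \<beta> * z w + \<gamma> * z w ^ 2) / z w" for w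
    using t[of w] nz(2)[of w] by (simp add: z_def eq_divide_eq mult.commute)
  have key: "\<And>z1 z2 z3 z4 :: complex. (\<alpha> + \<beta> * z1 + \<gamma> * z1 ^ 2) * ((z2 - z3) * (z2 - z4) * (z3 - z4)) 
     - (\<alpha> + \<beta> * z2 + \<gamma> * z2 ^ 2) * ((z1 - z3) * (z1 - z4) * (z3 - z4)) 
     + (\<alpha> + \<beta> * z3 + \<gamma> * z3 ^ 2) * ((z1 - z2) * (z1 - z4) * (z2 - z4)) 
     - (\<alpha> + \<beta> * z4 + \<gamma> * z4 ^ 2) * ((z1 - z2) * (z1 - z3) * (z2 - z3)) = 0"
    by algebra
  define K where "K = (2 * \<i>) ^ 3 * (z w1 * z w2 * z w3 * z w4)"
  have K: "K \<noteq> 0" using nz by (simp add: K_def)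
  have r: "x / z u * ((y1 / (2 * \<i> * E v1 * E v2)) * (y2 / (2 * \<i> * E v1 * E v3)) * (y3 / (2 * \<i> * E v2 * E v3))) = x * (y1 * y2 * y3) / ((2 * \<i>) ^ 3 * (z u * z v1 * z v2 * z v3))" for x y1 y2 y3 u v1 v2 v3
    unfolding zE by (simp add: power3_eq_cube mult_ac)
  show ?thesis
    unfolding s B r using key[of "z w1" "z w2" "z w3" "z w4"] K unfolding K_def
    by (simp add: mult_ac add_divide_distrib [symmetric] diff_divide_distrib [symmetric] del: mult_eq_0_iff)
qed

section \<open>Combining the relations\<close>

lemma rGamma_minus_of_nat: "rGamma (1 - x - of_nat n) = (- 1) ^ n * pochhammer x n * rGamma (1 - x)" for x :: complex
proof (induction n)
  case (Suc n)
  have "rGamma (1 - x - of_nat (Suc n)) = - (x + of_nat n) * rGamma (1 - x - of_nat n)"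
    using rGamma_plus1[of "1 - x - of_nat (Suc n)"] by (simp add: algebra_simps)
  then show ?case unfolding Suc by (simp add: pochhammer_Suc algebra_simps)
qed simp

lemma rGamma_minus_nat: "rGamma (- of_nat n :: complex) = 0"
  by (simp add: rGamma_eq_zero_iff)

text \<open>For p + w = 1 the sum is one-sided: all terms to the left contain 1/Gamma(-n) = 0, and
  on the right 1/Gamma(p+w+n) is 1/n!.\<close>

lemma bil_at_one:
  assumes bal: "p + e + f + g - (a + b + c + d) = 2" and w: "p + w = 1"
  shows "bil a b c d p e f g w = rGamma (1 - a - w) * rGamma (1 - b - w) * rGamma (1 - c - w) * rGamma (1 - d - w) *
    F43_reg (a + w) (b + w) (c + w) (d + w) (e + w) (f + w) (g + w)"
proof -
  have p: "p = 1 - w" using w by (simp add: algebra_simps)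
  have "bil_term (1 - p) (1 - e) (1 - f) (1 - g) (1 - a) (1 - b) (1 - c) (1 - d) (1 - w + of_nat n) = 0" for n
  proof -
    have "1 - (1 - p) - (1 - w + of_nat n) = - of_nat n" by (simp add: p)
    then show ?thesis unfolding bil_term_def by (simp only: rGamma_minus_nat mult_zero_left)
  qed
  then have 2: "bil_half (1 - p) (1 - e) (1 - f) (1 - g) (1 - a) (1 - b) (1 - c) (1 - d) (1 - w) = 0"
    by (simp add: bil_half_def)
  define t where "t n = pochhammer (a + w) n * pochhammer (b + w) n * pochhammer (c + w) n * pochhammer (d + w) n / fact n *
     (rGamma (e + w + of_nat n) * rGamma (f + w + of_nat n) * rGamma (g + w + of_nat n))" for n
  have "saalschutz_terms (\<lambda>n u. t n) (\<lambda>_. a + w) (\<lambda>_. b + w) (\<lambda>_. c + w) (\<lambda>_. d + w) (\<lambda>_. e + w) (\<lambda>_. f + w) (\<lambda>_. g + w) (\<lambda>_. 1)"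
    unfolding t_def by (rule F43_terms) (use bal in \<open>auto simp: p algebra_simps\<close>)
  then have st: "summable t" by (rule saalschutz_terms.summable_terms)
  have "bil_term a b c d p e f g (w + of_nat n) = rGamma (1 - a - w) * rGamma (1 - b - w) * rGamma (1 - c - w) * rGamma (1 - d - w) * t n" for n
  proof -
    have "rGamma (1 - x - (w + of_nat n)) = (- 1) ^ n * pochhammer (x + w) n * rGamma (1 - x - w)" for x :: complex
      using rGamma_minus_of_nat[of "x + w" n] by (simp add: algebra_simps)
    moreover have "rGamma (p + (w + of_nat n)) = inverse (fact n)"
      by (simp add: p rGamma_inverse_Gamma Gamma_fact [symmetric])
    moreover have "(- 1) ^ n * (- 1) ^ n = (1::complex)" by (simp add: power_mult_distrib [symmetric])
    ultimately show ?thesis by (simp add: bil_term_def t_def add.assoc divide_inverse mult_ac)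
  qed
  then have "bil_half a b c d p e f g w = rGamma (1 - a - w) * rGamma (1 - b - w) * rGamma (1 - c - w) * rGamma (1 - d - w) * suminf t"
    unfolding bil_half_def by (simp only: suminf_mult[OF st])
  then show ?thesis by (simp add: bil_def 2 F43_reg_def t_def [abs_def])
qed

lemma bil_perm: "bil a b c d p e f g = bil a b c d f e p g" "bil a b c d p e f g = bil a b c d g e f p"
  by (simp_all add: fun_eq_iff bil_def bil_half_def bil_term_def mult_ac)

text \<open>The substitution t to -t. The halves do not correspond exactly, since the term at t = w
  changes sides; splitting off one term of each accounts for it.\<close>

lemma bil_reflect:
  assumes bal: "p + e + f + g - (a + b + c + d) = 2"
  shows "bil a b c d p e f g w = bil (1 - p) (1 - e) (1 - f) (1 - g) (1 - a) (1 - b) (1 - c) (1 - d) (- w)"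
  using bil_half_Suc[OF bal, of w] bil_half_Suc[OF reflected_balance[OF bal], of "- w"] bil_term_reflect[of p e f g a b c d w]
  by (simp add: bil_def add_ac)

text \<open>In terms of squared exponentials this is a polynomial identity in five variables. It is
  what makes the coefficient of the series based at \<open>1-f\<close> equal to the bracket of
  \<open>B_4\<close>.\<close>

lemma trig_identity:
  fixes b c d f g :: complex
  shows "sin (f + g - b - c - d) * sin f * sin g * sin (g - f) + sin b * sin c * sin d * sin (g - f) =
    sin f * sin (g - b) * sin (g - c) * sin (g - d) - sin g * sin (f - b) * sin (f - c) * sin (f - d)"
proof -
  define E where "E x = exp (\<i> * x)" for x :: complex
  have nz: "E x \<noteq> 0" for x by (simp add: E_def)
  have Em: "E (x - y) * E y = E x" "E (x + y) = E x * E y" for x y by (simp_all add: E_def exp_add [symmetric] algebra_simps)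
  have E1: "sin x * (2 * \<i> * E x) = E x ^ 2 - 1" for x
  proof -
    have "sin x * (2 * \<i>) = exp (\<i> * x) - exp (- (\<i> * x))"
      by (subst nonzero_eq_divide_eq [symmetric]) (simp, rule sin_exp_eq)
    then have "sin x * (2 * \<i>) * E x = E x ^ 2 - exp (- (\<i> * x)) * exp (\<i> * x)"
      by (simp add: E_def power2_eq_square left_diff_distrib)
    also have "exp (- (\<i> * x)) * exp (\<i> * x) = 1" by (simp add: exp_minus)
    finally show ?thesis by (simp only: mult.assoc)
  qed
  have E2: "sin (x - y) * (2 * \<i> * (E x * E y)) = E x ^ 2 - E y ^ 2" for x y
  proof -
    have "sin (x - y) * (2 * \<i> * (E x * E y)) = (sin (x - y) * (2 * \<i> * E (x - y))) * E y ^ 2"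
      unfolding Em(1)[of x y, symmetric] by (simp add: power2_eq_square)
    also have "\<dots> = (E (x - y) * E y) ^ 2 - E y ^ 2" unfolding E1 by (simp add: power_mult_distrib left_diff_distrib)
    finally show ?thesis by (simp only: Em(1))
  qed
  have E3: "sin (f + g - b - c - d) * (2 * \<i> * (E f * E g * (E b * E c * E d))) = (E f * E g) ^ 2 - (E b * E c * E d) ^ 2"
    using E2[of "f + g" "b + c + d"] unfolding Em by (simp add: diff_diff_eq)
  \<comment> \<open>The common denominator of the four products: each has four sines, and products
    using fewer than three factors \<open>E f\<close> or \<open>E g\<close> are padded with
    squares.\<close>
  define K where "K = (2 * \<i>) ^ 4 * (E f ^ 3 * E g ^ 3 * (E b * E c * E d))"
  have K: "K \<noteq> 0" using nz by (simp add: K_def)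
  have "K * (sin (f + g - b - c - d) * sin f * sin g * sin (g - f)) = 
     (sin (f + g - b - c - d) * (2 * \<i> * (E f * E g * (E b * E c * E d)))) * (sin f * (2 * \<i> * E f)) * (sin g * (2 * \<i> * E g)) * (sin (g - f) * (2 * \<i> * (E g * E f)))"
    unfolding K_def by (simp only: power4_eq_xxxx power3_eq_cube mult_ac)
  note 1 = this[unfolded E1 E2 E3]
  have "K * (sin b * sin c * sin d * sin (g - f)) = 
     (sin b * (2 * \<i> * E b)) * (sin c * (2 * \<i> * E c)) * (sin d * (2 * \<i> * E d)) * (sin (g - f) * (2 * \<i> * (E g * E f))) * (E f ^ 2 * E g ^ 2)"
    unfolding K_def by (simp only: power4_eq_xxxx power3_eq_cube power2_eq_square mult_ac)
  note 2 = this[unfolded E1 E2]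
  have 3: "K * (sin y * sin (x - b) * sin (x - c) * sin (x - d)) = 
     (E y ^ 2 - 1) * (E x ^ 2 - E b ^ 2) * (E x ^ 2 - E c ^ 2) * (E x ^ 2 - E d ^ 2) * E y ^ 2" if "K = (2 * \<i>) ^ 4 * (E y ^ 3 * E x ^ 3 * (E b * E c * E d))" for x y
    unfolding that E1 [symmetric] E2 [symmetric] by (simp only: power4_eq_xxxx power3_eq_cube power2_eq_square mult_ac)
  have K': "K = (2 * \<i>) ^ 4 * (E g ^ 3 * E f ^ 3 * (E b * E c * E d))" unfolding K_def by (simp only: mult_ac)
  have poly: "(F * G - X * Y * Z) * (F - 1) * (G - 1) * (G - F) + (X - 1) * (Y - 1) * (Z - 1) * (G - F) * (F * G) = 
     (F - 1) * (G - X) * (G - Y) * (G - Z) * F - (G - 1) * (F - X) * (F - Y) * (F - Z) * G" for F G X Y Z :: complex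
    by algebra
  have "K * (sin (f + g - b - c - d) * sin f * sin g * sin (g - f) + sin b * sin c * sin d * sin (g - f)) =
    K * (sin f * sin (g - b) * sin (g - c) * sin (g - d) - sin g * sin (f - b) * sin (f - c) * sin (f - d))"
    unfolding distrib_left[of K] right_diff_distrib[of K] 1 2 3[OF K_def] 3[OF K'] power_mult_distrib by (rule poly)
  then show ?thesis using K by simp
qed

text \<open>Each two-term relation keeps the first pair of upper parameters, so the pairs are
  swapped between applications: c, d move first, then a, b, then a, b once more. The sines of the
  two intermediate functions are cancelled at the end, hence the two conditions.\<close>

lemma L_six_bar:
  fixes a b c d e f g :: complex
  assumes V: "e + f + g = 1 + a + b + c + d" and nz: "1 - a - b + f \<notin> \<int>" "e + f - a - b \<notin> \<int>"
  shows "sin (of_real pi * (1 + f - g)) * L_reg (1 - a) (1 - b) (1 - c) (1 - d) (2 - e) (2 - f) (2 - g) =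
    sin (of_real pi * (2 - e)) * L_reg (1 + a - g) (1 + b - g) (1 + c - g) (1 + d - g) (1 + f - g) (2 - g) (1 + e - g)"
proof -
  have e: "e = 1 + a + b + c + d - f - g" using V by (simp add: algebra_simps)
  have perm: "L_reg a b c d e f g = L_reg c d a b e g f" "L_reg a b c d e f g = L_reg a b c d e g f" "L_reg a b c d e f g = L_reg c d b a e f g" for a b c d e f g
    unfolding L_reg_def F43_reg_def by (simp_all add: mult_ac)
  have 1: "sin (of_real pi * (1 - a - b + f)) * L_reg (1 - a) (1 - b) (1 - c) (1 - d) (2 - e) (2 - f) (2 - g) = 
    sin (of_real pi * (2 - e)) * L_reg (1 - a) (1 - b) (1 + c - g) (1 + d - g) (1 - a - b + f) (1 - a - b + e) (2 - g)"
    using two_term_relation[of "2 - f" "2 - e" "2 - g" "1 - a" "1 - b" "1 - c" "1 - d"] unfolding e by (simp add: algebra_simps)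
  have 2: "sin (of_real pi * (e + f - a - b)) * L_reg (1 + c - g) (1 + d - g) (1 - a) (1 - b) (1 - a - b + f) (2 - g) (1 - a - b + e) = 
    sin (of_real pi * (1 - a - b + f)) * L_reg (1 + c - g) (1 + d - g) (e - b) (e - a) (e + f - a - b) (1 + e - g) (1 - a - b + e)"
    using two_term_relation[of "2 - g" "1 - a - b + f" "1 - a - b + e" "1 + c - g" "1 + d - g" "1 - a" "1 - b"] unfolding e by (simp add: algebra_simps)
  have 3: "sin (of_real pi * (1 + f - g)) * L_reg (1 + c - g) (1 + d - g) (e - b) (e - a) (e + f - a - b) (1 - a - b + e) (1 + e - g) = 
    sin (of_real pi * (e + f - a - b)) * L_reg (1 + c - g) (1 + d - g) (1 + b - g) (1 + a - g) (1 + f - g) (2 - g) (1 + e - g)"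
    using two_term_relation[of "1 - a - b + e" "e + f - a - b" "1 + e - g" "1 + c - g" "1 + d - g" "e - b" "e - a"] unfolding e by (simp add: algebra_simps)
  define l1 l2 l3 l4 where "l1 = L_reg (1 - a) (1 - b) (1 - c) (1 - d) (2 - e) (2 - f) (2 - g)"
    and "l2 = L_reg (1 - a) (1 - b) (1 + c - g) (1 + d - g) (1 - a - b + f) (1 - a - b + e) (2 - g)"
    and "l3 = L_reg (1 + c - g) (1 + d - g) (e - b) (e - a) (e + f - a - b) (1 + e - g) (1 - a - b + e)"
    and "l4 = L_reg (1 + a - g) (1 + b - g) (1 + c - g) (1 + d - g) (1 + f - g) (2 - g) (1 + e - g)"
  have n: "sin (of_real pi * (1 - a - b + f)) \<noteq> 0" "sin (of_real pi * (e + f - a - b)) \<noteq> 0"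
    using nz by (simp_all only: sin_pi_eq_0_iff not_False_eq_True)
  note 1 = 1[folded l1_def l2_def]
  note 2 = 2[unfolded perm(1)[of "1 + c - g" "1 + d - g" "1 - a" "1 - b" "1 - a - b + f" "2 - g" "1 - a - b + e"], folded l2_def l3_def]
  have 3: "sin (of_real pi * (1 + f - g)) * l3 = sin (of_real pi * (e + f - a - b)) * l4"
    using 3 unfolding l3_def l4_def perm(2)[of "1 + c - g" "1 + d - g" "e - b" "e - a" "e + f - a - b" "1 + e - g" "1 - a - b + e"]
      perm(3)[of "1 + a - g" "1 + b - g" "1 + c - g" "1 + d - g" "1 + f - g" "2 - g" "1 + e - g"] .
  have "(sin (of_real pi * (1 - a - b + f)) * sin (of_real pi * (e + f - a - b))) * (sin (of_real pi * (1 + f - g)) * l1) = 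
    sin (of_real pi * (e + f - a - b)) * sin (of_real pi * (1 + f - g)) * (sin (of_real pi * (1 - a - b + f)) * l1)" by (simp only: mult_ac)
  also have "\<dots> = sin (of_real pi * (2 - e)) * sin (of_real pi * (1 + f - g)) * (sin (of_real pi * (e + f - a - b)) * l2)"
    unfolding 1 by (simp only: mult_ac)
  also have "\<dots> = sin (of_real pi * (2 - e)) * sin (of_real pi * (1 - a - b + f)) * (sin (of_real pi * (1 + f - g)) * l3)"
    unfolding 2 by (simp only: mult_ac)
  also have "\<dots> = (sin (of_real pi * (1 - a - b + f)) * sin (of_real pi * (e + f - a - b))) * (sin (of_real pi * (2 - e)) * l4)"
    unfolding 3 by (simp only: mult_ac)
  finally show ?thesis using n by (simp add: l1_def l4_def)
qed

section \<open>The relation among four series\<close>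

definition sp :: "complex \<Rightarrow> complex" where "sp x = sin (of_real pi * x)"

lemma sp_simps: "sp (1 - x) = sp x" "sp (1 + x) = - sp x" "sp (x - 1) = - sp x" "sp (- x) = - sp x" "sp (2 - x) = - sp x"
proof -
  show "sp (1 - x) = sp x" by (simp add: sp_def right_diff_distrib sin_diff)
  show "sp (1 + x) = - sp x" by (simp add: sp_def distrib_left sin_add)
  show "sp (x - 1) = - sp x" by (simp add: sp_def right_diff_distrib sin_diff)
  show "sp (- x) = - sp x" by (simp add: sp_def)
  have "of_real pi * (2 - x) = 2 * of_real pi - of_real pi * x" by (simp add: algebra_simps)
  then show "sp (2 - x) = - sp x" unfolding sp_def by (simp only: sin_diff) simp
qed

lemma rGamma_reflect: "rGamma x * rGamma (1 - x) = sp x / of_real pi"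
  unfolding sp_def by (rule rGamma_reflection_complex)

text \<open>At 0, 1-f and 1-g the lower parameter 1, f or g adds up with the point to 1, so
  \<open>bil_at_one\<close> applies after a permutation. At -a it applies after reflection, with
  lower parameter 1-a and point a.\<close>

lemma four_series_relation:
  assumes V: "e + f + g = 1 + a + b + c + d"
  shows "A4 (1 - a) (1 - b) (1 - c) (1 - d) * F43_reg a b c d e f g * (sp (g - f) * sp (f - a) * sp (g - a))
    + A4 (f - a) (f - b) (f - c) (f - d) * F43_reg (1 + a - f) (1 + b - f) (1 + c - f) (1 + d - f) (2 - f) (1 + e - f) (1 + g - f) * (sp g * sp a * sp (g - a))
    - A4 (g - a) (g - b) (g - c) (g - d) * F43_reg (1 + a - g) (1 + b - g) (1 + c - g) (1 + d - g) (1 + f - g) (2 - g) (1 + e - g) * (sp f * sp a * sp (f - a))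
    - A4 (1 - a) (e - a) (f - a) (g - a) * F43_reg a (1 + a - e) (1 + a - f) (1 + a - g) (1 + a - b) (1 + a - c) (1 + a - d) * (sp f * sp g * sp (g - f)) = 0"
proof -
  have bal: "1 + e + f + g - (a + b + c + d) = 2" using V by (simp add: algebra_simps)
  have balf: "f + e + 1 + g - (a + b + c + d) = 2" and balg: "g + e + f + 1 - (a + b + c + d) = 2" using V by (simp_all add: algebra_simps)
  let ?B = "bil a b c d 1 e f g"
  have D0: "?B 0 = A4 (1 - a) (1 - b) (1 - c) (1 - d) * F43_reg a b c d e f g"
    using bil_at_one[OF bal, of 0] by (simp add: A4_def)
  have Df: "?B (1 - f) = A4 (f - a) (f - b) (f - c) (f - d) * F43_reg (1 + a - f) (1 + b - f) (1 + c - f) (1 + d - f) (2 - f) (1 + e - f) (1 + g - f)"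
    using bil_at_one[OF balf, of "1 - f"] unfolding bil_perm(1)[of a b c d 1] A4_def
    by (simp add: algebra_simps F43_reg_perm_lower(1)[of _ _ _ _ "1 + e - f"])
  have Dg: "?B (1 - g) = A4 (g - a) (g - b) (g - c) (g - d) * F43_reg (1 + a - g) (1 + b - g) (1 + c - g) (1 + d - g) (1 + f - g) (2 - g) (1 + e - g)"
    using bil_at_one[OF balg, of "1 - g"] unfolding bil_perm(2)[of a b c d 1] A4_def
    by (simp add: algebra_simps F43_reg_perm_lower(2)[of _ _ _ _ "1 + e - g"])
  have "?B (- a) = bil (1 - 1) (1 - e) (1 - f) (1 - g) (1 - a) (1 - b) (1 - c) (1 - d) a"
    using bil_reflect[OF bal, of "- a"] by simp
  also have "\<dots> = A4 (1 - a) (e - a) (f - a) (g - a) * F43_reg a (1 + a - e) (1 + a - f) (1 + a - g) (1 + a - b) (1 + a - c) (1 + a - d)"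
    using bil_at_one[OF reflected_balance[OF bal], of a] by (simp add: A4_def algebra_simps)
  finally have Da: "?B (- a) = A4 (1 - a) (e - a) (f - a) (g - a) * F43_reg a (1 + a - e) (1 + a - f) (1 + a - g) (1 + a - b) (1 + a - c) (1 + a - d)" .
  have s: "1 - f - (1 - g) = g - f" "1 - f - - a = 1 - (f - a)" "1 - g - - a = 1 - (g - a)" "0 - (1 - g) = g - 1" "0 - - a = a" "0 - (1 - f) = f - 1"
    by simp_all
  have "?B 0 * (sp (g - f) * sp (1 - (f - a)) * sp (1 - (g - a))) - ?B (1 - f) * (sp (g - 1) * sp a * sp (1 - (g - a)))
    + ?B (1 - g) * (sp (f - 1) * sp a * sp (1 - (f - a))) - ?B (- a) * (sp (f - 1) * sp (g - 1) * sp (g - f)) = 0"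
    using bil_four_points[OF bal, of 0 "1 - f" "1 - g" "- a"] unfolding sp_def s .
  then show ?thesis unfolding D0 Df Dg Da sp_simps by simp
qed

text \<open>Here \<open>A\<close> and the P's are the Gamma products accompanying the series in K
  and L, the Q's are their complements under reflection, and k is pi^(-4). The K and L terms contain
  \<open>Fa\<close> and \<open>Fg\<close> with the same coefficients as A * Pf times the four-series
  relation, up to sign, so both drop out and only \<open>F0\<close> and \<open>Ff\<close>
  remain.\<close>

lemma core_algebra:
  fixes F0 Ff Fg Fa A Pf Pg Pa Q0 Qf Qg Qa k :: complex
  assumes h4: "Q0 * F0 * (sgf * sfa * sga) + Qf * Ff * (sg * sa * sga) - Qg * Fg * (sf * sa * sfa) - Qa * Fa * (sf * sg * sgf) = 0"
    and r: "A * Q0 = sa * sb * sc * sd * k" "Pf * Qf = sfa * sfb * sfc * sfd * k" "Pg * Qg = sga * sgb * sgc * sgd * k" "Pa * Qa = sa * sea * sfa * sga * k"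
    and trig: "sea * sf * sg * sgf + sb * sc * sd * sgf = sf * sgb * sgc * sgd - sg * sfb * sfc * sfd"
  shows "sg * Pf * Qa * (F0 * Pa + Fa * A) * (sf * sgf) + sfa * A * Qg * (Fg * Pf - Ff * Pg) * (sa * sf)
    - sfa * sga * (sb * sc * sd + sea * sf * sg) * k * (F0 * Pf - Ff * A) * (sa * sgf) = 0"
proof -
  have "sg * Pf * Qa * (F0 * Pa + Fa * A) * (sf * sgf) + sfa * A * Qg * (Fg * Pf - Ff * Pg) * (sa * sf)
    = F0 * Pf * (sg * sf * sgf * (Pa * Qa) + sgf * sfa * sga * (A * Q0)) + Ff * A * (sg * sa * sga * (Pf * Qf) - sfa * sa * sf * (Pg * Qg))
     - A * Pf * (Q0 * F0 * (sgf * sfa * sga) + Qf * Ff * (sg * sa * sga) - Qg * Fg * (sf * sa * sfa) - Qa * Fa * (sf * sg * sgf))"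
    by (simp add: algebra_simps)
  also have "\<dots> = F0 * Pf * (sg * sf * sgf * (sa * sea * sfa * sga * k) + sgf * sfa * sga * (sa * sb * sc * sd * k)) +
      Ff * A * (sg * sa * sga * (sfa * sfb * sfc * sfd * k) - sfa * sa * sf * (sga * sgb * sgc * sgd * k))"
    unfolding h4 r by simp
  also have "\<dots> = F0 * Pf * (sa * sfa * sga * sgf * k * (sea * sf * sg + sb * sc * sd)) - Ff * A * (sa * sfa * sga * k * (sf * sgb * sgc * sgd - sg * sfb * sfc * sfd))"
    by (simp add: algebra_simps)
  also have "\<dots> = sfa * sga * (sb * sc * sd + sea * sf * sg) * k * (F0 * Pf - Ff * A) * (sa * sgf)"
    unfolding trig [symmetric] by (simp add: algebra_simps)
  finally show ?thesis by simp
qed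

definition K_reg :: "complex \<Rightarrow> complex \<Rightarrow> complex \<Rightarrow> complex \<Rightarrow> complex \<Rightarrow> complex \<Rightarrow> complex \<Rightarrow> complex" where
  "K_reg a b c d e f g = F43_reg a b c d e f g * A4 a (1 + a - e) (1 + a - f) (1 + a - g) +
     F43_reg a (1 + a - e) (1 + a - f) (1 + a - g) (1 + a - b) (1 + a - c) (1 + a - d) * A4 a b c d"

definition B_coeff :: "complex \<Rightarrow> complex \<Rightarrow> complex \<Rightarrow> complex \<Rightarrow> complex \<Rightarrow> complex \<Rightarrow> complex \<Rightarrow> complex" where
  "B_coeff a b c d e f g = sp (f - a) * sp (g - a) * (sp b * sp c * sp d + sp (e - a) * sp f * sp g) * (1 / of_real pi ^ 4)"

text \<open>The asserted relation with \<open>L_6bar\<close> replaced by the L based at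
  \<open>1-f\<close> and \<open>1-g\<close>, multiplied by the three sines sp a, sp f and sp (g-f)
  that occur as denominators.\<close>

lemma K_reg_L_reg_relation:
  assumes V: "e + f + g = 1 + a + b + c + d"
  shows "sp g * A4 (1 + a - f) (1 + b - f) (1 + c - f) (1 + d - f) * A4 (1 - a) (e - a) (f - a) (g - a) * K_reg a b c d e f g * (sp f * sp (g - f))
    + sp (f - a) * A4 a b c d * A4 (g - a) (g - b) (g - c) (g - d) * L_reg (1 + a - g) (1 + b - g) (1 + c - g) (1 + d - g) (1 + f - g) (2 - g) (1 + e - g) * (sp a * sp f)
    - B_coeff a b c d e f g * L_reg a b c d f e g * (sp a * sp (g - f)) = 0"
proof -
  define k :: complex where "k = 1 / of_real pi ^ 4"
  have r: "A4 x y z w * A4 (1 - x) (1 - y) (1 - z) (1 - w) = sp x * sp y * sp z * sp w * k" for x y z w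
  proof -
    have "A4 x y z w * A4 (1 - x) (1 - y) (1 - z) (1 - w) = (rGamma x * rGamma (1 - x)) * (rGamma y * rGamma (1 - y)) * (rGamma z * rGamma (1 - z)) * (rGamma w * rGamma (1 - w))"
      by (simp only: A4_def mult_ac)
    then show ?thesis unfolding rGamma_reflect by (simp add: k_def power4_eq_xxxx)
  qed
  have r1: "A4 (1 + x1 - y) (1 + x2 - y) (1 + x3 - y) (1 + x4 - y) * A4 (y - x1) (y - x2) (y - x3) (y - x4) = sp (y - x1) * sp (y - x2) * sp (y - x3) * sp (y - x4) * k" for x1 x2 x3 x4 y
    using r[of "y - x1" "y - x2" "y - x3" "y - x4"] by (simp add: mult.commute diff_diff_eq2)
  have r2: "A4 a (1 + a - e) (1 + a - f) (1 + a - g) * A4 (1 - a) (e - a) (f - a) (g - a) = sp a * sp (e - a) * sp (f - a) * sp (g - a) * k"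
    using r[of a "1 + a - e" "1 + a - f" "1 + a - g"] sp_simps(1)[of "e - a"] sp_simps(1)[of "f - a"] sp_simps(1)[of "g - a"]
    by (simp add: algebra_simps)
  have trig: "sp (e - a) * sp f * sp g * sp (g - f) + sp b * sp c * sp d * sp (g - f) =
      sp f * sp (g - b) * sp (g - c) * sp (g - d) - sp g * sp (f - b) * sp (f - c) * sp (f - d)"
  proof -
    have "e - a = 1 - (f + g - b - c - d)" using V by (simp add: algebra_simps)
    then have "sp (e - a) = sp (f + g - b - c - d)" by (simp only: sp_simps)
    then show ?thesis
      using trig_identity[of "of_real pi * f" "of_real pi * g" "of_real pi * b" "of_real pi * c" "of_real pi * d"]
      by (simp add: sp_def right_diff_distrib distrib_left)
  qed
  have L1: "L_reg a b c d f e g = F43_reg a b c d e f g * A4 (1 + a - f) (1 + b - f) (1 + c - f) (1 + d - f) -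
     F43_reg (1 + a - f) (1 + b - f) (1 + c - f) (1 + d - f) (2 - f) (1 + e - f) (1 + g - f) * A4 a b c d"
    unfolding L_reg_def A4_def F43_reg_perm_lower(1)[of a b c d f] ..
  have t: "1 + (1 + x - g) - (1 + f - g) = 1 + x - f" "2 - (1 + f - g) = 1 + g - f" "1 + (2 - g) - (1 + f - g) = 2 - f" for x
    by simp_all
  have L2: "L_reg (1 + a - g) (1 + b - g) (1 + c - g) (1 + d - g) (1 + f - g) (2 - g) (1 + e - g) = 
     F43_reg (1 + a - g) (1 + b - g) (1 + c - g) (1 + d - g) (1 + f - g) (2 - g) (1 + e - g) * A4 (1 + a - f) (1 + b - f) (1 + c - f) (1 + d - f) -
     F43_reg (1 + a - f) (1 + b - f) (1 + c - f) (1 + d - f) (2 - f) (1 + e - f) (1 + g - f) * A4 (1 + a - g) (1 + b - g) (1 + c - g) (1 + d - g)"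
    unfolding L_reg_def A4_def t F43_reg_perm_lower(2)[of "1 + a - f" "1 + b - f" "1 + c - f" "1 + d - f" "1 + g - f" "2 - f" "1 + e - f"] ..
  show ?thesis
    unfolding L1 L2 K_reg_def B_coeff_def k_def [symmetric]
    by (rule core_algebra[OF four_series_relation[OF V] r r1 r1 r2 trig])
qed

text \<open>The left side of the theorem times sp a * sp f * sp (2-e). No division is left, so it is
  holomorphic along lines.\<close>

definition relation_defect :: "complex \<Rightarrow> complex \<Rightarrow> complex \<Rightarrow> complex \<Rightarrow> complex \<Rightarrow> complex \<Rightarrow> complex \<Rightarrow> complex" where
  "relation_defect a b c d e f g =
     sp g * A4 (1 + a - f) (1 + b - f) (1 + c - f) (1 + d - f) * A4 (1 - a) (e - a) (f - a) (g - a) * K_reg a b c d e f g * (sp f * sp (2 - e))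
    + sp (f - a) * A4 a b c d * A4 (g - a) (g - b) (g - c) (g - d) * L_reg (1 - a) (1 - b) (1 - c) (1 - d) (2 - e) (2 - f) (2 - g) * (sp a * sp f)
    - B_coeff a b c d e f g * L_reg a b c d f e g * (sp a * sp (2 - e))"

lemma relation_defect_generic:
  assumes V: "e + f + g = 1 + a + b + c + d" and nz: "1 - a - b + f \<notin> \<int>" "e + f - a - b \<notin> \<int>" "g - f \<notin> \<int>"
  shows "relation_defect a b c d e f g = 0"
proof -
  have gf: "sp (g - f) \<noteq> 0" using nz(3) by (simp add: sp_def sin_pi_eq_0_iff)
  have "1 + f - g = 1 - (g - f)" by simp
  then have "sp (1 + f - g) = sp (g - f)" by (simp only: sp_simps)
  with L_six_bar[OF V nz(1,2)] have L: "sp (g - f) * L_reg (1 - a) (1 - b) (1 - c) (1 - d) (2 - e) (2 - f) (2 - g) =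
    sp (2 - e) * L_reg (1 + a - g) (1 + b - g) (1 + c - g) (1 + d - g) (1 + f - g) (2 - g) (1 + e - g)"
    by (simp only: sp_def)
  have *: "s * (x1 * k * (y1 * t) + x2 * l * y2 - x3 * z * (w * t)) = t * (x1 * k * (y1 * s) + x2 * l' * y2 - x3 * z * (w * s))"
    if "s * l = t * l'" for s t x1 x2 x3 k l l' y1 y2 z w :: complex
    using that by algebra
  have "sp (g - f) * relation_defect a b c d e f g = 0"
    unfolding relation_defect_def *[OF L] K_reg_L_reg_relation[OF V] by simp
  then show ?thesis using gf by simp
qed

lemma relation_defect_zero:
  assumes V: "e + f + g = 1 + a + b + c + d"
  shows "relation_defect a b c d e f g = 0"
proof -
  define A where "A = line a \<i>"
  define B where "B = line b (2 * \<i>)"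
  define C where "C = line c (4 * \<i>)"
  define D where "D = line d (8 * \<i>)"
  define F where "F = line f (32 * \<i>)"
  define G where "G = line g (64 * \<i>)"
  \<comment> \<open>Forced by the balance condition: 1 + 2 + 4 + 8 - 32 - 64 = -81. The three
    combinations to be kept off the integers then have imaginary parts 29, -52 and 32.\<close>
  define E where "E = line e (1 - 81 * \<i>)"
  note defs = A_def B_def C_def D_def E_def F_def G_def
  have VV: "E u + F u + G u = 1 + A u + B u + C u + D u" for u
  proof -
    have "E u + F u + G u - (1 + A u + B u + C u + D u) = (1 - u) * (e + f + g - (1 + a + b + c + d))"
      unfolding defs line_def by (simp add: algebra_simps)
    then show ?thesis using V by simp
  qed
  have hol: "A holomorphic_on UNIV" "B holomorphic_on UNIV" "C holomorphic_on UNIV" "D holomorphic_on UNIV"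
    "E holomorphic_on UNIV" "F holomorphic_on UNIV" "G holomorphic_on UNIV"
    unfolding defs by (intro holomorphic_intros)+
  have con: "isCont A 1" "isCont B 1" "isCont C 1" "isCont D 1" "isCont E 1" "isCont F 1" "isCont G 1"
    unfolding defs by (intro continuous_intros)+
  have one: "A 1 = \<i>" "B 1 = 2 * \<i>" "C 1 = 4 * \<i>" "D 1 = 8 * \<i>" "F 1 = 32 * \<i>" "G 1 = 64 * \<i>" "E 1 = 1 - 81 * \<i>"
    unfolding defs by simp_all
  have "(\<lambda>u. relation_defect (A u) (B u) (C u) (D u) (E u) (F u) (G u)) holomorphic_on UNIV"
    unfolding relation_defect_def K_reg_def B_coeff_def A4_def sp_def
    by (intro holomorphic_on_add holomorphic_on_diff holomorphic_on_mult holomorphic_on_const holomorphic_on_sin' holomorphic_rGamma'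
      holomorphic_F43_reg holomorphic_L_reg hol) (use VV in \<open>simp_all add: algebra_simps\<close>)
  moreover have "eventually (\<lambda>u. relation_defect (A u) (B u) (C u) (D u) (E u) (F u) (G u) = 0) (at 1)"
  proof -
    have "eventually (\<lambda>u. 1 - A u - B u + F u \<notin> \<int> \<and> E u + F u - A u - B u \<notin> \<int> \<and> G u - F u \<notin> \<int>) (at 1)"
      by (intro eventually_conj eventually_Im_nonzero continuous_intros con) (simp_all add: one)
    then show ?thesis by eventually_elim (rule relation_defect_generic[OF VV]; blast)
  qed
  ultimately have "relation_defect (A 0) (B 0) (C 0) (D 0) (E 0) (F 0) (G 0) = 0" by (rule holomorphic_zero_if_eventually)
  then show ?thesis by (simp add: defs)
qed

section \<open>Return to the unregularised functions\<close>

lemma F43_reg_eq: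
  assumes V: "e + f + g = 1 + a + b + c + d" and np: "e \<notin> \<int>\<^sub>\<le>\<^sub>0" "f \<notin> \<int>\<^sub>\<le>\<^sub>0" "g \<notin> \<int>\<^sub>\<le>\<^sub>0"
  shows "F43_reg a b c d e f g = F43 a b c d e f g * (rGamma e * rGamma f * rGamma g)"
proof -
  define t where "t n = (pochhammer a n * pochhammer b n * pochhammer c n * pochhammer d n) /
           (fact n * pochhammer e n * pochhammer f n * pochhammer g n)" for n
  have r: "rGamma (x + of_nat n) = rGamma x / pochhammer x n" if "x \<notin> \<int>\<^sub>\<le>\<^sub>0" for x :: complex and n
  proof -
    have "pochhammer x n \<noteq> 0" using that by (auto simp: pochhammer_eq_0_iff)
    then show ?thesis using pochhammer_rGamma[of x n] by (simp add: field_simps)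
  qed
  have eq: "pochhammer a n * pochhammer b n * pochhammer c n * pochhammer d n / fact n *
     (rGamma (e + of_nat n) * rGamma (f + of_nat n) * rGamma (g + of_nat n)) = t n * (rGamma e * rGamma f * rGamma g)" for n
    unfolding r[OF np(1)] r[OF np(2)] r[OF np(3)] t_def by (simp add: mult_ac)
  have nz: "rGamma e * rGamma f * rGamma g \<noteq> 0" using np by (simp add: rGamma_eq_zero_iff)
  have "saalschutz_terms (\<lambda>n u. pochhammer a n * pochhammer b n * pochhammer c n * pochhammer d n / fact n *
     (rGamma (e + of_nat n) * rGamma (f + of_nat n) * rGamma (g + of_nat n))) (\<lambda>_. a) (\<lambda>_. b) (\<lambda>_. c) (\<lambda>_. d) (\<lambda>_. e) (\<lambda>_. f) (\<lambda>_. g) (\<lambda>_. 1)"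
    by (rule F43_terms) (use V in auto)
  then have "summable (\<lambda>n. t n * (rGamma e * rGamma f * rGamma g))"
    using saalschutz_terms.summable_terms unfolding eq by blast
  \<comment> \<open>Convergence is inherited from the regularised series by dividing out a nonzero
    constant; it is needed to move that constant through the sum.\<close>
  then have "summable t" using nz by (simp add: mult.commute[of _ "rGamma e * rGamma f * rGamma g"])
  then show ?thesis unfolding F43_reg_def eq F43_def t_def[symmetric] by (rule suminf_mult2[symmetric])
qed

lemma K_fun_eq:
  assumes V: "e + f + g = 1 + a + b + c + d" and K: "K_defined a b c d e f g"
  shows "K_fun a b c d e f g = K_reg a b c d e f g / sp a"
proof -
  have "F43_reg a b c d e f g = F43 a b c d e f g * (rGamma e * rGamma f * rGamma g)"
    by (rule F43_reg_eq[OF V]) (use K in \<open>auto simp: K_defined_def\<close>)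
  moreover have "F43_reg a (1 + a - e) (1 + a - f) (1 + a - g) (1 + a - b) (1 + a - c) (1 + a - d) =
    F43 a (1 + a - e) (1 + a - f) (1 + a - g) (1 + a - b) (1 + a - c) (1 + a - d) * (rGamma (1 + a - b) * rGamma (1 + a - c) * rGamma (1 + a - d))"
    by (rule F43_reg_eq) (use V K in \<open>auto simp: K_defined_def algebra_simps\<close>)
  ultimately show ?thesis
    unfolding K_fun_def K_reg_def A4_def sp_def by (simp add: add_divide_distrib mult_ac)
qed

lemma L_fun_eq:
  assumes V: "e + f + g = 1 + a + b + c + d" and L: "L_defined a b c d e f g"
  shows "L_fun a b c d e f g = L_reg a b c d e f g / sp e"
proof -
  have "F43_reg a b c d e f g = F43 a b c d e f g * (rGamma e * rGamma f * rGamma g)"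
    by (rule F43_reg_eq[OF V]) (use L in \<open>auto simp: L_defined_def\<close>)
  moreover have "F43_reg (1 + a - e) (1 + b - e) (1 + c - e) (1 + d - e) (2 - e) (1 + f - e) (1 + g - e) =
    F43 (1 + a - e) (1 + b - e) (1 + c - e) (1 + d - e) (2 - e) (1 + f - e) (1 + g - e) * (rGamma (2 - e) * rGamma (1 + f - e) * rGamma (1 + g - e))"
    by (rule F43_reg_eq) (use V L in \<open>auto simp: L_defined_def algebra_simps\<close>)
  ultimately show ?thesis
    unfolding L_fun_def L_reg_def sp_def by (simp add: diff_divide_distrib mult_ac)
qed

theorem proposition6p8:
  fixes a b c d e f g :: complex and x :: param
  assumes "x = (a, b, c, d, e, f, g)"
    and "x \<in> V"
    and "K_p0_defined x" and "L_6bar_defined x" and "L_5_defined x"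
  shows "sinpi [g] * A4 (1 + a - f) (1 + b - f) (1 + c - f) (1 + d - f)
           * A4 (1 - a) (e - a) (f - a) (g - a) * K_p0 x
         + sinpi [f - a] * A4 a b c d * A4 (g - a) (g - b) (g - c) (g - d) * L_6bar x
         - B_4 x * L_5 x = 0"
proof -
  have V: "e + f + g = 1 + a + b + c + d" using assms(1,2) by (simp add: V_def algebra_simps)
  have K: "K_defined a b c d e f g" and L6: "L_defined (1 - a) (1 - b) (1 - c) (1 - d) (2 - e) (2 - f) (2 - g)" and L5: "L_defined a b c d f e g"
    using assms by simp_all
  \<comment> \<open>Definedness of the three functions supplies, one each, the sines by which
    \<open>relation_defect\<close> exceeds the claimed expression.\<close>
  have nz: "sp a \<noteq> 0" "sp (2 - e) \<noteq> 0" "sp f \<noteq> 0"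
    using K L6 L5 by (simp_all add: K_defined_def L_defined_def sp_def)
  have k: "K_p0 x = K_reg a b c d e f g / sp a" using K_fun_eq[OF V K] assms(1) by simp
  have l6: "L_6bar x = L_reg (1 - a) (1 - b) (1 - c) (1 - d) (2 - e) (2 - f) (2 - g) / sp (2 - e)"
    unfolding assms(1) L_6bar.simps by (rule L_fun_eq[OF _ L6]) (use V in \<open>simp add: algebra_simps\<close>)
  have l5: "L_5 x = L_reg a b c d f e g / sp f"
    unfolding assms(1) L_5.simps by (rule L_fun_eq[OF _ L5]) (use V in \<open>simp add: algebra_simps\<close>)
  have B: "B_4 x = B_coeff a b c d e f g" and s: "sinpi [y] = sp y" for y
    unfolding assms(1) B_4.simps B_coeff_def sinpi_def sp_def by (simp_all add: mult.assoc)
  have *: "x1 * (k / s1) + x2 * (l / s2) - x3 * (m / s3) = (x1 * k * (s3 * s2) + x2 * l * (s1 * s3) - x3 * m * (s1 * s2)) / (s1 * s2 * s3)"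
    if "s1 \<noteq> 0" "s2 \<noteq> 0" "s3 \<noteq> 0" for x1 x2 x3 k l m s1 s2 s3 :: complex
    using that by (simp add: field_simps)
  have "relation_defect a b c d e f g = 0" by (rule relation_defect_zero[OF V])
  then show ?thesis unfolding k l6 l5 B s *[OF nz] relation_defect_def by simp
qed

end
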